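(* Let $(X,R,\tau)$ be a generalized circularly ordered topological space (GCOTS). Let $\operatorname{Comp}_{\mathrm{COP}}(X)$ be the poset of proper COP compactifications $j:X\to Y$ of $(X,R,\tau)$, and let $\operatorname{Unif}_{\mathrm{GCO}}(X)$ be the poset of precompact GCO-uniformities on $(X,R,\tau)$, partially ordered by inclusion. There is a natural order anti-isomorphism $$\operatorname{Comp}_{\mathrm{COP}}(X)\ \longleftrightarrow\ \operatorname{Unif}_{\mathrm{GCO}}(X),$$ sending a compactification $j:X\to(Y,R_Y)$ to the uniformity $\mathcal U_Y$ on $X$ pulled back via $j$ from the unique compatible uniformity of $Y$, and a GCO-uniformity $\mathcal U$ to the completion compactification $X\to\widehat X$ of $(X,\mathcal U)$, where $\widehat X$ carries its canonical circular order.
   Context: A circular order on a set $X$ is a ternary relation $R\subseteq X^3$ (write $[a,b,c]$ for $(a,b,c)\in R$) satisfying: cyclicity ($[a,b,c]\Rightarrow[b,c,a]$); asymmetry ($[a,b,c]\Rightarrow (c,b,a)\notin R$); transitivity ($[a,b,c]$ and $[a,c,d]$ imply $[a,b,d]$); totality (if $a,b,c$ are distinct then $[a,b,c]$ or $[a,c,b]$). Put $(a,b)_R:=\{x\in X:[a,x,b]\}$ and $[a,b]_R:=(a,b)_R\cup\{a,b\}$. The interval topology $\lambda_R$ is the topology on $X$ with base $\{X\setminus[a,b]_R: a,b\in X\}\cup\{X\}$. A bi-embedding of $(X,R,\tau)$ into a circularly ordered set $(Y,R_Y)$ is an injection $i:X\to Y$ that is a topological embedding of $(X,\tau)$ into $(Y,\lambda_{R_Y})$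 and satisfies $[a,b,c]_R\iff[i(a),i(b),i(c)]_{R_Y}$. A GCOTS is a triple $(X,R,\tau)$ ($R$ a circular order, $\tau$ a topology on $X$) admitting a bi-embedding into some circularly ordered set with its interval topology. A proper COP compactification of $(X,R,\tau)$ is a bi-embedding $j:X\to Y$ with dense image into a circularly ordered set $(Y,R_Y)$ with compact interval topology. Compactifications are considered up to equivalence and ordered as usual: $j_1\le j_2$ (that is, $j_2:X\to Y_2$ dominates $j_1:X\to Y_1$) if there is a continuous map $F:Y_2\to Y_1$ with $F\circ j_2=j_1$ (such $F$ is automatically circular order preserving). A subset $C\subseteq X$ is convex if for all $a,b\in C$ at least one of $[a,b]_R$, $[b,a]_R$ is contained in $C$. A GCO-uniformity (convex uniformity) on $(X,R,\tau)$ is a $\tau$-compatible (Hausdorff) uniformity, viewed as a family of uniform covers, having a base of covers all of whose members are convex; precompact means that it has a base of finite covers (equivalently, its completion is compact). Canonical circular order on the completion $\widehat X$ of a GCO-uniformity (points of $\widehat X$ being minimal Cauchy filters): for distinct $\Phi,\Psi,\Theta\in\widehat X$, $[\Phi,\Psi,\Theta]$ iff there are a uniform cover $\alpha$ consisting of convex sets and pairwise disjoint $A\in\Phi\cap\alpha$, $B\in\Psi\cap\alpha$, $C\in\Theta\cap\alpha$ such that $[a,b,c]_R$ for all $a\in A,b\in B,c\in C$.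
   Formalization: With compactifications ordered by domination and uniformities by inclusion, the correspondence is proved order preserving, not an anti-isomorphism; the literal "anti" fails for X=(0,1) with compactifications [0,1] and the circle. *)

theory Defs
  imports "HOL-Analysis.Analysis"
begin

section \<open>Circular orders and their interval topologies\<close>

definition circular_order :: "'a set \<Rightarrow> ('a \<times> 'a \<times> 'a) set \<Rightarrow> bool" where
  "circular_order X R \<longleftrightarrow>
     R \<subseteq> X \<times> X \<times> X \<and>
     (\<forall>a b c. (a, b, c) \<in> R \<longrightarrow> (b, c, a) \<in> R) \<and>
     (\<forall>a b c. (a, b, c) \<in> R \<longrightarrow> (c, b, a) \<notin> R) \<and>
     (\<forall>a b c d. (a, b, c) \<in> R \<and> (a, c, d) \<in> R \<longrightarrow> (a, b, d) \<in> R) \<and>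
     (\<forall>a\<in>X. \<forall>b\<in>X. \<forall>c\<in>X. a \<noteq> b \<and> b \<noteq> c \<and> a \<noteq> c \<longrightarrow> (a, b, c) \<in> R \<or> (a, c, b) \<in> R)"

definition closed_arc :: "('a \<times> 'a \<times> 'a) set \<Rightarrow> 'a \<Rightarrow> 'a \<Rightarrow> 'a set" where
  "closed_arc R a b = {x. (a, x, b) \<in> R} \<union> {a, b}"

text \<open>For a circular order the generating family is already a base.\<close>

definition interval_topology :: "'a set \<Rightarrow> ('a \<times> 'a \<times> 'a) set \<Rightarrow> 'a topology" where
  "interval_topology X R =
     topology_generated_by (insert X {X - closed_arc R a b | a b. a \<in> X \<and> b \<in> X})"

definition circ_convex :: "'a set \<Rightarrow> ('a \<times> 'a \<times> 'a) set \<Rightarrow> 'a set \<Rightarrow> bool" where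
  "circ_convex X R C \<longleftrightarrow>
     C \<subseteq> X \<and> (\<forall>a\<in>C. \<forall>b\<in>C. closed_arc R a b \<subseteq> C \<or> closed_arc R b a \<subseteq> C)"

text \<open>From here on a triple \<open>(X, R, \<tau>)\<close> is given by \<open>R\<close> and \<open>T\<close>, with \<open>X = topspace T\<close>.\<close>

definition bi_embedding ::
  "('a \<times> 'a \<times> 'a) set \<Rightarrow> 'a topology \<Rightarrow> 'b set \<Rightarrow> ('b \<times> 'b \<times> 'b) set \<Rightarrow> ('a \<Rightarrow> 'b) \<Rightarrow> bool" where
  "bi_embedding R T Y S i \<longleftrightarrow>
     inj_on i (topspace T) \<and>
     embedding_map T (interval_topology Y S) i \<and>
     (\<forall>a\<in>topspace T. \<forall>b\<in>topspace T. \<forall>c\<in>topspace T. (a, b, c) \<in> R \<longleftrightarrow> (i a, i b, i c) \<in> S)"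

text \<open>HOL cannot quantify over types inside a formula. The type of the ambient circularly ordered
  set is therefore a parameter; a theorem with hypothesis \<open>gcots TYPE('y) R T\<close> and \<open>'y\<close> a free type
  variable covers ambient sets of every type.\<close>

definition gcots :: "'y itself \<Rightarrow> ('a \<times> 'a \<times> 'a) set \<Rightarrow> 'a topology \<Rightarrow> bool" where
  "gcots _ R T \<longleftrightarrow>
     circular_order (topspace T) R \<and>
     (\<exists>(Y :: 'y set) S i. circular_order Y S \<and> bi_embedding R T Y S i)"

section \<open>Covering uniformities\<close>

definition is_cover :: "'a set \<Rightarrow> 'a set set \<Rightarrow> bool" where
  "is_cover X \<alpha> \<longleftrightarrow> \<alpha> \<subseteq> Pow X \<and> \<Union>\<alpha> = X"

text \<open>Empty members are ignored. This only matters for the empty space, whose two covers \<open>{}\<close> and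
  \<open>{{}}\<close> then refine each other, so that it carries exactly one uniformity.\<close>

definition refines :: "'a set set \<Rightarrow> 'a set set \<Rightarrow> bool" where
  "refines \<alpha> \<beta> \<longleftrightarrow> (\<forall>A\<in>\<alpha>. A = {} \<or> (\<exists>B\<in>\<beta>. A \<subseteq> B))"

definition star :: "'a set \<Rightarrow> 'a set set \<Rightarrow> 'a set" where
  "star A \<alpha> = \<Union>{B \<in> \<alpha>. B \<inter> A \<noteq> {}}"

definition star_refines :: "'a set set \<Rightarrow> 'a set set \<Rightarrow> bool" where
  "star_refines \<alpha> \<beta> \<longleftrightarrow> refines {star A \<alpha> | A. A \<in> \<alpha>} \<beta>"

definition uniformity_on :: "'a set \<Rightarrow> 'a set set set \<Rightarrow> bool" where
  "uniformity_on X \<U> \<longleftrightarrow>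
     (\<forall>\<alpha>\<in>\<U>. is_cover X \<alpha>) \<and>
     {X} \<in> \<U> \<and>
     (\<forall>\<alpha>\<in>\<U>. \<forall>\<beta>. is_cover X \<beta> \<and> refines \<alpha> \<beta> \<longrightarrow> \<beta> \<in> \<U>) \<and>
     (\<forall>\<alpha>\<in>\<U>. \<forall>\<beta>\<in>\<U>. \<exists>\<gamma>\<in>\<U>. refines \<gamma> \<alpha> \<and> refines \<gamma> \<beta>) \<and>
     (\<forall>\<alpha>\<in>\<U>. \<exists>\<beta>\<in>\<U>. star_refines \<beta> \<alpha>)"

definition hausdorff_uniformity :: "'a set \<Rightarrow> 'a set set set \<Rightarrow> bool" where
  "hausdorff_uniformity X \<U> \<longleftrightarrow>
     (\<forall>x\<in>X. \<forall>y\<in>X. x \<noteq> y \<longrightarrow> (\<exists>\<alpha>\<in>\<U>. y \<notin> star {x} \<alpha>))"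

definition compatible_uniformity :: "'a topology \<Rightarrow> 'a set set set \<Rightarrow> bool" where
  "compatible_uniformity T \<U> \<longleftrightarrow>
     uniformity_on (topspace T) \<U> \<and>
     hausdorff_uniformity (topspace T) \<U> \<and>
     (\<forall>V. openin T V \<longleftrightarrow> V \<subseteq> topspace T \<and> (\<forall>x\<in>V. \<exists>\<alpha>\<in>\<U>. star {x} \<alpha> \<subseteq> V))"

definition the_uniformity :: "'a topology \<Rightarrow> 'a set set set" where
  "the_uniformity T = (THE \<V>. compatible_uniformity T \<V>)"

definition pullback_uniformity :: "'a set \<Rightarrow> ('a \<Rightarrow> 'b) \<Rightarrow> 'b set set set \<Rightarrow> 'a set set set" where
  "pullback_uniformity X j \<V> =
     {\<alpha>. is_cover X \<alpha> \<and> (\<exists>\<beta>\<in>\<V>. refines {j -` B \<inter> X | B. B \<in> \<beta>} \<alpha>)}"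

definition gco_uniformity :: "('a \<times> 'a \<times> 'a) set \<Rightarrow> 'a topology \<Rightarrow> 'a set set set \<Rightarrow> bool" where
  "gco_uniformity R T \<U> \<longleftrightarrow>
     compatible_uniformity T \<U> \<and>
     (\<forall>\<alpha>\<in>\<U>. \<exists>\<beta>\<in>\<U>. (\<forall>B\<in>\<beta>. circ_convex (topspace T) R B) \<and> refines \<beta> \<alpha>)"

definition precompact_uniformity :: "'a set set set \<Rightarrow> bool" where
  "precompact_uniformity \<U> \<longleftrightarrow> (\<forall>\<alpha>\<in>\<U>. \<exists>\<beta>\<in>\<U>. finite \<beta> \<and> refines \<beta> \<alpha>)"

definition Unif_GCO :: "('a \<times> 'a \<times> 'a) set \<Rightarrow> 'a topology \<Rightarrow> 'a set set set set" where
  "Unif_GCO R T = {\<U>. gco_uniformity R T \<U> \<and> precompact_uniformity \<U>}"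

section \<open>Completion\<close>

text \<open>A filter on \<open>X\<close> is an \<open>'a filter\<close> below \<open>principal X\<close>, and \<open>A \<in> \<Phi>\<close> is rendered as
  \<open>eventually (\<lambda>x. x \<in> A) \<Phi>\<close>. The library order on filters is reverse inclusion, so a filter that
  is minimal with respect to inclusion is maximal for \<open>\<le>\<close>.\<close>

definition filter_mem :: "'a set \<Rightarrow> 'a filter \<Rightarrow> bool" where
  "filter_mem A \<Phi> \<longleftrightarrow> eventually (\<lambda>x. x \<in> A) \<Phi>"

definition cauchy_on :: "'a set \<Rightarrow> 'a set set set \<Rightarrow> 'a filter \<Rightarrow> bool" where
  "cauchy_on X \<U> \<Phi> \<longleftrightarrow>
     \<Phi> \<noteq> bot \<and> \<Phi> \<le> principal X \<and> (\<forall>\<alpha>\<in>\<U>. \<exists>A\<in>\<alpha>. filter_mem A \<Phi>)"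

definition completion :: "'a set \<Rightarrow> 'a set set set \<Rightarrow> 'a filter set" where
  "completion X \<U> =
     {\<Phi>. cauchy_on X \<U> \<Phi> \<and> (\<forall>\<Psi>. cauchy_on X \<U> \<Psi> \<and> \<Phi> \<le> \<Psi> \<longrightarrow> \<Psi> = \<Phi>)}"

definition completion_uniformity :: "'a set \<Rightarrow> 'a set set set \<Rightarrow> 'a filter set set set" where
  "completion_uniformity X \<U> =
     {\<gamma>. is_cover (completion X \<U>) \<gamma> \<and>
          (\<exists>\<alpha>\<in>\<U>. refines {{\<Phi> \<in> completion X \<U>. filter_mem A \<Phi>} | A. A \<in> \<alpha>} \<gamma>)}"

definition completion_order ::
  "('a \<times> 'a \<times> 'a) set \<Rightarrow> 'a set \<Rightarrow> 'a set set set \<Rightarrow> ('a filter \<times> 'a filter \<times> 'a filter) set" where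
  "completion_order R X \<U> =
     {(\<Phi>, \<Psi>, \<Theta>).
        \<Phi> \<in> completion X \<U> \<and> \<Psi> \<in> completion X \<U> \<and> \<Theta> \<in> completion X \<U> \<and>
        \<Phi> \<noteq> \<Psi> \<and> \<Psi> \<noteq> \<Theta> \<and> \<Phi> \<noteq> \<Theta> \<and>
        (\<exists>\<alpha>\<in>\<U>. (\<forall>A\<in>\<alpha>. circ_convex X R A) \<and>
          (\<exists>A\<in>\<alpha>. \<exists>B\<in>\<alpha>. \<exists>C\<in>\<alpha>.
             filter_mem A \<Phi> \<and> filter_mem B \<Psi> \<and> filter_mem C \<Theta> \<and>
             A \<inter> B = {} \<and> B \<inter> C = {} \<and> A \<inter> C = {} \<and>
             (\<forall>a\<in>A. \<forall>b\<in>B. \<forall>c\<in>C. (a, b, c) \<in> R)))}"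

section \<open>Proper COP compactifications\<close>

record ('a, 'b) compactification =
  points :: "'b set"
  circ :: "('b \<times> 'b \<times> 'b) set"
  emb :: "'a \<Rightarrow> 'b"

definition ctop :: "('a, 'b) compactification \<Rightarrow> 'b topology" where
  "ctop c = interval_topology (points c) (circ c)"

definition proper_cop ::
  "('a \<times> 'a \<times> 'a) set \<Rightarrow> 'a topology \<Rightarrow> ('a, 'b) compactification \<Rightarrow> bool" where
  "proper_cop R T c \<longleftrightarrow>
     circular_order (points c) (circ c) \<and>
     compact_space (ctop c) \<and>
     bi_embedding R T (points c) (circ c) (emb c) \<and>
     ctop c closure_of (emb c ` topspace T) = points c"

text \<open>\<open>comp_le T c d\<close> says that \<open>d\<close> dominates \<open>c\<close>. The map \<open>F\<close> is uniformly continuous, so the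
  pulled back uniformities satisfy \<open>unif_of T c \<subseteq> unif_of T d\<close>: the correspondence preserves
  \<open>comp_le\<close>, and it is order reversing with respect to the direction \<open>d \<rightarrow> c\<close> of the maps \<open>F\<close>.\<close>

definition comp_le ::
  "'a topology \<Rightarrow> ('a, 'b) compactification \<Rightarrow> ('a, 'c) compactification \<Rightarrow> bool" where
  "comp_le T c d \<longleftrightarrow>
     (\<exists>F. continuous_map (ctop d) (ctop c) F \<and> (\<forall>x\<in>topspace T. F (emb d x) = emb c x))"

definition comp_equivalent ::
  "'a topology \<Rightarrow> ('a, 'b) compactification \<Rightarrow> ('a, 'c) compactification \<Rightarrow> bool" where
  "comp_equivalent T c d \<longleftrightarrow>
     (\<exists>h. homeomorphic_map (ctop c) (ctop d) h \<and>
          (\<forall>x\<in>topspace T. h (emb c x) = emb d x) \<and>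
          (\<forall>u\<in>points c. \<forall>v\<in>points c. \<forall>w\<in>points c.
             (u, v, w) \<in> circ c \<longleftrightarrow> (h u, h v, h w) \<in> circ d))"

definition unif_of :: "'a topology \<Rightarrow> ('a, 'b) compactification \<Rightarrow> 'a set set set" where
  "unif_of T c = pullback_uniformity (topspace T) (emb c) (the_uniformity (ctop c))"

text \<open>The canonical map into the completion sends a point to its neighbourhood filter.\<close>

definition completion_cpt ::
  "('a \<times> 'a \<times> 'a) set \<Rightarrow> 'a topology \<Rightarrow> 'a set set set \<Rightarrow> ('a, 'a filter) compactification" where
  "completion_cpt R T \<U> =
     \<lparr>points = completion (topspace T) \<U>,
      circ = completion_order R (topspace T) \<U>,
      emb = nhdsin T\<rparr>"

text \<open>The poset of equivalence classes is formed from compactifications whose points are of type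
  \<open>'a filter\<close>, the type of the points of the completions. That this loses nothing, i.e. that a
  compactification with points of any other type is equivalent to one of these, has to be stated
  alongside.\<close>

definition comp_equiv_rel ::
  "('a \<times> 'a \<times> 'a) set \<Rightarrow> 'a topology \<Rightarrow>
   (('a, 'a filter) compactification \<times> ('a, 'a filter) compactification) set" where
  "comp_equiv_rel R T = {(c, d). proper_cop R T c \<and> proper_cop R T d \<and> comp_equivalent T c d}"

definition Comp_COP ::
  "('a \<times> 'a \<times> 'a) set \<Rightarrow> 'a topology \<Rightarrow> ('a, 'a filter) compactification set set" where
  "Comp_COP R T = {c. proper_cop R T c} // comp_equiv_rel R T"

definition comp_class ::
  "('a \<times> 'a \<times> 'a) set \<Rightarrow> 'a topology \<Rightarrow> ('a, 'a filter) compactification \<Rightarrow>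
   ('a, 'a filter) compactification set" where
  "comp_class R T c = comp_equiv_rel R T `` {c}"

definition comp_order ::
  "('a \<times> 'a \<times> 'a) set \<Rightarrow> 'a topology \<Rightarrow>
   (('a, 'a filter) compactification set \<times> ('a, 'a filter) compactification set) set" where
  "comp_order R T =
     {(K, L). K \<in> Comp_COP R T \<and> L \<in> Comp_COP R T \<and> (\<exists>c\<in>K. \<exists>d\<in>L. comp_le T c d)}"

end

theory Submission
  imports Defs
begin

text \<open>A compact Hausdorff space has exactly one compatible uniformity, generated by its open covers, and
  an interval topology is Hausdorff with a base of open convex sets. Pulling back finite covers by
  such sets shows that a compactification induces a precompact convex uniformity. Conversely, in the
  completion of such a uniformity three distinct minimal Cauchy filters contain pairwise disjoint
  convex sets of one uniform cover. Disjoint convex sets are uniformly oriented, so the canonical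
  relation is total, hence a circular order with open arcs. Its Hausdorff interval topology is thus
  coarser than the compact topology of the completion, and the two coincide.

  Uniformities determine compactifications because the embedding into one compactification extends
  continuously to another as soon as it is uniformly continuous; a homeomorphism of compactifications
  over \<open>X\<close> preserves the order by density, orientation being an open condition.\<close>

section \<open>Covering uniformities\<close>

text \<open>Everything is compared on \<open>X\<close> itself: two compactifications may have points
  of different types, but the uniformities that they induce are families of covers of
  \<open>X\<close>. Domination becomes inclusion and equivalence becomes equality of these families,
  so the quotient and its order are read off from the injective map \<open>class_unif\<close>.

  The canonical relation is awkward to use directly, because two of its instances bring two
  unrelated covers and different representatives. \<open>completion_order_iff\<close> describes it
  without covers, convexity or disjointness; asymmetry and transitivity then need only that two
  members of one Cauchy filter have a common point.

  Members of uniform covers need not be open, and Cauchy filters need not be minimal. Two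
  constructions repair this: \<open>uinterior\<close> turns a uniform cover into an open one, and
  \<open>rounding\<close> turns a Cauchy filter into the minimal one that it contains. The
  neighbourhood filter of a point belongs to the completion because it is the rounding of the
  principal filter at that point.\<close>

lemma is_coverD: "is_cover X \<alpha> \<Longrightarrow> x \<in> X \<Longrightarrow> \<exists>A\<in>\<alpha>. x \<in> A"
  by (auto simp: is_cover_def)

lemma star_singleton: "star {x} \<alpha> = \<Union>{B \<in> \<alpha>. x \<in> B}"
  by (auto simp: star_def)

lemma star_mono: "A \<subseteq> B \<Longrightarrow> star A \<alpha> \<subseteq> star B \<alpha>"
  by (auto simp: star_def)

lemma refines_refl: "refines \<alpha> \<alpha>"
  by (auto simp: refines_def)

lemma refinesI: "(\<And>A. A \<in> \<alpha> \<Longrightarrow> A \<noteq> {} \<Longrightarrow> \<exists>B\<in>\<beta>. A \<subseteq> B) \<Longrightarrow> refines \<alpha> \<beta>"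
  unfolding refines_def by blast

lemma refinesD: "refines \<alpha> \<beta> \<Longrightarrow> A \<in> \<alpha> \<Longrightarrow> A \<noteq> {} \<Longrightarrow> \<exists>B\<in>\<beta>. A \<subseteq> B"
  unfolding refines_def by blast

lemma refines_trans: "refines \<alpha> \<beta> \<Longrightarrow> refines \<beta> \<gamma> \<Longrightarrow> refines \<alpha> \<gamma>"
proof (rule refinesI)
  fix A assume r: "refines \<alpha> \<beta>" "refines \<beta> \<gamma>" and A: "A \<in> \<alpha>" "A \<noteq> {}"
  obtain B where "B \<in> \<beta>" "A \<subseteq> B"
    using refinesD[OF r(1) A] by blast
  moreover from this obtain C where "C \<in> \<gamma>" "B \<subseteq> C"
    using refinesD[OF r(2)] A(2) by blast
  ultimately show "\<exists>B\<in>\<gamma>. A \<subseteq> B"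
    by blast
qed

lemma star_refinement_mono: "refines \<beta> \<alpha> \<Longrightarrow> star A \<beta> \<subseteq> star A \<alpha>"
proof
  fix x assume r: "refines \<beta> \<alpha>" and "x \<in> star A \<beta>"
  then obtain B where B: "B \<in> \<beta>" "B \<inter> A \<noteq> {}" "x \<in> B"
    unfolding star_def by blast
  then obtain C where "C \<in> \<alpha>" "B \<subseteq> C"
    using refinesD[OF r] by blast
  then show "x \<in> star A \<alpha>"
    using B unfolding star_def by blast
qed

text \<open>\<open>refines\<close> skips empty members. A nonempty \<open>B\<close> has a nonempty
  star, to which the refinement therefore applies.\<close>

lemma star_refinesD:
  assumes "star_refines \<beta> \<alpha>" "B \<in> \<beta>" "B \<noteq> {}"
  obtains A where "A \<in> \<alpha>" "star B \<beta> \<subseteq> A"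
proof -
  have "B \<subseteq> star B \<beta>"
    using assms by (auto simp: star_def)
  moreover have "star B \<beta> \<in> {star A \<beta> |A. A \<in> \<beta>}"
    using assms(2) by blast
  ultimately have "\<exists>A\<in>\<alpha>. star B \<beta> \<subseteq> A"
    using refinesD[OF assms(1)[unfolded star_refines_def], of "star B \<beta>"] assms(3) by blast
  then show thesis
    using that by blast
qed

lemma star_refinesI:
  assumes "\<And>B. B \<in> \<beta> \<Longrightarrow> B \<noteq> {} \<Longrightarrow> \<exists>A\<in>\<alpha>. star B \<beta> \<subseteq> A"
  shows "star_refines \<beta> \<alpha>"
  unfolding star_refines_def
proof (rule refinesI)
  fix S assume "S \<in> {star B \<beta> |B. B \<in> \<beta>}" "S \<noteq> {}"
  then obtain B where "B \<in> \<beta>" "S = star B \<beta>" "B \<noteq> {}"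
    unfolding star_def by blast
  then show "\<exists>A\<in>\<alpha>. S \<subseteq> A"
    using assms by blast
qed

section \<open>Uniform covers and the topology of a uniformity\<close>

locale covering_uniformity =
  fixes X :: "'a set" and U :: "'a set set set"
  assumes uniformity: "uniformity_on X U"
begin

lemma cover: "\<alpha> \<in> U \<Longrightarrow> is_cover X \<alpha>"
  and trivial_cover: "{X} \<in> U"
  and coarser_cover: "\<alpha> \<in> U \<Longrightarrow> is_cover X \<beta> \<Longrightarrow> refines \<alpha> \<beta> \<Longrightarrow> \<beta> \<in> U"
  and common_refinement: "\<alpha> \<in> U \<Longrightarrow> \<beta> \<in> U \<Longrightarrow> \<exists>\<gamma>\<in>U. refines \<gamma> \<alpha> \<and> refines \<gamma> \<beta>"
  and star_refinement: "\<alpha> \<in> U \<Longrightarrow> \<exists>\<beta>\<in>U. star_refines \<beta> \<alpha>"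
  using uniformity unfolding uniformity_on_def by blast+

lemma member_subset: "\<alpha> \<in> U \<Longrightarrow> A \<in> \<alpha> \<Longrightarrow> A \<subseteq> X"
  using cover unfolding is_cover_def by blast

lemma member_containing: "\<alpha> \<in> U \<Longrightarrow> x \<in> X \<Longrightarrow> \<exists>A\<in>\<alpha>. x \<in> A"
  using cover[of \<alpha>] unfolding is_cover_def by blast

lemma in_star_self: "\<alpha> \<in> U \<Longrightarrow> x \<in> X \<Longrightarrow> x \<in> star {x} \<alpha>"
  using member_containing[of \<alpha> x] by (auto simp: star_singleton)

lemma star_subset: "\<alpha> \<in> U \<Longrightarrow> star A \<alpha> \<subseteq> X"
  using member_subset by (auto simp: star_def)

lemma finite_common_refinement:
  assumes "finite F" "\<And>i. i \<in> F \<Longrightarrow> g i \<in> U"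
  shows "\<exists>\<delta>\<in>U. \<forall>i\<in>F. refines \<delta> (g i)"
  using assms
proof (induction F)
  case empty
  then show ?case using trivial_cover by blast
next
  case (insert i F)
  then obtain \<delta> where "\<delta> \<in> U" "\<forall>i\<in>F. refines \<delta> (g i)"
    by auto
  moreover obtain \<epsilon> where "\<epsilon> \<in> U" "refines \<epsilon> \<delta>" "refines \<epsilon> (g i)"
    using common_refinement[OF \<open>\<delta> \<in> U\<close>, of "g i"] insert.prems by auto
  ultimately show ?case
    by (metis insertE refines_trans)
qed

text \<open>Members of uniform covers need not be open; this is their interior in the topology that
  \<open>U\<close> induces, expressed through stars alone.\<close>

definition uinterior :: "'a set \<Rightarrow> 'a set" where
  "uinterior A = {x \<in> X. \<exists>\<alpha>\<in>U. star {x} \<alpha> \<subseteq> A}"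

lemma uinterior_subset: "uinterior A \<subseteq> A"
  unfolding uinterior_def using in_star_self by fast

lemma in_uinterior_star: "\<alpha> \<in> U \<Longrightarrow> x \<in> X \<Longrightarrow> x \<in> uinterior (star {x} \<alpha>)"
  unfolding uinterior_def by blast

text \<open>Let \<beta> star-refine \<alpha>. If \<open>x\<close> and \<open>y\<close> share a
  member \<open>B\<close> of \<beta>, the \<beta>-star of \<open>y\<close> lies in the star of
  \<open>B\<close>, hence in one member of \<alpha>. This member contains \<open>x\<close>, so the
  \<beta>-star of \<open>y\<close> stays inside the \<alpha>-star of \<open>x\<close>.\<close>

lemma uinterior_open:
  assumes "x \<in> uinterior A"
  shows "\<exists>\<beta>\<in>U. star {x} \<beta> \<subseteq> uinterior A"
proof -
  obtain \<alpha> where \<alpha>: "\<alpha> \<in> U" "star {x} \<alpha> \<subseteq> A" and x: "x \<in> X"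
    using assms unfolding uinterior_def by blast
  obtain \<beta> where \<beta>: "\<beta> \<in> U" "star_refines \<beta> \<alpha>"
    using star_refinement[OF \<alpha>(1)] by blast
  have "y \<in> uinterior A" if "y \<in> star {x} \<beta>" for y
  proof -
    obtain B where B: "B \<in> \<beta>" "x \<in> B" "y \<in> B"
      using \<open>y \<in> star {x} \<beta>\<close> unfolding star_singleton by blast
    then obtain A' where A': "A' \<in> \<alpha>" "star B \<beta> \<subseteq> A'"
      using star_refinesD[OF \<beta>(2)] by blast
    have "star {y} \<beta> \<subseteq> star B \<beta>"
      using B by (intro star_mono) auto
    moreover have "x \<in> star B \<beta>"
      using B by (auto simp: star_def)
    ultimately have "star {y} \<beta> \<subseteq> star {x} \<alpha>"
      using A' by (auto simp: star_singleton)
    then show ?thesis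
      using \<alpha>(2) \<beta>(1) B member_subset unfolding uinterior_def by blast
  qed
  then show ?thesis
    using \<beta>(1) by blast
qed

text \<open>If a member of \<alpha> contains the whole star of \<open>B\<close>, it contains the
  \<beta>-star of each point of \<open>B\<close>. It follows that open uniform covers form a
  base.\<close>

lemma star_refines_uinterior:
  assumes "\<beta> \<in> U" "star_refines \<beta> \<alpha>"
  shows "refines \<beta> (uinterior ` \<alpha>)"
proof (rule refinesI)
  fix B assume B: "B \<in> \<beta>" "B \<noteq> {}"
  then obtain A where A: "A \<in> \<alpha>" "star B \<beta> \<subseteq> A"
    using star_refinesD assms(2) by blast
  have "B \<subseteq> uinterior A"
  proof
    fix x assume "x \<in> B"
    then have "star {x} \<beta> \<subseteq> A"
      using A(2) star_mono[of "{x}" B \<beta>] by auto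
    then show "x \<in> uinterior A"
      using \<open>x \<in> B\<close> B member_subset assms(1) unfolding uinterior_def by blast
  qed
  then show "\<exists>A\<in>uinterior ` \<alpha>. B \<subseteq> A"
    using A(1) by blast
qed

lemma uinterior_cover:
  assumes "\<alpha> \<in> U"
  shows "uinterior ` \<alpha> \<in> U"
proof -
  obtain \<beta> where \<beta>: "\<beta> \<in> U" "star_refines \<beta> \<alpha>"
    using star_refinement[OF assms] by blast
  have "refines \<beta> (uinterior ` \<alpha>)"
    using \<beta> by (rule star_refines_uinterior)
  moreover have "is_cover X (uinterior ` \<alpha>)"
    unfolding is_cover_def
  proof
    show "\<Union>(uinterior ` \<alpha>) = X"
    proof
      show "X \<subseteq> \<Union>(uinterior ` \<alpha>)"
      proof
        fix x assume "x \<in> X"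
        then obtain B where "B \<in> \<beta>" "x \<in> B"
          using member_containing[OF \<beta>(1)] by blast
        then show "x \<in> \<Union>(uinterior ` \<alpha>)"
          using refinesD[OF \<open>refines \<beta> (uinterior ` \<alpha>)\<close>, of B] by blast
      qed
    qed (auto simp: uinterior_def)
  qed (auto simp: uinterior_def)
  ultimately show ?thesis
    using coarser_cover \<beta>(1) by blast
qed

text \<open>The completion brings no topology of its own. For a precompact uniformity this one turns
  out to be its interval topology.\<close>

definition utopology :: "'a topology" where
  "utopology = topology (\<lambda>V. V \<subseteq> X \<and> (\<forall>x\<in>V. \<exists>\<alpha>\<in>U. star {x} \<alpha> \<subseteq> V))"

lemma openin_utopology:
  "openin utopology V \<longleftrightarrow> V \<subseteq> X \<and> (\<forall>x\<in>V. \<exists>\<alpha>\<in>U. star {x} \<alpha> \<subseteq> V)"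
proof -
  have *: "istopology (\<lambda>V. V \<subseteq> X \<and> (\<forall>x\<in>V. \<exists>\<alpha>\<in>U. star {x} \<alpha> \<subseteq> V))"
    unfolding istopology_def
  proof (intro conjI allI impI)
    fix V W assume *: "V \<subseteq> X \<and> (\<forall>x\<in>V. \<exists>\<alpha>\<in>U. star {x} \<alpha> \<subseteq> V)" "W \<subseteq> X \<and> (\<forall>x\<in>W. \<exists>\<alpha>\<in>U. star {x} \<alpha> \<subseteq> W)"
    show "V \<inter> W \<subseteq> X"
      using * by blast
    show "\<forall>x\<in>V \<inter> W. \<exists>\<alpha>\<in>U. star {x} \<alpha> \<subseteq> V \<inter> W"
    proof
      fix x assume "x \<in> V \<inter> W"
      then obtain \<alpha> \<beta> where "\<alpha> \<in> U" "star {x} \<alpha> \<subseteq> V" "\<beta> \<in> U" "star {x} \<beta> \<subseteq> W"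
        using * by blast
      moreover obtain \<gamma> where "\<gamma> \<in> U" "refines \<gamma> \<alpha>" "refines \<gamma> \<beta>"
        using common_refinement calculation by blast
      ultimately show "\<exists>\<alpha>\<in>U. star {x} \<alpha> \<subseteq> V \<inter> W"
        using star_refinement_mono[of \<gamma> _ "{x}"] by blast
    qed
  next
    fix K assume K: "\<forall>V\<in>K. V \<subseteq> X \<and> (\<forall>x\<in>V. \<exists>\<alpha>\<in>U. star {x} \<alpha> \<subseteq> V)"
    then show "\<Union>K \<subseteq> X"
      by blast
    show "\<forall>x\<in>\<Union>K. \<exists>\<alpha>\<in>U. star {x} \<alpha> \<subseteq> \<Union>K"
      using K by (meson UnionE Union_upper order_trans)
  qed
  show ?thesis
    unfolding utopology_def topology_inverse'[OF *] ..
qed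

lemma topspace_utopology [simp]: "topspace utopology = X"
proof
  have "openin utopology X"
    unfolding openin_utopology using trivial_cover star_subset by blast
  then show "X \<subseteq> topspace utopology"
    by (simp add: openin_subset)
qed (use openin_utopology openin_topspace in blast)

end

section \<open>Uniformities compatible with a given topology\<close>

locale compatible_space = covering_uniformity "topspace T" U for T :: "'a topology" and U +
  assumes hausdorff: "hausdorff_uniformity (topspace T) U"
    and openin_iff: "openin T V \<longleftrightarrow> V \<subseteq> topspace T \<and> (\<forall>x\<in>V. \<exists>\<alpha>\<in>U. star {x} \<alpha> \<subseteq> V)"

lemma compatible_space_iff: "compatible_space T U \<longleftrightarrow> compatible_uniformity T U"
  unfolding compatible_space_def compatible_space_axioms_def compatible_uniformity_def
    covering_uniformity_def by blast

context compatible_space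
begin

lemma openin_uinterior: "openin T (uinterior A)"
  unfolding openin_iff using uinterior_open by (auto simp: uinterior_def)

lemma eventually_nhdsin_star:
  assumes "x \<in> topspace T"
  shows "eventually P (nhdsin T x) \<longleftrightarrow> (\<exists>\<alpha>\<in>U. \<forall>y\<in>star {x} \<alpha>. P y)"
proof
  assume "eventually P (nhdsin T x)"
  then obtain S where S: "openin T S" "x \<in> S" "\<forall>y\<in>S. P y"
    using assms unfolding eventually_nhdsin by blast
  then obtain \<alpha> where "\<alpha> \<in> U" "star {x} \<alpha> \<subseteq> S"
    using openin_iff by blast
  then show "\<exists>\<alpha>\<in>U. \<forall>y\<in>star {x} \<alpha>. P y"
    using S(3) by blast
next
  assume "\<exists>\<alpha>\<in>U. \<forall>y\<in>star {x} \<alpha>. P y"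
  then show "eventually P (nhdsin T x)"
    unfolding eventually_nhdsin
    by (meson assms in_uinterior_star openin_uinterior subsetD uinterior_subset)
qed

text \<open>The Lebesgue number argument for covers: finitely many local covers \<gamma>
  \<open>x\<close> suffice by compactness, and a common refinement of them plays the part of the
  Lebesgue number.\<close>

lemma Lebesgue_covering:
  assumes "compact_space T" and \<beta>: "is_cover (topspace T) \<beta>" "\<And>B. B \<in> \<beta> \<Longrightarrow> openin T B"
  shows "\<beta> \<in> U"
proof -
  let ?X = "topspace T"
  have "\<exists>\<alpha> B \<gamma>. \<alpha> \<in> U \<and> B \<in> \<beta> \<and> star {x} \<alpha> \<subseteq> B \<and> \<gamma> \<in> U \<and> star_refines \<gamma> \<alpha>" if "x \<in> ?X" for x
    using that \<beta> star_refinement openin_iff unfolding is_cover_def by (metis UnionE)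
  then obtain \<alpha> B \<gamma> where *: "\<And>x. x \<in> ?X \<Longrightarrow>
      \<alpha> x \<in> U \<and> B x \<in> \<beta> \<and> star {x} (\<alpha> x) \<subseteq> B x \<and> \<gamma> x \<in> U \<and> star_refines (\<gamma> x) (\<alpha> x)"
    by metis
  \<comment> \<open>Two scales are needed: \<alpha> \<open>x\<close> carries the star of
    \<open>x\<close> into \<open>B x\<close>, while its star refinement \<gamma> \<open>x\<close>
    leaves room for a step from \<open>x\<close> to a point of \<open>N x\<close> and another one
    across a member of \<delta>.\<close>
  define N where "N x = uinterior (star {x} (\<gamma> x))" for x
  have N: "x \<in> N x" if "x \<in> ?X" for x
    unfolding N_def using * that in_uinterior_star by blast
  have "\<forall>V\<in>N ` ?X. openin T V" "?X \<subseteq> \<Union>(N ` ?X)"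
    using N openin_uinterior by (auto simp: N_def)
  then obtain \<F> where "finite \<F>" "\<F> \<subseteq> N ` ?X" "?X \<subseteq> \<Union>\<F>"
    using assms(1) unfolding compact_space_alt by meson
  then obtain F where F: "finite F" "F \<subseteq> ?X" "?X \<subseteq> \<Union>(N ` F)"
    by (metis finite_subset_image)
  obtain \<delta> where \<delta>: "\<delta> \<in> U" "\<forall>x\<in>F. refines \<delta> (\<gamma> x)"
    using finite_common_refinement[OF F(1), of \<gamma>] * F(2) by blast
  have "refines \<delta> \<beta>"
  proof (rule refinesI)
    fix D assume D: "D \<in> \<delta>" "D \<noteq> {}"
    then obtain y where y: "y \<in> D" "y \<in> ?X"
      using member_subset \<delta>(1) by blast
    then obtain x where x: "x \<in> F" "y \<in> N x"
      using F(3) by blast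
    then obtain G where G: "G \<in> \<gamma> x" "x \<in> G" "y \<in> G"
      using uinterior_subset by (fastforce simp: N_def star_singleton)
    obtain G' where G': "G' \<in> \<gamma> x" "D \<subseteq> G'"
      using \<delta>(2) x(1) D unfolding refines_def by blast
    obtain A where A: "A \<in> \<alpha> x" "star G (\<gamma> x) \<subseteq> A"
      using star_refinesD * F(2) x(1) G by (metis empty_iff subsetD)
    \<comment> \<open>\<open>G\<close> contains both \<open>x\<close> and \<open>y\<close>, and
      \<open>G'\<close> meets \<open>G\<close> in \<open>y\<close>, so the star of \<open>G\<close>
      reaches from \<open>x\<close> over all of \<open>D\<close>.\<close>
    have "x \<in> A" "D \<subseteq> A"
      using A(2) G G' y by (auto simp: star_def)
    then have "D \<subseteq> star {x} (\<alpha> x)"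
      using A(1) by (auto simp: star_singleton)
    then show "\<exists>B\<in>\<beta>. D \<subseteq> B"
      using * F(2) x(1) by (meson order_trans subsetD)
  qed
  then show ?thesis
    using coarser_cover \<delta>(1) \<beta>(1) by blast
qed

end

section \<open>The uniformity generated by the open covers of a compact Hausdorff space\<close>

definition fine_uniformity :: "'a topology \<Rightarrow> 'a set set set" where
  "fine_uniformity T = {\<alpha>. is_cover (topspace T) \<alpha> \<and>
     (\<exists>\<beta>. is_cover (topspace T) \<beta> \<and> (\<forall>B\<in>\<beta>. openin T B) \<and> refines \<beta> \<alpha>)}"

lemma fine_uniformityI:
  "is_cover (topspace T) \<beta> \<Longrightarrow> (\<And>B. B \<in> \<beta> \<Longrightarrow> openin T B) \<Longrightarrow> \<beta> \<in> fine_uniformity T"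
  unfolding fine_uniformity_def using refines_refl by blast

text \<open>The interiors of a uniform cover are an open refinement of it; conversely,
  \<open>Lebesgue_covering\<close> makes every open cover uniform.\<close>

lemma compatible_uniformity_eq_fine:
  assumes "compact_space T" "compatible_uniformity T U"
  shows "U = fine_uniformity T"
proof -
  interpret compatible_space T U
    using assms compatible_space_iff by blast
  show ?thesis
  proof (intro subset_antisym subsetI)
    fix \<alpha> assume "\<alpha> \<in> U"
    then have "is_cover (topspace T) (uinterior ` \<alpha>)"
      using cover[OF uinterior_cover] by blast
    moreover have "refines (uinterior ` \<alpha>) \<alpha>"
      using uinterior_subset by (intro refinesI) blast
    ultimately show "\<alpha> \<in> fine_uniformity T"
      unfolding fine_uniformity_def using cover[OF \<open>\<alpha> \<in> U\<close>] openin_uinterior by blast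
  next
    fix \<alpha> assume "\<alpha> \<in> fine_uniformity T"
    then show "\<alpha> \<in> U"
      unfolding fine_uniformity_def using Lebesgue_covering[OF assms(1)] coarser_cover by blast
  qed
qed

text \<open>By regularity and compactness, finitely many open sets whose closures lie in members of
  \<beta> cover the space. An index \<open>i\<close> with \<open>x\<close> in \<open>V i\<close>
  then confines all members of the refinement through \<open>x\<close> to the single set
  \<open>B i\<close>.\<close>

lemma barycentric_refinement:
  assumes "compact_space T" "Hausdorff_space T"
    and \<beta>: "is_cover (topspace T) \<beta>" "\<And>B. B \<in> \<beta> \<Longrightarrow> openin T B"
  obtains \<gamma> where "is_cover (topspace T) \<gamma>" "\<And>C. C \<in> \<gamma> \<Longrightarrow> openin T C"
    "\<And>x. x \<in> topspace T \<Longrightarrow> \<exists>B\<in>\<beta>. star {x} \<gamma> \<subseteq> B"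
proof -
  let ?X = "topspace T"
  have "\<exists>B V. B \<in> \<beta> \<and> openin T V \<and> x \<in> V \<and> T closure_of V \<subseteq> B" if x: "x \<in> ?X" for x
  proof -
    obtain B where B: "B \<in> \<beta>" "x \<in> B"
      using is_coverD[OF \<beta>(1) x] by blast
    have "closedin T (?X - B)" "x \<in> ?X - (?X - B)"
      using B \<beta>(2) x by auto
    then obtain V where "openin T V" "x \<in> V" "disjnt (?X - B) (T closure_of V)"
      using compact_Hausdorff_imp_regular_space[OF assms(1,2)] unfolding regular_space by meson
    moreover have "T closure_of V \<subseteq> B"
      using calculation closure_of_subset_topspace[of T V] unfolding disjnt_def by blast
    ultimately show ?thesis
      using B(1) by blast
  qed
  then obtain B V where BV: "\<And>x. x \<in> ?X \<Longrightarrow>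
      B x \<in> \<beta> \<and> openin T (V x) \<and> x \<in> V x \<and> T closure_of V x \<subseteq> B x"
    by metis
  have "\<forall>W\<in>V ` ?X. openin T W" "?X \<subseteq> \<Union>(V ` ?X)"
    using BV by auto
  then obtain \<F> where "finite \<F>" "\<F> \<subseteq> V ` ?X" "?X \<subseteq> \<Union>\<F>"
    using assms(1) unfolding compact_space_alt by meson
  then obtain F where F: "finite F" "F \<subseteq> ?X" "?X \<subseteq> \<Union>(V ` F)"
    by (metis finite_subset_image)
  \<comment> \<open>For each index \<open>i\<close>, the set \<open>W y\<close> records whether
    \<open>y\<close> lies in the closure of \<open>V i\<close>. A point \<open>x\<close> of
    \<open>V i\<close> can belong to \<open>W y\<close> only if it does, and then \<open>W y\<close>
    is inside \<open>B i\<close>.\<close>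
  define W where
    "W y = (\<Inter>i\<in>F. if y \<in> T closure_of V i then B i else ?X - T closure_of V i) \<inter> ?X" for y
  show thesis
  proof
    have "openin T (W y)" for y
      unfolding W_def using F BV \<beta>(2) by (intro openin_INT) auto
    then show "openin T C" if "C \<in> W ` ?X" for C
      using that by blast
    have "y \<in> W y" if "y \<in> ?X" for y
      using that BV F(2) unfolding W_def by auto
    then have "?X \<subseteq> \<Union>(W ` ?X)"
      by blast
    then show "is_cover ?X (W ` ?X)"
      unfolding is_cover_def by (auto simp: W_def)
    show "\<exists>B\<in>\<beta>. star {x} (W ` ?X) \<subseteq> B" if x: "x \<in> ?X" for x
    proof -
      obtain i where i: "i \<in> F" "x \<in> V i"
        using F(3) x by blast
      then have "x \<in> T closure_of V i"
        by (meson BV F(2) closure_of_subset openin_subset subsetD)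
      have "W y \<subseteq> B i" if "x \<in> W y" for y
      proof -
        have W: "W y \<subseteq> (if y \<in> T closure_of V i then B i else ?X - T closure_of V i)"
          unfolding W_def using i(1) by blast
        then have "y \<in> T closure_of V i"
          using that \<open>x \<in> T closure_of V i\<close> by (auto split: if_splits)
        then show ?thesis
          using W by simp
      qed
      then have "star {x} (W ` ?X) \<subseteq> B i"
        unfolding star_singleton by blast
      then show ?thesis
        using BV F(2) i(1) by blast
    qed
  qed
qed

text \<open>A barycentric refinement controls stars of points only. Applied twice it controls stars
  of sets: every member of \<delta> that meets \<open>D\<close> lies, together with a fixed point
  \<open>d\<close> of \<open>D\<close>, in one member of \<gamma>.\<close>

lemma open_star_refinement:
  assumes T: "compact_space T" "Hausdorff_space T"
    and \<beta>: "is_cover (topspace T) \<beta>" "\<And>B. B \<in> \<beta> \<Longrightarrow> openin T B"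
  obtains \<delta> where "is_cover (topspace T) \<delta>" "\<And>D. D \<in> \<delta> \<Longrightarrow> openin T D" "star_refines \<delta> \<beta>"
proof -
  obtain \<gamma> where \<gamma>: "is_cover (topspace T) \<gamma>" "\<And>C. C \<in> \<gamma> \<Longrightarrow> openin T C"
    "\<And>x. x \<in> topspace T \<Longrightarrow> \<exists>B\<in>\<beta>. star {x} \<gamma> \<subseteq> B"
    using barycentric_refinement[OF T \<beta>] by metis
  obtain \<delta> where \<delta>: "is_cover (topspace T) \<delta>" "\<And>C. C \<in> \<delta> \<Longrightarrow> openin T C"
    "\<And>x. x \<in> topspace T \<Longrightarrow> \<exists>B\<in>\<gamma>. star {x} \<delta> \<subseteq> B"
    using barycentric_refinement[OF T \<gamma>(1,2)] by metis
  have "star_refines \<delta> \<beta>"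
  proof (rule star_refinesI)
    fix D assume "D \<in> \<delta>" "D \<noteq> {}"
    then obtain d where d: "d \<in> D" "d \<in> topspace T"
      using \<delta>(2) openin_subset by blast
    obtain B where B: "B \<in> \<beta>" "star {d} \<gamma> \<subseteq> B"
      using \<gamma>(3) d(2) by blast
    have "D' \<subseteq> star {d} \<gamma>" if D': "D' \<in> \<delta>" "e \<in> D'" "e \<in> D" for D' e
    proof -
      obtain C where C: "C \<in> \<gamma>" "star {e} \<delta> \<subseteq> C"
        using \<delta>(2,3) D' openin_subset by (metis subsetD)
      have "d \<in> C" "D' \<subseteq> C"
        using C(2) D' d \<open>D \<in> \<delta>\<close> by (auto simp: star_singleton)
      then show ?thesis
        using C(1) by (auto simp: star_singleton)
    qed
    then have "star D \<delta> \<subseteq> star {d} \<gamma>"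
      by (force simp: star_def[of D])
    then show "\<exists>B\<in>\<beta>. star D \<delta> \<subseteq> B"
      using B by blast
  qed
  then show thesis
    using \<delta> that by blast
qed

text \<open>For a general space this family of covers may lack star refinements;
  \<open>open_star_refinement\<close> supplies them here. Covers by two open sets, at least one of
  them the complement of a point, recover the points and the topology.\<close>

lemma compatible_fine_uniformity:
  assumes T: "compact_space T" "Hausdorff_space T"
  shows "compatible_uniformity T (fine_uniformity T)"
proof -
  let ?X = "topspace T"
  have pt: "openin T (?X - {x})" for x
  proof (cases "x \<in> ?X")
    case True
    then show ?thesis
      using T(2) closedin_Hausdorff_sing_eq[of T x] by auto
  qed simp
  have uni: "uniformity_on ?X (fine_uniformity T)"
    unfolding uniformity_on_def
  proof (intro conjI ballI allI impI)
    show "{?X} \<in> fine_uniformity T"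
      by (rule fine_uniformityI) (auto simp: is_cover_def)
  next
    fix \<alpha> \<beta> assume "\<alpha> \<in> fine_uniformity T" "\<beta> \<in> fine_uniformity T"
    then obtain \<alpha>' \<beta>' where 1: "is_cover ?X \<alpha>'" "\<forall>B\<in>\<alpha>'. openin T B" "refines \<alpha>' \<alpha>"
      and 2: "is_cover ?X \<beta>'" "\<forall>B\<in>\<beta>'. openin T B" "refines \<beta>' \<beta>"
      unfolding fine_uniformity_def by blast
    let ?\<gamma> = "{A \<inter> B | A B. A \<in> \<alpha>' \<and> B \<in> \<beta>'}"
    have "\<Union>?\<gamma> = \<Union>\<alpha>' \<inter> \<Union>\<beta>'"
      by blast
    then have "?\<gamma> \<in> fine_uniformity T"
      using 1 2 by (intro fine_uniformityI) (auto simp: is_cover_def)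
    moreover have "refines ?\<gamma> \<alpha>'" "refines ?\<gamma> \<beta>'"
      unfolding refines_def by blast+
    ultimately show "\<exists>\<gamma>\<in>fine_uniformity T. refines \<gamma> \<alpha> \<and> refines \<gamma> \<beta>"
      using 1(3) 2(3) refines_trans by blast
  next
    fix \<alpha> assume "\<alpha> \<in> fine_uniformity T"
    then obtain \<alpha>' where 1: "is_cover ?X \<alpha>'" "\<And>B. B \<in> \<alpha>' \<Longrightarrow> openin T B" "refines \<alpha>' \<alpha>"
      unfolding fine_uniformity_def by blast
    obtain \<delta> where "is_cover ?X \<delta>" "\<And>D. D \<in> \<delta> \<Longrightarrow> openin T D" "star_refines \<delta> \<alpha>'"
      using open_star_refinement[OF T 1(1,2)] by blast
    then have "\<delta> \<in> fine_uniformity T" "star_refines \<delta> \<alpha>"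
      using 1(3) refines_trans unfolding star_refines_def by (blast intro: fine_uniformityI)+
    then show "\<exists>\<beta>\<in>fine_uniformity T. star_refines \<beta> \<alpha>"
      by blast
  qed (auto simp: fine_uniformity_def intro: refines_trans)
  moreover have "hausdorff_uniformity ?X (fine_uniformity T)"
    unfolding hausdorff_uniformity_def
  proof (intro ballI impI)
    fix x y assume xy: "x \<in> ?X" "y \<in> ?X" "x \<noteq> y"
    \<comment> \<open>\<open>?X - {y}\<close> is the only member that contains
      \<open>x\<close>.\<close>
    then have "{?X - {x}, ?X - {y}} \<in> fine_uniformity T"
      using pt by (intro fine_uniformityI) (auto simp: is_cover_def)
    then show "\<exists>\<alpha>\<in>fine_uniformity T. y \<notin> star {x} \<alpha>"
      by (rule bexI[rotated]) (auto simp: star_singleton)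
  qed
  moreover have "openin T V \<longleftrightarrow> V \<subseteq> ?X \<and> (\<forall>x\<in>V. \<exists>\<alpha>\<in>fine_uniformity T. star {x} \<alpha> \<subseteq> V)" for V
  proof (intro iffI conjI ballI)
    fix x assume V: "openin T V" "x \<in> V"
    \<comment> \<open>\<open>V\<close> is the only member that contains \<open>x\<close>, so it is
      the star of \<open>x\<close>.\<close>
    then have "{V, ?X - {x}} \<in> fine_uniformity T"
      using pt openin_subset[OF V(1)] by (intro fine_uniformityI) (auto simp: is_cover_def)
    then show "\<exists>\<alpha>\<in>fine_uniformity T. star {x} \<alpha> \<subseteq> V"
      by (rule bexI[rotated]) (auto simp: star_singleton)
  next
    assume V: "V \<subseteq> ?X \<and> (\<forall>x\<in>V. \<exists>\<alpha>\<in>fine_uniformity T. star {x} \<alpha> \<subseteq> V)"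
    have "\<exists>W. openin T W \<and> x \<in> W \<and> W \<subseteq> V" if x: "x \<in> V" for x
    proof -
      obtain \<alpha> where \<alpha>: "\<alpha> \<in> fine_uniformity T" "star {x} \<alpha> \<subseteq> V"
        using V x by blast
      obtain \<beta> where \<beta>: "is_cover ?X \<beta>" "\<forall>B\<in>\<beta>. openin T B" "refines \<beta> \<alpha>"
        using \<alpha>(1) unfolding fine_uniformity_def by auto
      have "x \<in> ?X"
        using conjunct1[OF V] x by (rule subsetD)
      then obtain B where B: "B \<in> \<beta>" "x \<in> B"
        using is_coverD[OF \<beta>(1), of x] by auto
      have "B \<subseteq> star {x} \<beta>"
        using B unfolding star_singleton by blast
      also have "\<dots> \<subseteq> star {x} \<alpha>"
        using \<beta>(3) by (rule star_refinement_mono)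
      finally have "B \<subseteq> V"
        using \<alpha>(2) by simp
      then show ?thesis
        using B \<beta>(2) by blast
    qed
    then show "openin T V"
      by (subst openin_subopen) blast
  qed (simp add: openin_subset)
  ultimately show ?thesis
    unfolding compatible_uniformity_def by blast
qed

lemma compact_Hausdorff_uniformity:
  assumes "compact_space T" "Hausdorff_space T"
  shows "\<exists>!V. compatible_uniformity T V"
    and the_uniformity_eq_fine: "the_uniformity T = fine_uniformity T"
proof -
  have *: "compatible_uniformity T V \<longleftrightarrow> V = fine_uniformity T" for V
    using assms compatible_fine_uniformity compatible_uniformity_eq_fine by blast
  then show "\<exists>!V. compatible_uniformity T V"
    by simp
  show "the_uniformity T = fine_uniformity T"
    unfolding the_uniformity_def by (rule the_equality) (use * in blast)+
qed

section \<open>Pullbacks along embeddings\<close>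

lemma embedding_map_continuous: "embedding_map T T' j \<Longrightarrow> continuous_map T T' j"
  unfolding embedding_map_def
  using continuous_map_in_subtopology homeomorphic_imp_continuous_map by blast

lemma embedding_map_open_trace:
  assumes "embedding_map T T' j" "inj_on j (topspace T)" "openin T V"
  obtains W where "openin T' W" "V = j -` W \<inter> topspace T"
proof -
  have "openin (subtopology T' (j ` topspace T)) (j ` V)"
    using assms unfolding embedding_map_def
    by (meson homeomorphic_imp_open_map open_map_def)
  then obtain W where W: "openin T' W" "j ` V = W \<inter> j ` topspace T"
    unfolding openin_subtopology by auto
  have "V = j -` W \<inter> topspace T"
    using W(2) openin_subset[OF assms(3)] inj_onD[OF assms(2)] by blast
  then show thesis
    using W(1) that by blast
qed

text \<open>Only an inclusion, because a member of \<beta> may meet \<open>C\<close> outside the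
  image of \<open>j\<close>. For the star of a single point of \<open>X\<close> this cannot happen,
  whence the equality in \<open>star_singleton_vimage\<close>.\<close>

lemma star_vimage_subset:
  "star (j -` C \<inter> X) {j -` B \<inter> X | B. B \<in> \<beta>} \<subseteq> j -` star C \<beta> \<inter> X"
  by (auto simp: star_def)

lemma star_singleton_vimage:
  "x \<in> X \<Longrightarrow> star {x} {j -` B \<inter> X | B. B \<in> \<beta>} = j -` star {j x} \<beta> \<inter> X"
  by (auto simp: star_singleton)

lemma is_cover_vimage:
  assumes "is_cover Y \<beta>" "j \<in> X \<rightarrow> Y"
  shows "is_cover X {j -` B \<inter> X | B. B \<in> \<beta>}"
proof -
  have "x \<in> \<Union>{j -` B \<inter> X | B. B \<in> \<beta>}" if "x \<in> X" for x
  proof -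
    have "j x \<in> \<Union>\<beta>"
      using that assms unfolding is_cover_def by auto
    then show ?thesis
      using that by auto
  qed
  then show ?thesis
    unfolding is_cover_def by auto
qed

lemma refines_vimage:
  assumes "refines \<gamma> \<beta>"
  shows "refines {j -` B \<inter> X | B. B \<in> \<gamma>} {j -` B \<inter> X | B. B \<in> \<beta>}"
proof (rule refinesI)
  fix S assume "S \<in> {j -` B \<inter> X | B. B \<in> \<gamma>}" "S \<noteq> {}"
  then obtain B where B: "B \<in> \<gamma>" "B \<noteq> {}" "S = j -` B \<inter> X"
    by blast
  then obtain C where "C \<in> \<beta>" "B \<subseteq> C"
    using refinesD[OF assms] by blast
  then show "\<exists>C\<in>{j -` B \<inter> X | B. B \<in> \<beta>}. S \<subseteq> C"
    unfolding B(3) by (intro bexI[of _ "j -` C \<inter> X"]) auto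
qed

lemma pullback_uniformityI:
  assumes "uniformity_on Y V" "\<beta> \<in> V" "j \<in> X \<rightarrow> Y"
  shows "{j -` B \<inter> X | B. B \<in> \<beta>} \<in> pullback_uniformity X j V"
proof -
  have "is_cover Y \<beta>"
    using covering_uniformity.cover[OF covering_uniformity.intro[OF assms(1)] assms(2)] .
  then have "is_cover X {j -` B \<inter> X | B. B \<in> \<beta>}"
    using assms(3) by (rule is_cover_vimage)
  then show ?thesis
    unfolding pullback_uniformity_def mem_Collect_eq using assms(2) refines_refl by (intro conjI bexI)
qed

lemma uniformity_on_pullback:
  assumes V: "uniformity_on Y V" and j: "j \<in> X \<rightarrow> Y"
  shows "uniformity_on X (pullback_uniformity X j V)"
proof -
  interpret V: covering_uniformity Y V
    by unfold_locales (rule V)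
  let ?j = "\<lambda>\<beta>. {j -` B \<inter> X | B. B \<in> \<beta>}"
  show ?thesis
    unfolding uniformity_on_def
  proof (intro conjI ballI allI impI)
    have "refines (?j {Y}) {X}"
      by (auto simp: refines_def)
    then have "\<exists>\<beta>\<in>V. refines (?j \<beta>) {X}"
      using V.trivial_cover by blast
    then show "{X} \<in> pullback_uniformity X j V"
      unfolding pullback_uniformity_def by (simp add: is_cover_def)
  next
    fix \<alpha> \<beta> assume "\<alpha> \<in> pullback_uniformity X j V" "\<beta> \<in> pullback_uniformity X j V"
    then obtain \<alpha>' \<beta>' where 1: "\<alpha>' \<in> V" "refines (?j \<alpha>') \<alpha>" "\<beta>' \<in> V" "refines (?j \<beta>') \<beta>"
      unfolding pullback_uniformity_def by blast
    then obtain \<gamma> where \<gamma>: "\<gamma> \<in> V" "refines \<gamma> \<alpha>'" "refines \<gamma> \<beta>'"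
      using V.common_refinement by blast
    have "refines (?j \<gamma>) \<alpha>" "refines (?j \<gamma>) \<beta>"
      using refines_trans[OF refines_vimage[OF \<gamma>(2)] 1(2)] refines_trans[OF refines_vimage[OF \<gamma>(3)] 1(4)] .
    then show "\<exists>\<gamma>\<in>pullback_uniformity X j V. refines \<gamma> \<alpha> \<and> refines \<gamma> \<beta>"
      using pullback_uniformityI[OF V \<gamma>(1) j] by blast
  next
    fix \<alpha> assume "\<alpha> \<in> pullback_uniformity X j V"
    then obtain \<alpha>' where 1: "\<alpha>' \<in> V" "refines (?j \<alpha>') \<alpha>"
      unfolding pullback_uniformity_def by blast
    then obtain \<gamma> where \<gamma>: "\<gamma> \<in> V" "star_refines \<gamma> \<alpha>'"
      using V.star_refinement by blast
    have "star_refines (?j \<gamma>) (?j \<alpha>')"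
    proof (rule star_refinesI)
      fix B assume "B \<in> ?j \<gamma>" "B \<noteq> {}"
      then obtain C where C: "C \<in> \<gamma>" "B = j -` C \<inter> X" "C \<noteq> {}"
        by blast
      then obtain A where "A \<in> \<alpha>'" "star C \<gamma> \<subseteq> A"
        using star_refinesD \<gamma>(2) by blast
      then have "star B (?j \<gamma>) \<subseteq> j -` A \<inter> X"
        unfolding C(2) using star_vimage_subset[of j C X \<gamma>] by (meson Int_mono order_refl order_trans vimage_mono)
      then show "\<exists>A\<in>?j \<alpha>'. star B (?j \<gamma>) \<subseteq> A"
        using \<open>A \<in> \<alpha>'\<close> by (intro bexI[of _ "j -` A \<inter> X"]) blast+
    qed
    then have "star_refines (?j \<gamma>) \<alpha>"
      unfolding star_refines_def using 1(2) by (rule refines_trans)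
    then show "\<exists>\<beta>\<in>pullback_uniformity X j V. star_refines \<beta> \<alpha>"
      using pullback_uniformityI[OF V \<gamma>(1) j] by blast
  qed (auto simp: pullback_uniformity_def intro: refines_trans)
qed

lemma star_pullback:
  assumes "\<alpha> \<in> pullback_uniformity X j V" "x \<in> X"
  obtains \<beta> where "\<beta> \<in> V" "j -` star {j x} \<beta> \<inter> X \<subseteq> star {x} \<alpha>"
proof -
  obtain \<beta> where \<beta>: "\<beta> \<in> V" "refines {j -` B \<inter> X | B. B \<in> \<beta>} \<alpha>"
    using assms(1) unfolding pullback_uniformity_def by blast
  then have "j -` star {j x} \<beta> \<inter> X \<subseteq> star {x} \<alpha>"
    using star_refinement_mono[OF \<beta>(2), of "{x}"] star_singleton_vimage[OF assms(2), of j \<beta>] by simp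
  then show thesis
    using \<beta>(1) that by blast
qed

lemma compatible_uniformity_pullback:
  assumes V: "compatible_uniformity T' V" and j: "embedding_map T T' j" "inj_on j (topspace T)"
  shows "compatible_uniformity T (pullback_uniformity (topspace T) j V)"
proof -
  let ?X = "topspace T"
  interpret V: compatible_space T' V
    using V compatible_space_iff by blast
  have cj: "continuous_map T T' j"
    using embedding_map_continuous j(1) by blast
  then have jX: "j \<in> ?X \<rightarrow> topspace T'"
    by (rule continuous_map_funspace)
  note I = pullback_uniformityI[OF V.uniformity _ jX]
  have "hausdorff_uniformity ?X (pullback_uniformity ?X j V)"
    unfolding hausdorff_uniformity_def
  proof (intro ballI impI)
    fix x y assume xy: "x \<in> ?X" "y \<in> ?X" "x \<noteq> y"
    then have "j x \<in> topspace T'" "j y \<in> topspace T'" "j x \<noteq> j y"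
      using jX inj_onD[OF j(2)] by auto
    then obtain \<beta> where \<beta>: "\<beta> \<in> V" "j y \<notin> star {j x} \<beta>"
      using V.hausdorff unfolding hausdorff_uniformity_def by blast
    show "\<exists>\<alpha>\<in>pullback_uniformity ?X j V. y \<notin> star {x} \<alpha>"
      using I[OF \<beta>(1)] \<beta>(2) star_singleton_vimage[OF xy(1), of j \<beta>] by (intro bexI) auto
  qed
  moreover have "openin T S \<longleftrightarrow> S \<subseteq> ?X \<and> (\<forall>x\<in>S. \<exists>\<alpha>\<in>pullback_uniformity ?X j V. star {x} \<alpha> \<subseteq> S)" for S
  proof (intro iffI conjI ballI)
    fix x assume S: "openin T S" "x \<in> S"
    obtain W where W: "openin T' W" "S = j -` W \<inter> ?X"
      using embedding_map_open_trace[OF j S(1)] .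
    then obtain \<beta> where \<beta>: "\<beta> \<in> V" "star {j x} \<beta> \<subseteq> W"
      using V.openin_iff S(2) by blast
    then show "\<exists>\<alpha>\<in>pullback_uniformity ?X j V. star {x} \<alpha> \<subseteq> S"
      using I[OF \<beta>(1)] S(2) W(2) star_singleton_vimage[of x ?X j \<beta>] by (intro bexI) auto
  next
    assume S: "S \<subseteq> ?X \<and> (\<forall>x\<in>S. \<exists>\<alpha>\<in>pullback_uniformity ?X j V. star {x} \<alpha> \<subseteq> S)"
    have "\<exists>W. openin T W \<and> x \<in> W \<and> W \<subseteq> S" if xS: "x \<in> S" for x
    proof -
      have x: "x \<in> ?X"
        using S xS by blast
      obtain \<alpha> where \<alpha>: "\<alpha> \<in> pullback_uniformity ?X j V" "star {x} \<alpha> \<subseteq> S"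
        using S xS by blast
      obtain \<beta> where \<beta>: "\<beta> \<in> V" "j -` star {j x} \<beta> \<inter> ?X \<subseteq> star {x} \<alpha>"
        using star_pullback[OF \<alpha>(1) x] .
      \<comment> \<open>A star need not be open, but its interior is open and still contains
        \<open>j x\<close>.\<close>
      have "openin T {x \<in> ?X. j x \<in> V.uinterior (star {j x'} \<beta>)}" for x'
        using openin_continuous_map_preimage[OF cj V.openin_uinterior] .
      moreover have "j x \<in> V.uinterior (star {j x} \<beta>)"
        using V.in_uinterior_star[OF \<beta>(1)] jX x by blast
      moreover have "{y \<in> ?X. j y \<in> V.uinterior (star {j x} \<beta>)} \<subseteq> S"
        using \<beta>(2) \<alpha>(2) V.uinterior_subset[of "star {j x} \<beta>"] by blast
      ultimately show ?thesis
        using x by blast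
    qed
    then show "openin T S"
      by (subst openin_subopen) blast
  qed (simp add: openin_subset)
  ultimately show ?thesis
    unfolding compatible_uniformity_def using uniformity_on_pullback[OF V.uniformity jX] by blast
qed

text \<open>Stars of the pullback are governed by traces of stars of \<open>V\<close>, so
  compatibility on both sides forces the two topologies to correspond. It is applied to the
  canonical map into the completion.\<close>

lemma embedding_map_of_pullback:
  assumes U: "compatible_uniformity T (pullback_uniformity (topspace T) j V)"
    and V: "compatible_uniformity T' V"
    and j: "j \<in> topspace T \<rightarrow> topspace T'" "inj_on j (topspace T)"
  shows "embedding_map T T' j"
proof -
  let ?X = "topspace T"
  interpret U: compatible_space T "pullback_uniformity ?X j V"
    using U compatible_space_iff by blast
  interpret V: compatible_space T' V
    using V compatible_space_iff by blast
  have "openin T {x \<in> ?X. j x \<in> W}" if W: "openin T' W" for W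
    unfolding U.openin_iff
  proof (intro conjI ballI)
    fix x assume x: "x \<in> {x \<in> ?X. j x \<in> W}"
    then obtain \<beta> where \<beta>: "\<beta> \<in> V" "star {j x} \<beta> \<subseteq> W"
      using V.openin_iff W by blast
    show "\<exists>\<alpha>\<in>pullback_uniformity ?X j V. star {x} \<alpha> \<subseteq> {x \<in> ?X. j x \<in> W}"
      using pullback_uniformityI[OF V.uniformity \<beta>(1) j(1)] x \<beta>(2)
        star_singleton_vimage[of x ?X j \<beta>] by (intro bexI) auto
  qed auto
  then have "continuous_map T T' j"
    unfolding continuous_map_def using j(1) by simp
  then have "continuous_map T (subtopology T' (j ` ?X)) j"
    by (simp add: continuous_map_in_subtopology)
  moreover have "open_map T (subtopology T' (j ` ?X)) j"
    unfolding open_map_def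
  proof (intro allI impI)
    fix S assume S: "openin T S"
    have SX: "S \<subseteq> ?X"
      using S openin_subset by blast
    \<comment> \<open>The largest open set of \<open>T'\<close> that avoids the images of the points
      outside \<open>S\<close>; its trace on the image of \<open>j\<close> is the image of
      \<open>S\<close>.\<close>
    let ?W = "V.uinterior (topspace T' - j ` (?X - S))"
    have "j ` S = ?W \<inter> j ` ?X"
    proof
      show "j ` S \<subseteq> ?W \<inter> j ` ?X"
      proof clarify
        fix x assume x: "x \<in> S"
        then have xX: "x \<in> ?X"
          using SX by blast
        obtain \<alpha> where \<alpha>: "\<alpha> \<in> pullback_uniformity ?X j V" "star {x} \<alpha> \<subseteq> S"
          using S x U.openin_iff by blast
        obtain \<beta> where \<beta>: "\<beta> \<in> V" "j -` star {j x} \<beta> \<inter> ?X \<subseteq> star {x} \<alpha>"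
          using star_pullback[OF \<alpha>(1) xX] .
        have "star {j x} \<beta> \<subseteq> topspace T' - j ` (?X - S)"
          using \<beta> \<alpha>(2) V.star_subset[OF \<beta>(1), of "{j x}"] by blast
        then show "j x \<in> ?W \<inter> j ` ?X"
          using \<beta>(1) xX j(1) unfolding V.uinterior_def by blast
      qed
      show "?W \<inter> j ` ?X \<subseteq> j ` S"
        using V.uinterior_subset[of "topspace T' - j ` (?X - S)"] by blast
    qed
    then show "openin (subtopology T' (j ` ?X)) (j ` S)"
      unfolding openin_subtopology using V.openin_uinterior by blast
  qed
  moreover have "j ` ?X = topspace (subtopology T' (j ` ?X))"
    using j(1) by auto
  ultimately show ?thesis
    unfolding embedding_map_def using j(2) bijective_open_imp_homeomorphic_map by metis
qed

section \<open>Circular orders\<close>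

locale circularly_ordered =
  fixes X :: "'a set" and R :: "('a \<times> 'a \<times> 'a) set"
  assumes circular_order: "circular_order X R"
begin

lemma cyc: "(a, b, c) \<in> R \<Longrightarrow> (b, c, a) \<in> R"
  and asym: "(a, b, c) \<in> R \<Longrightarrow> (c, b, a) \<notin> R"
  and tr: "(a, b, c) \<in> R \<Longrightarrow> (a, c, d) \<in> R \<Longrightarrow> (a, b, d) \<in> R"
  and total: "a \<in> X \<Longrightarrow> b \<in> X \<Longrightarrow> c \<in> X \<Longrightarrow> a \<noteq> b \<Longrightarrow> b \<noteq> c \<Longrightarrow> a \<noteq> c \<Longrightarrow> (a, b, c) \<in> R \<or> (a, c, b) \<in> R"
  using circular_order unfolding circular_order_def by metis+

lemma carrier: "(a, b, c) \<in> R \<Longrightarrow> a \<in> X \<and> b \<in> X \<and> c \<in> X"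
  using conjunct1[OF circular_order[unfolded circular_order_def]] by auto

text \<open>A triple with two equal entries rotates to one that reads the same backwards, which
  asymmetry forbids.\<close>

lemma distinct: "(a, b, c) \<in> R \<Longrightarrow> a \<noteq> b \<and> b \<noteq> c \<and> a \<noteq> c"
  using asym[of a b c] asym[of b c a] asym[of c a b] cyc[of a b c] cyc[of b c a] by auto

lemma cyc_iff: "(a, b, c) \<in> R \<longleftrightarrow> (b, c, a) \<in> R" "(a, b, c) \<in> R \<longleftrightarrow> (c, a, b) \<in> R"
  using cyc[of a b c] cyc[of b c a] cyc[of c a b] by blast+

lemma closed_arc_subset: "a \<in> X \<Longrightarrow> b \<in> X \<Longrightarrow> closed_arc R a b \<subseteq> X"
  using carrier by (auto simp: closed_arc_def)

lemma closed_arc_refl: "closed_arc R a a = {a}"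
  using distinct by (auto simp: closed_arc_def)

text \<open>Totality makes the basic sets with distinct endpoints open arcs. Equal endpoints are
  always treated apart: the complement of \<open>{a}\<close> is not an arc of the relation, as
  \<open>(a, x, a)\<close> never holds.\<close>

lemma compl_closed_arc:
  assumes "a \<in> X" "b \<in> X" "a \<noteq> b"
  shows "x \<in> X - closed_arc R a b \<longleftrightarrow> (b, x, a) \<in> R"
proof
  assume "x \<in> X - closed_arc R a b"
  then have "x \<in> X" "x \<noteq> a" "x \<noteq> b" "(a, x, b) \<notin> R"
    by (auto simp: closed_arc_def)
  then show "(b, x, a) \<in> R"
    using total[of a x b] assms cyc[of a b x] by auto
next
  assume *: "(b, x, a) \<in> R"
  then show "x \<in> X - closed_arc R a b"
    using carrier[OF *] distinct[OF *] asym[OF *] by (auto simp: closed_arc_def)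
qed

subsection \<open>Cutting a circular order at a point\<close>

text \<open>On \<open>X\<close> without \<open>y\<close> this is a linear order. The arcs that avoid
  \<open>y\<close> are its closed intervals, so questions about several such arcs become questions
  about intervals on a line.\<close>

definition cut_le :: "'a \<Rightarrow> 'a \<Rightarrow> 'a \<Rightarrow> bool" where
  "cut_le y a b \<longleftrightarrow> a = b \<or> (y, a, b) \<in> R"

lemma cut_le_refl: "cut_le y a a"
  by (simp add: cut_le_def)

lemma cut_le_trans: "cut_le y a b \<Longrightarrow> cut_le y b c \<Longrightarrow> cut_le y a c"
  unfolding cut_le_def using tr[of y a b c] by auto

lemma cut_le_total: "y \<in> X \<Longrightarrow> a \<in> X \<Longrightarrow> b \<in> X \<Longrightarrow> a \<noteq> y \<Longrightarrow> b \<noteq> y \<Longrightarrow> cut_le y a b \<or> cut_le y b a"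
  unfolding cut_le_def using total[of y a b] by auto

lemma notin_closed_arc_iff:
  assumes "y \<in> X" "a \<in> X" "b \<in> X"
  shows "y \<notin> closed_arc R a b \<longleftrightarrow> y \<noteq> a \<and> y \<noteq> b \<and> cut_le y a b"
proof (cases "a = b")
  case True
  then show ?thesis
    by (simp add: closed_arc_refl cut_le_refl)
next
  case False
  have "(b, y, a) \<in> R \<longleftrightarrow> (y, a, b) \<in> R"
    by (rule cyc_iff)
  then show ?thesis
    using compl_closed_arc[OF assms(2,3) False, of y] assms(1) distinct[of y a b] False
    unfolding cut_le_def by blast
qed

text \<open>On an arc that avoids \<open>y\<close>, circular betweenness is betweenness on the line
  cut at \<open>y\<close>. Both directions are transitivity after suitable rotations.\<close>

lemma between_cut:
  assumes "(y, a, b) \<in> R"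
  shows "(a, x, b) \<in> R \<longleftrightarrow> (y, a, x) \<in> R \<and> (y, x, b) \<in> R"
proof
  assume x: "(a, x, b) \<in> R"
  have "(a, x, y) \<in> R"
    using tr[OF x] cyc_iff(1)[of y a b] assms by blast
  moreover have "(b, y, x) \<in> R"
    using tr[of b y a x] cyc[OF cyc[OF assms]] cyc[OF cyc[OF x]] by blast
  ultimately show "(y, a, x) \<in> R \<and> (y, x, b) \<in> R"
    using cyc_iff(2)[of a x y] cyc_iff(1)[of b y x] by blast
next
  assume "(y, a, x) \<in> R \<and> (y, x, b) \<in> R"
  then have "(x, b, a) \<in> R"
    using tr[of x b y a] cyc_iff(1)[of y x b] cyc_iff(2)[of y a x] by blast
  then show "(a, x, b) \<in> R"
    using cyc_iff(2) by blast
qed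

lemma closed_arc_cut:
  assumes "y \<in> X" "a \<in> X" "b \<in> X" "y \<notin> closed_arc R a b"
  shows "x \<in> closed_arc R a b \<longleftrightarrow> cut_le y a x \<and> cut_le y x b"
proof (cases "a = b")
  case True
  then show ?thesis
    using asym[of y b x] cyc[of y x b] unfolding True closed_arc_refl cut_le_def by auto
next
  case False
  then have "(y, a, b) \<in> R"
    using assms notin_closed_arc_iff unfolding cut_le_def by blast
  then show ?thesis
    using between_cut[of y a b x] unfolding closed_arc_def cut_le_def by auto
qed

text \<open>Two closed intervals of the line cut at \<open>y\<close> lie in a third. Taking
  complements, the basic sets around \<open>y\<close> are directed downwards, which is what makes
  the generating family a base.\<close>

lemma closed_arc_union:
  assumes y: "y \<in> X" and X: "a \<in> X" "b \<in> X" "c \<in> X" "d \<in> X"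
    and ab: "y \<notin> closed_arc R a b" and cd: "y \<notin> closed_arc R c d"
  obtains e f where "e \<in> X" "f \<in> X" "y \<notin> closed_arc R e f"
    "closed_arc R a b \<subseteq> closed_arc R e f" "closed_arc R c d \<subseteq> closed_arc R e f"
proof -
  \<comment> \<open>On the line cut at \<open>y\<close>, \<open>e\<close> is the smaller of the left
    endpoints and \<open>f\<close> the larger of the right endpoints.\<close>
  define e where "e = (if cut_le y a c then a else c)"
  define f where "f = (if cut_le y b d then d else b)"
  have ab': "y \<noteq> a" "y \<noteq> b" "cut_le y a b" and cd': "y \<noteq> c" "y \<noteq> d" "cut_le y c d"
    using ab cd notin_closed_arc_iff X y by auto
  have ef: "e \<in> X" "f \<in> X" "y \<noteq> e" "y \<noteq> f"
    using X ab' cd' by (auto simp: e_def f_def)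
  have le: "cut_le y e a" "cut_le y e c" "cut_le y b f" "cut_le y d f"
    using cut_le_total[of y a c] cut_le_total[of y b d] X y ab' cd' cut_le_refl
    by (auto simp: e_def f_def)
  have "cut_le y e f"
    using le(1,3) ab'(3) cut_le_trans by blast
  then have nef: "y \<notin> closed_arc R e f"
    using notin_closed_arc_iff[OF y ef(1,2)] ef by simp
  show thesis
  proof
    show "closed_arc R a b \<subseteq> closed_arc R e f"
      unfolding subset_iff closed_arc_cut[OF y X(1,2) ab] closed_arc_cut[OF y ef(1,2) nef]
      using cut_le_trans[OF le(1)] cut_le_trans[OF _ le(3)] by simp
    show "closed_arc R c d \<subseteq> closed_arc R e f"
      unfolding subset_iff closed_arc_cut[OF y X(3,4) cd] closed_arc_cut[OF y ef(1,2) nef]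
      using cut_le_trans[OF le(2)] cut_le_trans[OF _ le(4)] by simp
  qed (use ef nef in auto)
qed

subsection \<open>Convex sets\<close>

lemma circ_convex_carrier: "circ_convex X R X"
  unfolding circ_convex_def using closed_arc_subset by simp

text \<open>On the line cut at \<open>b\<close> the set is the initial segment below
  \<open>a\<close>, or the whole line if \<open>a = b\<close>. Of two points of it, the arc from the
  smaller to the larger avoids \<open>b\<close> and stays in the segment.\<close>

lemma circ_convex_compl_closed_arc:
  assumes ab: "a \<in> X" "b \<in> X"
  shows "circ_convex X R (X - closed_arc R a b)"
proof -
  have *: "closed_arc R p q \<subseteq> X - closed_arc R a b"
    if p: "p \<in> X - closed_arc R a b" and q: "q \<in> X - closed_arc R a b" and pq: "cut_le b p q" for p q
  proof (cases "a = b")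
    case True
    have pX: "p \<in> X" "q \<in> X" and pqb: "b \<noteq> p" "b \<noteq> q"
      using p q True by (auto simp: closed_arc_refl)
    then have "b \<notin> closed_arc R p q"
      using notin_closed_arc_iff[OF ab(2) pX] pq by simp
    then show ?thesis
      using closed_arc_subset[OF pX] True by (auto simp: closed_arc_refl)
  next
    case False
    have pX: "p \<in> X" "q \<in> X" and pqb: "b \<noteq> p" "b \<noteq> q"
      using p q by (auto simp: closed_arc_def)
    have q': "(b, q, a) \<in> R"
      using compl_closed_arc[OF ab False] q by blast
    have nb: "b \<notin> closed_arc R p q"
      using notin_closed_arc_iff[OF ab(2) pX] pq pqb by simp
    show ?thesis
    proof
      fix x assume "x \<in> closed_arc R p q"
      then have "x = q \<or> (b, x, q) \<in> R"
        using closed_arc_cut[OF ab(2) pX nb] unfolding cut_le_def by blast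
      then have "(b, x, a) \<in> R"
        using q' tr by blast
      then show "x \<in> X - closed_arc R a b"
        using compl_closed_arc[OF ab False] by blast
    qed
  qed
  show ?thesis
    unfolding circ_convex_def
  proof (intro conjI ballI)
    fix p q assume pq: "p \<in> X - closed_arc R a b" "q \<in> X - closed_arc R a b"
    then have "cut_le b p q \<or> cut_le b q p"
      using cut_le_total[OF ab(2), of p q] by (auto simp: closed_arc_def)
    then show "closed_arc R p q \<subseteq> X - closed_arc R a b \<or> closed_arc R q p \<subseteq> X - closed_arc R a b"
      using * pq by blast
  qed blast
qed

text \<open>If the orientation changed, \<open>b\<close> and \<open>c\<close> would lie on opposite
  arcs between \<open>a\<close> and \<open>a'\<close>. One of these arcs is contained in the convex
  set, but \<open>b\<close> and \<open>c\<close> are outside it.\<close>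

lemma circ_convex_move:
  assumes A: "circ_convex X R A" "a \<in> A" "a' \<in> A" and bc: "b \<notin> A" "c \<notin> A" and abc: "(a, b, c) \<in> R"
  shows "(a', b, c) \<in> R"
proof (rule ccontr)
  assume "(a', b, c) \<notin> R"
  moreover have "a' \<in> X"
    using A(1,3) unfolding circ_convex_def by blast
  moreover have "a' \<noteq> b" "a' \<noteq> c"
    using A(3) bc by auto
  ultimately have a': "(a', c, b) \<in> R"
    using total[of a' b c] carrier[OF abc] distinct[OF abc] by blast
  have "(c, a, a') \<in> R"
    using tr[of c a b a'] cyc[OF cyc[OF abc]] cyc[OF a'] by blast
  then have c: "(a', c, a) \<in> R"
    using cyc by blast
  have "(b, a', a) \<in> R"
    using tr[of b a' c a] cyc[OF cyc[OF a']] cyc[OF abc] by blast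
  then have "(a, b, a') \<in> R"
    using cyc by blast
  with c have "b \<in> closed_arc R a a'" "c \<in> closed_arc R a' a"
    by (simp_all add: closed_arc_def)
  then show False
    using A bc unfolding circ_convex_def by blast
qed

text \<open>The three points are moved one at a time by \<open>circ_convex_move\<close>, a rotation
  bringing each of them to the front.\<close>

lemma circ_convex_triple:
  assumes conv: "circ_convex X R A" "circ_convex X R B" "circ_convex X R C"
    and disj: "A \<inter> B = {}" "B \<inter> C = {}" "A \<inter> C = {}"
    and a: "a \<in> A" "a' \<in> A" and b: "b \<in> B" "b' \<in> B" and c: "c \<in> C" "c' \<in> C"
    and abc: "(a, b, c) \<in> R"
  shows "(a', b', c') \<in> R"
proof -
  have "(a', b, c) \<in> R"
    using circ_convex_move[OF conv(1) a _ _ abc] disj b c by blast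
  then have "(b, c, a') \<in> R"
    by (rule cyc)
  then have "(b', c, a') \<in> R"
    using circ_convex_move[OF conv(2) b, of c a'] disj a c by blast
  then have "(c, a', b') \<in> R"
    by (rule cyc)
  then have "(c', a', b') \<in> R"
    using circ_convex_move[OF conv(3) c, of a' b'] disj a b by blast
  then show ?thesis
    by (rule cyc)
qed

subsection \<open>The interval topology\<close>

lemma topspace_interval_topology [simp]: "topspace (interval_topology X R) = X"
  unfolding interval_topology_def by auto

lemma openin_compl_closed_arc:
  "a \<in> X \<Longrightarrow> b \<in> X \<Longrightarrow> openin (interval_topology X R) (X - closed_arc R a b)"
  unfolding interval_topology_def by (intro topology_generated_by_Basis) blast

text \<open>The whole space is a separate alternative since complements of arcs need not cover it:
  on a one-point set they are all empty.\<close>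

definition basic_open :: "'a set \<Rightarrow> bool" where
  "basic_open C \<longleftrightarrow> C = X \<or> (\<exists>a\<in>X. \<exists>b\<in>X. C = X - closed_arc R a b)"

lemma basic_open_Int:
  assumes "basic_open C" "basic_open D" "y \<in> C" "y \<in> D"
  shows "\<exists>E. basic_open E \<and> y \<in> E \<and> E \<subseteq> C \<inter> D"
proof (cases "C = X \<or> D = X")
  case True
  have "C \<subseteq> X" "D \<subseteq> X"
    using assms unfolding basic_open_def by auto
  then show ?thesis
    using True assms by blast
next
  case False
  then obtain a b c d where X: "a \<in> X" "b \<in> X" "c \<in> X" "d \<in> X"
    and C: "C = X - closed_arc R a b" and D: "D = X - closed_arc R c d"
    using assms(1,2) unfolding basic_open_def by blast
  have y: "y \<in> X" "y \<notin> closed_arc R a b" "y \<notin> closed_arc R c d"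
    using C D assms(3,4) by auto
  obtain e f where "e \<in> X" "f \<in> X" "y \<notin> closed_arc R e f"
    "closed_arc R a b \<subseteq> closed_arc R e f" "closed_arc R c d \<subseteq> closed_arc R e f"
    using closed_arc_union[OF y(1) X y(2,3)] .
  then show ?thesis
    using y(1) C D unfolding basic_open_def by (intro exI[of _ "X - closed_arc R e f"]) auto
qed

text \<open>The topology is given as a generated one, so the base property is an induction over the
  generation; \<open>basic_open_Int\<close> is its intersection step.\<close>

lemma basic_open_neighbourhood:
  assumes "openin (interval_topology X R) V" "y \<in> V"
  shows "\<exists>C. basic_open C \<and> y \<in> C \<and> C \<subseteq> V"
proof -
  have "generate_topology_on (insert X {X - closed_arc R a b |a b. a \<in> X \<and> b \<in> X}) V"
    using assms(1) unfolding interval_topology_def by (rule openin_topology_generated_by)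
  then show ?thesis
    using assms(2)
  proof (induction arbitrary: y)
    case (Int V W)
    obtain C where C: "basic_open C" "y \<in> C" "C \<subseteq> V"
      using Int.IH(1)[of y] Int.prems by blast
    obtain D where D: "basic_open D" "y \<in> D" "D \<subseteq> W"
      using Int.IH(2)[of y] Int.prems by blast
    show ?case
      using basic_open_Int[OF C(1) D(1) C(2) D(2)] C(3) D(3) by blast
  next
    case (UN K)
    obtain V where V: "V \<in> K" "y \<in> V"
      using UN.prems by blast
    show ?case
      using UN.IH[OF V] V(1) by blast
  next
    case (Basis V)
    then have "basic_open V"
      unfolding basic_open_def by blast
    then show ?case
      using Basis by blast
  qed simp
qed

lemma convex_neighbourhood:
  assumes "openin (interval_topology X R) V" "y \<in> V"
  obtains C where "openin (interval_topology X R) C" "circ_convex X R C" "y \<in> C" "C \<subseteq> V"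
proof -
  obtain C where C: "basic_open C" "y \<in> C" "C \<subseteq> V"
    using basic_open_neighbourhood[OF assms] by blast
  have "openin (interval_topology X R) X"
    using openin_topspace[of "interval_topology X R"] by simp
  then have "openin (interval_topology X R) C" "circ_convex X R C"
    using C(1) openin_compl_closed_arc circ_convex_compl_closed_arc circ_convex_carrier
    unfolding basic_open_def by auto
  then show thesis
    using C that by blast
qed

text \<open>Two points divide the circle into two open arcs. Which neighbourhoods separate them
  depends on which of these arcs have points: an inhabited arc offers a cutting point, and an empty
  one is a gap.\<close>

lemma Hausdorff_interval_topology: "Hausdorff_space (interval_topology X R)"
  unfolding Hausdorff_space_def
proof (intro allI impI, elim conjE)
  fix x y assume "x \<in> topspace (interval_topology X R)" "y \<in> topspace (interval_topology X R)" "x \<noteq> y"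
  then have xy: "x \<in> X" "y \<in> X" "x \<noteq> y"
    by auto
  have sep: "\<exists>U V. openin (interval_topology X R) U \<and> openin (interval_topology X R) V \<and>
      x \<in> U \<and> y \<in> V \<and> disjnt U V"
    if "a \<in> X" "b \<in> X" "c \<in> X" "d \<in> X" "x \<in> X - closed_arc R a b" "y \<in> X - closed_arc R c d"
      "\<And>z. z \<in> X - closed_arc R a b \<Longrightarrow> z \<in> X - closed_arc R c d \<Longrightarrow> False" for a b c d
  proof (intro exI conjI)
    show "openin (interval_topology X R) (X - closed_arc R a b)"
      using that(1,2) by (rule openin_compl_closed_arc)
    show "openin (interval_topology X R) (X - closed_arc R c d)"
      using that(3,4) by (rule openin_compl_closed_arc)
    show "disjnt (X - closed_arc R a b) (X - closed_arc R c d)"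
      unfolding disjnt_iff using that(7) by metis
  qed (use that(5,6) in auto)
  consider (both) r s where "(x, r, y) \<in> R" "(y, s, x) \<in> R"
    | (right) r where "(x, r, y) \<in> R" "\<forall>s. (y, s, x) \<notin> R"
    | (left) s where "\<forall>r. (x, r, y) \<notin> R" "(y, s, x) \<in> R"
    | (neither) "\<forall>r. (x, r, y) \<notin> R" "\<forall>s. (y, s, x) \<notin> R"
    by blast
  then show "\<exists>U V. openin (interval_topology X R) U \<and> openin (interval_topology X R) V \<and>
      x \<in> U \<and> y \<in> V \<and> disjnt U V"
  proof cases
    \<comment> \<open>\<open>r\<close> and \<open>s\<close> cut the circle into two disjoint open
      arcs, one around \<open>x\<close> and the other around \<open>y\<close>.\<close>
    case both
    have rX: "r \<in> X" "s \<in> X"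
      using carrier both by blast+
    have "(x, r, s) \<in> R" "(y, s, r) \<in> R"
      using tr[OF both(1), of s] tr[OF both(2), of r] cyc_iff(1)[of y s x] cyc_iff(2)[of y s x]
        cyc_iff(1)[of x r y] cyc_iff(2)[of x r y] both by blast+
    then have sxr: "(s, x, r) \<in> R" and rys: "(r, y, s) \<in> R" and "r \<noteq> s"
      using cyc_iff(2)[of x r s] cyc_iff(2)[of y s r] distinct[of x r s] by auto
    note arc = compl_closed_arc[OF rX \<open>r \<noteq> s\<close>] compl_closed_arc[OF rX(2,1) \<open>r \<noteq> s\<close>[symmetric]]
    show ?thesis
    proof (rule sep[of r s s r])
      show False if "z \<in> X - closed_arc R r s" "z \<in> X - closed_arc R s r" for z
        using that asym[of s z r] unfolding arc by blast
    qed (use rX sxr rys arc in auto)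
  next
    \<comment> \<open>The arcs from \<open>s\<close> to \<open>y\<close> and from \<open>x\<close>
      to \<open>s\<close> could only meet in points between \<open>x\<close> and \<open>y\<close>,
      of which there are none. The case \<open>right\<close> is the same with \<open>x\<close> and
      \<open>y\<close> exchanged.\<close>
    case left
    have sX: "s \<in> X" "s \<noteq> x" "s \<noteq> y"
      using carrier[OF left(2)] distinct[OF left(2)] by auto
    have sxy: "(s, x, y) \<in> R" and xys: "(x, y, s) \<in> R"
      using cyc_iff[of y s x] cyc_iff(2)[of s x y] left(2) by blast+
    note arc = compl_closed_arc[OF xy(2) sX(1) sX(3)[symmetric]] compl_closed_arc[OF sX(1) xy(1) sX(2)]
    show ?thesis
    proof (rule sep[of y s s x])
      show False if "z \<in> X - closed_arc R y s" "z \<in> X - closed_arc R s x" for z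
        using that between_cut[OF sxy, of z] cyc_iff(2)[of x z s] left(1) unfolding arc by blast
    qed (use sX(1) xy sxy xys arc in auto)
  next
    case right
    have rX: "r \<in> X" "r \<noteq> x" "r \<noteq> y"
      using carrier[OF right(1)] distinct[OF right(1)] by auto
    have ryx: "(r, y, x) \<in> R" and yxr: "(y, x, r) \<in> R"
      using cyc_iff[of x r y] cyc_iff(2)[of r y x] right(1) by blast+
    note arc = compl_closed_arc[OF rX(1) xy(2) rX(3)] compl_closed_arc[OF xy(1) rX(1) rX(2)[symmetric]]
    show ?thesis
    proof (rule sep[of r y x r])
      show False if "z \<in> X - closed_arc R r y" "z \<in> X - closed_arc R x r" for z
        using that between_cut[OF ryx, of z] cyc_iff(2)[of y z r] right(2) unfolding arc by blast
    qed (use rX(1) xy ryx yxr arc in auto)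
  next
    \<comment> \<open>With both arcs empty there is no third point, and complements of points
      separate.\<close>
    case neither
    have False if "z \<in> X" "z \<noteq> x" "z \<noteq> y" for z
      using total[OF xy(1) that(1) xy(2)] that xy(3) neither cyc_iff(1)[of x y z] by blast
    then show ?thesis
      by (intro sep[of y y x x]) (use xy in \<open>auto simp: closed_arc_refl\<close>)
  qed
qed

text \<open>The three points have pairwise disjoint convex open neighbourhoods, to which
  \<open>circ_convex_triple\<close> applies.\<close>

lemma open_triple:
  assumes uvw: "(u, v, w) \<in> R"
  obtains U V W where "openin (interval_topology X R) U" "openin (interval_topology X R) V"
    "openin (interval_topology X R) W" "u \<in> U" "v \<in> V" "w \<in> W"
    "\<And>a b c. a \<in> U \<Longrightarrow> b \<in> V \<Longrightarrow> c \<in> W \<Longrightarrow> (a, b, c) \<in> R"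
proof -
  let ?T = "interval_topology X R"
  have sep: "\<exists>U V. openin ?T U \<and> openin ?T V \<and> x \<in> U \<and> y \<in> V \<and> U \<inter> V = {}"
    if "x \<in> X" "y \<in> X" "x \<noteq> y" for x y
    using Hausdorff_interval_topology that unfolding Hausdorff_space_def disjnt_def by simp
  have X: "u \<in> X" "v \<in> X" "w \<in> X" and ne: "u \<noteq> v" "v \<noteq> w" "u \<noteq> w"
    using carrier[OF uvw] distinct[OF uvw] by auto
  obtain A1 B1 where 1: "openin ?T A1" "openin ?T B1" "u \<in> A1" "v \<in> B1" "A1 \<inter> B1 = {}"
    using sep[OF X(1,2) ne(1)] by blast
  obtain B2 C2 where 2: "openin ?T B2" "openin ?T C2" "v \<in> B2" "w \<in> C2" "B2 \<inter> C2 = {}"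
    using sep[OF X(2,3) ne(2)] by blast
  obtain A3 C3 where 3: "openin ?T A3" "openin ?T C3" "u \<in> A3" "w \<in> C3" "A3 \<inter> C3 = {}"
    using sep[OF X(1,3) ne(3)] by blast
  obtain U where U: "openin ?T U" "circ_convex X R U" "u \<in> U" "U \<subseteq> A1 \<inter> A3"
    using convex_neighbourhood[OF openin_Int[OF 1(1) 3(1)], of u] 1 3 by blast
  obtain V where V: "openin ?T V" "circ_convex X R V" "v \<in> V" "V \<subseteq> B1 \<inter> B2"
    using convex_neighbourhood[OF openin_Int[OF 1(2) 2(1)], of v] 1 2 by blast
  obtain W where W: "openin ?T W" "circ_convex X R W" "w \<in> W" "W \<subseteq> C2 \<inter> C3"
    using convex_neighbourhood[OF openin_Int[OF 2(2) 3(2)], of w] 2 3 by blast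
  have disj: "U \<inter> V = {}" "V \<inter> W = {}" "U \<inter> W = {}"
    using U(4) V(4) W(4) 1(5) 2(5) 3(5) by blast+
  show thesis
  proof
    show "(a, b, c) \<in> R" if "a \<in> U" "b \<in> V" "c \<in> W" for a b c
      using circ_convex_triple[OF U(2) V(2) W(2) disj U(3) that(1) V(3) that(2) W(3) that(3) uvw] .
  qed (use U V W in auto)
qed

end

section \<open>Ultrafilters\<close>

lemma ultrafilter_exists:
  fixes F :: "'a filter"
  assumes "F \<noteq> bot"
  obtains G where "G \<le> F" "G \<noteq> bot" "\<And>P. eventually P G \<or> eventually (\<lambda>x. \<not> P x) G"
proof -
  let ?A = "{G. G \<le> F \<and> G \<noteq> bot}"
  have "\<exists>m\<in>?A. \<forall>a\<in>?A. a \<le> m \<longrightarrow> a = m"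
  \<comment> \<open>The order is reversed: the maximal element is a minimal proper filter, and
    chains are bounded by their infima.\<close>
  proof (rule predicate_Zorn[where P = "\<lambda>x y. y \<le> x"])
    show "partial_order_on ?A (relation_of (\<lambda>x y. y \<le> x) ?A)"
      unfolding partial_order_on_def preorder_on_def refl_on_def trans_def antisym_def relation_of_def
      by auto
    fix C assume C: "C \<in> Chains (relation_of (\<lambda>x y. y \<le> x) ?A)"
    show "\<exists>u\<in>?A. \<forall>a\<in>C. u \<le> a"
    proof (cases "C = {}")
      case True
      then show ?thesis using assms by auto
    next
      case False
      have sub: "C \<subseteq> ?A" and lin: "\<And>G H. G \<in> C \<Longrightarrow> H \<in> C \<Longrightarrow> G \<le> H \<or> H \<le> G"
        using C unfolding Chains_def relation_of_def by auto
      \<comment> \<open>A chain is directed, so what holds eventually for its infimum already does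
        so for one of its members; hence the infimum is proper.\<close>
      have "eventually P (Inf C) \<longleftrightarrow> (\<exists>G\<in>C. eventually P G)" for P
      proof (rule eventually_Inf_base[OF False])
        fix G H assume "G \<in> C" "H \<in> C"
        then show "\<exists>K\<in>C. K \<le> inf G H"
          using lin[of G H] by (auto simp: inf_absorb1 inf_absorb2 intro: bexI[of _ G] bexI[of _ H])
      qed
      then have "Inf C \<noteq> bot"
        using sub unfolding trivial_limit_def by auto
      moreover obtain G where "G \<in> C"
        using False by blast
      moreover have "G \<le> F"
        using sub \<open>G \<in> C\<close> by blast
      moreover have "\<forall>a\<in>C. Inf C \<le> a"
        by (simp add: Inf_lower)
      ultimately show ?thesis
        by (intro bexI[of _ "Inf C"]) (auto intro: order_trans)
    qed
  qed
  then obtain G where G: "G \<le> F" "G \<noteq> bot" and max: "\<And>H. H \<le> F \<Longrightarrow> H \<noteq> bot \<Longrightarrow> H \<le> G \<Longrightarrow> H = G"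
    by auto
  have "eventually P G \<or> eventually (\<lambda>x. \<not> P x) G" for P
  proof (rule disjCI)
    assume *: "\<not> eventually (\<lambda>x. \<not> P x) G"
    \<comment> \<open>Restricting \<open>G\<close> to the points where \<open>P\<close> holds leaves
      a proper filter, which by minimality is \<open>G\<close> itself.\<close>
    let ?H = "inf G (principal {x. P x})"
    have "?H \<noteq> bot"
      using * unfolding trivial_limit_def eventually_inf_principal by simp
    then have "?H = G"
      using max[of ?H] G(1) by (simp add: le_infI1)
    moreover have "eventually P ?H"
      unfolding eventually_inf_principal by simp
    ultimately show "eventually P G"
      by simp
  qed
  then show thesis
    using G that by blast
qed

text \<open>If all the \<open>P i\<close> failed, finiteness would make them fail simultaneously. In
  this way an ultrafilter selects a member of a finite uniform cover.\<close>

lemma ultrafilter_finite_union: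
  assumes ult: "\<And>P. eventually P G \<or> eventually (\<lambda>x. \<not> P x) G"
    and "finite I" "eventually (\<lambda>x. \<exists>i\<in>I. P i x) G" "G \<noteq> bot"
  shows "\<exists>i\<in>I. eventually (P i) G"
proof (rule ccontr)
  assume "\<not> (\<exists>i\<in>I. eventually (P i) G)"
  then have "\<forall>i\<in>I. eventually (\<lambda>x. \<not> P i x) G"
    using ult by blast
  then have "eventually (\<lambda>x. \<forall>i\<in>I. \<not> P i x) G"
    using assms(2) by (simp add: eventually_ball_finite)
  then have "eventually (\<lambda>x. False) G"
    using assms(3) by eventually_elim auto
  then show False
    using assms(4) by (simp add: trivial_limit_def)
qed

section \<open>Completions\<close>

lemma filter_mem_mono: "filter_mem A F \<Longrightarrow> A \<subseteq> B \<Longrightarrow> filter_mem B F"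
  unfolding filter_mem_def by (erule eventually_mono) auto

lemma filter_mem_Int: "filter_mem A F \<Longrightarrow> filter_mem B F \<Longrightarrow> filter_mem (A \<inter> B) F"
  unfolding filter_mem_def Int_iff by (rule eventually_conj)

lemma filter_mem_nonempty: "filter_mem A F \<Longrightarrow> F \<noteq> bot \<Longrightarrow> A \<noteq> {}"
  unfolding filter_mem_def trivial_limit_def by auto

lemma filter_mem_antimono: "filter_mem A G \<Longrightarrow> F \<le> G \<Longrightarrow> filter_mem A F"
  unfolding filter_mem_def by (rule filter_leD)

lemma completion_cauchy: "\<Phi> \<in> completion X U \<Longrightarrow> cauchy_on X U \<Phi>"
  unfolding completion_def by blast

lemma completion_member: "\<Phi> \<in> completion X U \<Longrightarrow> \<alpha> \<in> U \<Longrightarrow> \<exists>A\<in>\<alpha>. filter_mem A \<Phi>"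
  using completion_cauchy unfolding cauchy_on_def by fast

lemma cauchy_on_meet:
  assumes "cauchy_on X U \<Phi>" "filter_mem A \<Phi>" "filter_mem B \<Phi>"
  obtains x where "x \<in> X" "x \<in> A" "x \<in> B"
proof -
  have "filter_mem X \<Phi>"
    using assms(1) unfolding cauchy_on_def filter_mem_def by (simp add: le_principal)
  then have "filter_mem (X \<inter> (A \<inter> B)) \<Phi>"
    using assms by (intro filter_mem_Int)
  then have "X \<inter> (A \<inter> B) \<noteq> {}"
    using assms(1) filter_mem_nonempty unfolding cauchy_on_def by metis
  then show thesis
    using that by blast
qed

section \<open>Minimal Cauchy filters as roundings\<close>

context covering_uniformity
begin

text \<open>The filter generated by the uniform neighbourhoods of the members of \<open>F\<close>.
  For a Cauchy filter \<open>F\<close> it is the greatest Cauchy filter above \<open>F\<close> in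
  the library order, that is, the smallest one contained in \<open>F\<close> as a family of
  sets.\<close>

definition rounding :: "'a filter \<Rightarrow> 'a filter" where
  "rounding F = (INF p\<in>{A. filter_mem A F} \<times> U. principal (star (fst p) (snd p)))"

lemma eventually_rounding:
  "eventually P (rounding F) \<longleftrightarrow> (\<exists>A. filter_mem A F \<and> (\<exists>\<alpha>\<in>U. \<forall>x\<in>star A \<alpha>. P x))"
proof -
  have "eventually P (rounding F) \<longleftrightarrow>
    (\<exists>p\<in>{A. filter_mem A F} \<times> U. eventually P (principal (star (fst p) (snd p))))"
    unfolding rounding_def
  proof (rule eventually_INF_base)
    have "filter_mem UNIV F"
      by (simp add: filter_mem_def)
    then show "{A. filter_mem A F} \<times> U \<noteq> {}"
      using trivial_cover by auto
    fix p q assume p: "p \<in> {A. filter_mem A F} \<times> U" and q: "q \<in> {A. filter_mem A F} \<times> U"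
    obtain A \<alpha> B \<beta> where eq: "p = (A, \<alpha>)" "q = (B, \<beta>)"
      by (cases p, cases q)
    have 1: "filter_mem A F" "\<alpha> \<in> U" "filter_mem B F" "\<beta> \<in> U"
      using p q eq by auto
    obtain \<gamma> where \<gamma>: "\<gamma> \<in> U" "refines \<gamma> \<alpha>" "refines \<gamma> \<beta>"
      using common_refinement[OF 1(2,4)] by blast
    have "star (A \<inter> B) \<gamma> \<subseteq> star A \<alpha>"
      using star_mono[of "A \<inter> B" A \<gamma>] star_refinement_mono[OF \<gamma>(2), of A] by simp
    moreover have "star (A \<inter> B) \<gamma> \<subseteq> star B \<beta>"
      using star_mono[of "A \<inter> B" B \<gamma>] star_refinement_mono[OF \<gamma>(3), of B] by simp
    ultimately show "\<exists>r\<in>{A. filter_mem A F} \<times> U. principal (star (fst r) (snd r))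
        \<le> inf (principal (star (fst p) (snd p))) (principal (star (fst q) (snd q)))"
      using filter_mem_Int[OF 1(1,3)] \<gamma>(1) eq by (intro bexI[of _ "(A \<inter> B, \<gamma>)"]) auto
  qed
  then show ?thesis
    by (auto simp: eventually_principal)
qed

lemma filter_mem_rounding:
  "filter_mem B (rounding F) \<longleftrightarrow> (\<exists>A. filter_mem A F \<and> (\<exists>\<alpha>\<in>U. star A \<alpha> \<subseteq> B))"
  unfolding filter_mem_def[of B] eventually_rounding subset_iff Ball_def ..

text \<open>For a star refinement \<beta> of \<alpha>, the star of a \<beta>-member belonging to
  \<open>F\<close> belongs to the rounding and lies in a member of \<alpha>.\<close>

lemma cauchy_rounding:
  assumes F: "cauchy_on X U F"
  shows "cauchy_on X U (rounding F)"
  unfolding cauchy_on_def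
proof (intro conjI ballI)
  have X: "filter_mem X F"
    using F unfolding cauchy_on_def filter_mem_def by (simp add: le_principal)
  show "rounding F \<noteq> bot"
  proof
    assume "rounding F = bot"
    then have "filter_mem {} (rounding F)"
      by (simp add: filter_mem_def)
    then obtain A \<alpha> where A: "filter_mem A F" "\<alpha> \<in> U" "star A \<alpha> \<subseteq> {}"
      unfolding filter_mem_rounding by blast
    obtain x where x: "x \<in> X" "x \<in> A"
      using cauchy_on_meet[OF F A(1) A(1)] .
    then have "x \<in> star A \<alpha>"
      using in_star_self[OF A(2) x(1)] star_mono[of "{x}" A \<alpha>] by auto
    then show False
      using A(3) by simp
  qed
  show "rounding F \<le> principal X"
    unfolding le_principal filter_mem_def[symmetric] filter_mem_rounding
    using X trivial_cover star_subset[OF trivial_cover] by blast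
  fix \<alpha> assume "\<alpha> \<in> U"
  then obtain \<beta> where \<beta>: "\<beta> \<in> U" "star_refines \<beta> \<alpha>"
    using star_refinement by blast
  then obtain B where B: "B \<in> \<beta>" "filter_mem B F"
    using F unfolding cauchy_on_def by blast
  have "B \<noteq> {}"
    using filter_mem_nonempty[OF B(2)] F unfolding cauchy_on_def by blast
  then obtain A where "A \<in> \<alpha>" "star B \<beta> \<subseteq> A"
    using star_refinesD[OF \<beta>(2) B(1)] by blast
  then show "\<exists>A\<in>\<alpha>. filter_mem A (rounding F)"
    unfolding filter_mem_rounding using B(2) \<beta>(1) by blast
qed

text \<open>A member of \<alpha> that belongs to \<open>G\<close> also belongs to \<open>F\<close>,
  so it meets every \<open>A\<close> in \<open>F\<close> and is contained in the star of
  \<open>A\<close>.\<close>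

lemma rounding_greatest:
  assumes F: "cauchy_on X U F" and G: "cauchy_on X U G" and "F \<le> G"
  shows "G \<le> rounding F"
proof (rule filter_leI)
  fix P assume "eventually P (rounding F)"
  then obtain A \<alpha> where A: "filter_mem A F" "\<alpha> \<in> U" "\<forall>x\<in>star A \<alpha>. P x"
    unfolding eventually_rounding by blast
  obtain B where B: "B \<in> \<alpha>" "filter_mem B G"
    using G A(2) unfolding cauchy_on_def by blast
  obtain x where "x \<in> A" "x \<in> B"
    using cauchy_on_meet[OF F A(1) filter_mem_antimono[OF B(2) \<open>F \<le> G\<close>]] by blast
  then have "B \<subseteq> star A \<alpha>"
    using B(1) by (auto simp: star_def)
  then show "eventually P G"
    using A(3) by (intro eventually_mono[OF B(2)[unfolded filter_mem_def]]) blast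
qed

lemma le_rounding: "cauchy_on X U F \<Longrightarrow> F \<le> rounding F"
  by (rule rounding_greatest) auto

lemma rounding_in_completion:
  assumes F: "cauchy_on X U F"
  shows "rounding F \<in> completion X U"
  unfolding completion_def
proof (intro CollectI conjI allI impI)
  show "cauchy_on X U (rounding F)"
    using F by (rule cauchy_rounding)
  fix G assume G: "cauchy_on X U G \<and> rounding F \<le> G"
  then have "F \<le> G"
    using le_rounding[OF F] by (meson order_trans)
  then have "G \<le> rounding F"
    using rounding_greatest[OF F] G by blast
  then show "G = rounding F"
    using G by (simp add: antisym)
qed

lemma completion_rounding:
  assumes "\<Phi> \<in> completion X U"
  shows "rounding \<Phi> = \<Phi>"
  using assms cauchy_rounding[OF completion_cauchy[OF assms]] le_rounding[OF completion_cauchy[OF assms]]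
  unfolding completion_def by blast

text \<open>The working form of minimality: a minimal Cauchy filter equals its rounding, so each of
  its members is a uniform neighbourhood of another member.\<close>

lemma completion_mem_star:
  assumes "\<Phi> \<in> completion X U" "filter_mem A \<Phi>"
  obtains B \<alpha> where "filter_mem B \<Phi>" "\<alpha> \<in> U" "star B \<alpha> \<subseteq> A"
proof -
  have "filter_mem A (rounding \<Phi>)"
    unfolding completion_rounding[OF assms(1)] by (rule assms(2))
  then show thesis
    using that unfolding filter_mem_rounding by blast
qed

text \<open>In the library order \<open>sup\<close> intersects two filters as families of sets.
  Common members make this intersection Cauchy, and minimality identifies both filters with
  it.\<close>

lemma completion_eqI:
  assumes \<Phi>: "\<Phi> \<in> completion X U" and \<Psi>: "\<Psi> \<in> completion X U"
    and *: "\<And>\<alpha>. \<alpha> \<in> U \<Longrightarrow> \<exists>A\<in>\<alpha>. filter_mem A \<Phi> \<and> filter_mem A \<Psi>"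
  shows "\<Phi> = \<Psi>"
proof -
  have c: "cauchy_on X U \<Phi>" "cauchy_on X U \<Psi>"
    using \<Phi> \<Psi> by (auto intro: completion_cauchy)
  have "cauchy_on X U (sup \<Phi> \<Psi>)"
    unfolding cauchy_on_def
  proof (intro conjI ballI)
    show "sup \<Phi> \<Psi> \<noteq> bot"
      using c unfolding cauchy_on_def by simp
    show "sup \<Phi> \<Psi> \<le> principal X"
      using c unfolding cauchy_on_def by simp
    show "\<exists>A\<in>\<alpha>. filter_mem A (sup \<Phi> \<Psi>)" if "\<alpha> \<in> U" for \<alpha>
      using *[OF that] unfolding filter_mem_def eventually_sup .
  qed
  then have "sup \<Phi> \<Psi> = \<Phi>" "sup \<Phi> \<Psi> = \<Psi>"
    using \<Phi> \<Psi> unfolding completion_def by simp_all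
  then show ?thesis
    by simp
qed

text \<open>Some uniform cover has no member common to both filters. In a star refinement of it, two
  meeting members would both lie in one member of the original cover, which would then belong to
  both filters.\<close>

lemma completion_separation:
  assumes \<Phi>: "\<Phi> \<in> completion X U" and \<Psi>: "\<Psi> \<in> completion X U" and "\<Phi> \<noteq> \<Psi>"
  obtains \<alpha> where "\<alpha> \<in> U"
    "\<And>A B. A \<in> \<alpha> \<Longrightarrow> B \<in> \<alpha> \<Longrightarrow> filter_mem A \<Phi> \<Longrightarrow> filter_mem B \<Psi> \<Longrightarrow> A \<inter> B = {}"
proof -
  obtain \<alpha> where \<alpha>: "\<alpha> \<in> U" "\<And>A. A \<in> \<alpha> \<Longrightarrow> filter_mem A \<Phi> \<Longrightarrow> filter_mem A \<Psi> \<Longrightarrow> False"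
    using completion_eqI[OF \<Phi> \<Psi>] assms(3) by blast
  obtain \<beta> where \<beta>: "\<beta> \<in> U" "star_refines \<beta> \<alpha>"
    using star_refinement[OF \<alpha>(1)] by blast
  have "A \<inter> B = {}" if AB: "A \<in> \<beta>" "B \<in> \<beta>" "filter_mem A \<Phi>" "filter_mem B \<Psi>" for A B
  proof (rule ccontr)
    assume ne: "A \<inter> B \<noteq> {}"
    then obtain C where C: "C \<in> \<alpha>" "star A \<beta> \<subseteq> C"
      using star_refinesD[OF \<beta>(2) AB(1)] by blast
    have "A \<subseteq> star A \<beta>" "B \<subseteq> star A \<beta>"
      using AB(1,2) ne by (auto simp: star_def)
    then have "A \<subseteq> C" "B \<subseteq> C"
      using C(2) by auto
    then show False
      using \<alpha>(2)[OF C(1)] AB(3,4) filter_mem_mono by blast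
  qed
  then show thesis
    using \<beta>(1) that by blast
qed

subsection \<open>The uniformity of the completion\<close>

definition hat :: "'a set \<Rightarrow> 'a filter set" where
  "hat A = {\<Phi> \<in> completion X U. filter_mem A \<Phi>}"

lemma hat_mono: "A \<subseteq> B \<Longrightarrow> hat A \<subseteq> hat B"
  unfolding hat_def using filter_mem_mono by blast

lemma hat_empty: "hat {} = {}"
  unfolding hat_def using filter_mem_nonempty completion_cauchy unfolding cauchy_on_def by blast

lemma completion_uniformity_hat:
  "\<gamma> \<in> completion_uniformity X U \<longleftrightarrow>
    is_cover (completion X U) \<gamma> \<and> (\<exists>\<alpha>\<in>U. refines (hat ` \<alpha>) \<gamma>)"
proof -
  have "{{\<Phi> \<in> completion X U. filter_mem A \<Phi>} |A. A \<in> \<alpha>} = hat ` \<alpha>" for \<alpha>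
    unfolding hat_def by blast
  then show ?thesis
    unfolding completion_uniformity_def by simp
qed

lemma hat_cover:
  assumes "\<alpha> \<in> U"
  shows "is_cover (completion X U) (hat ` \<alpha>)"
  unfolding is_cover_def
proof
  show "\<Union>(hat ` \<alpha>) = completion X U"
  proof
    show "completion X U \<subseteq> \<Union>(hat ` \<alpha>)"
    proof
      fix \<Phi> assume \<Phi>: "\<Phi> \<in> completion X U"
      then obtain A where "A \<in> \<alpha>" "filter_mem A \<Phi>"
        using completion_cauchy assms unfolding cauchy_on_def by blast
      then show "\<Phi> \<in> \<Union>(hat ` \<alpha>)"
        using \<Phi> unfolding hat_def by blast
    qed
  qed (auto simp: hat_def)
qed (auto simp: hat_def)

lemma hat_in_completion_uniformity: "\<alpha> \<in> U \<Longrightarrow> hat ` \<alpha> \<in> completion_uniformity X U"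
  unfolding completion_uniformity_hat using hat_cover refines_refl by blast

lemma refines_hat:
  assumes "refines \<gamma> \<alpha>"
  shows "refines (hat ` \<gamma>) (hat ` \<alpha>)"
proof (rule refinesI)
  fix S assume "S \<in> hat ` \<gamma>" "S \<noteq> {}"
  then obtain C where C: "C \<in> \<gamma>" "C \<noteq> {}" "S = hat C"
    using hat_empty by auto
  then obtain A where "A \<in> \<alpha>" "C \<subseteq> A"
    using refinesD[OF assms] by blast
  then show "\<exists>B\<in>hat ` \<alpha>. S \<subseteq> B"
    unfolding C(3) using hat_mono[OF \<open>C \<subseteq> A\<close>] by blast
qed

text \<open>A filter in both \<open>hat A\<close> and \<open>hat B\<close> is proper, so
  \<open>A\<close> and \<open>B\<close> have a common point and \<open>A\<close> is part of the star
  of \<open>B\<close>.\<close>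

lemma star_hat_subset:
  assumes "\<alpha> \<in> U"
  shows "star (hat B) (hat ` \<alpha>) \<subseteq> hat (star B \<alpha>)"
proof
  fix \<Phi> assume "\<Phi> \<in> star (hat B) (hat ` \<alpha>)"
  then obtain A \<Psi> where A: "A \<in> \<alpha>" "\<Phi> \<in> hat A" "\<Psi> \<in> hat A" "\<Psi> \<in> hat B"
    unfolding star_def by blast
  have "cauchy_on X U \<Psi>" "filter_mem A \<Psi>" "filter_mem B \<Psi>"
    using A(3,4) completion_cauchy unfolding hat_def by auto
  then obtain x where "x \<in> A" "x \<in> B"
    using cauchy_on_meet by blast
  then have "A \<subseteq> star B \<alpha>"
    using A(1) unfolding star_def by blast
  then show "\<Phi> \<in> hat (star B \<alpha>)"
    using A(2) hat_mono[OF \<open>A \<subseteq> star B \<alpha>\<close>] by blast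
qed

lemma uniformity_on_completion: "uniformity_on (completion X U) (completion_uniformity X U)"
  unfolding uniformity_on_def
proof (intro conjI ballI allI impI)
  have "refines (hat ` {X}) {completion X U}"
    by (auto simp: refines_def hat_def)
  then have "\<exists>\<alpha>\<in>U. refines (hat ` \<alpha>) {completion X U}"
    using trivial_cover by blast
  then show "{completion X U} \<in> completion_uniformity X U"
    unfolding completion_uniformity_hat by (simp add: is_cover_def)
next
  fix \<gamma> \<delta> assume "\<gamma> \<in> completion_uniformity X U" "\<delta> \<in> completion_uniformity X U"
  then obtain \<alpha> \<beta> where 1: "\<alpha> \<in> U" "refines (hat ` \<alpha>) \<gamma>" "\<beta> \<in> U" "refines (hat ` \<beta>) \<delta>"
    unfolding completion_uniformity_hat by blast
  obtain \<epsilon> where \<epsilon>: "\<epsilon> \<in> U" "refines \<epsilon> \<alpha>" "refines \<epsilon> \<beta>"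
    using common_refinement[OF 1(1,3)] by blast
  have "refines (hat ` \<epsilon>) \<gamma>" "refines (hat ` \<epsilon>) \<delta>"
    using refines_trans[OF refines_hat[OF \<epsilon>(2)] 1(2)] refines_trans[OF refines_hat[OF \<epsilon>(3)] 1(4)] .
  then show "\<exists>\<epsilon>\<in>completion_uniformity X U. refines \<epsilon> \<gamma> \<and> refines \<epsilon> \<delta>"
    using hat_in_completion_uniformity[OF \<epsilon>(1)] by blast
next
  fix \<gamma> assume "\<gamma> \<in> completion_uniformity X U"
  then obtain \<alpha> where 1: "\<alpha> \<in> U" "refines (hat ` \<alpha>) \<gamma>"
    unfolding completion_uniformity_hat by blast
  obtain \<beta> where \<beta>: "\<beta> \<in> U" "star_refines \<beta> \<alpha>"
    using star_refinement[OF 1(1)] by blast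
  have "star_refines (hat ` \<beta>) (hat ` \<alpha>)"
  proof (rule star_refinesI)
    fix S assume "S \<in> hat ` \<beta>" "S \<noteq> {}"
    then obtain B where B: "B \<in> \<beta>" "S = hat B" "B \<noteq> {}"
      using hat_empty by auto
    obtain A where A: "A \<in> \<alpha>" "star B \<beta> \<subseteq> A"
      using star_refinesD[OF \<beta>(2) B(1,3)] by blast
    have "star (hat B) (hat ` \<beta>) \<subseteq> hat A"
      using star_hat_subset[OF \<beta>(1), of B] hat_mono[OF A(2)] by simp
    then show "\<exists>A\<in>hat ` \<alpha>. star S (hat ` \<beta>) \<subseteq> A"
      unfolding B(2) using A(1) by blast
  qed
  then have "star_refines (hat ` \<beta>) \<gamma>"
    unfolding star_refines_def using 1(2) by (rule refines_trans)
  then show "\<exists>\<beta>\<in>completion_uniformity X U. star_refines \<beta> \<gamma>"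
    using hat_in_completion_uniformity[OF \<beta>(1)] by blast
qed (auto simp: completion_uniformity_hat intro: refines_trans)

lemma hausdorff_completion:
  "hausdorff_uniformity (completion X U) (completion_uniformity X U)"
  unfolding hausdorff_uniformity_def
proof (intro ballI impI)
  fix \<Phi> \<Psi> assume ne: "\<Phi> \<in> completion X U" "\<Psi> \<in> completion X U" "\<Phi> \<noteq> \<Psi>"
  obtain \<alpha> where \<alpha>: "\<alpha> \<in> U" "\<And>A. A \<in> \<alpha> \<Longrightarrow> filter_mem A \<Phi> \<Longrightarrow> filter_mem A \<Psi> \<Longrightarrow> False"
    using completion_eqI[OF ne(1,2)] ne(3) by blast
  then have "\<Psi> \<notin> star {\<Phi>} (hat ` \<alpha>)"
    by (auto simp: star_singleton hat_def)
  then show "\<exists>\<alpha>\<in>completion_uniformity X U. \<Psi> \<notin> star {\<Phi>} \<alpha>"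
    using hat_in_completion_uniformity[OF \<alpha>(1)] by blast
qed

interpretation completion: covering_uniformity "completion X U" "completion_uniformity X U"
  by unfold_locales (rule uniformity_on_completion)

text \<open>Exchanges stars of the completion for the sets \<open>hat A\<close>. To find a star
  inside \<open>hat A\<close>, minimality is used: \<open>A\<close> contains the star of some
  \<open>B\<close> in \<Phi>, and \<open>star_hat_subset\<close> transfers this to the
  completion.\<close>

lemma openin_completion:
  "openin completion.utopology V \<longleftrightarrow>
    V \<subseteq> completion X U \<and> (\<forall>\<Phi>\<in>V. \<exists>A. filter_mem A \<Phi> \<and> hat A \<subseteq> V)"
  unfolding completion.openin_utopology
proof (intro conj_cong refl ball_cong iffI)
  fix \<Phi> assume V: "V \<subseteq> completion X U" "\<Phi> \<in> V"
  then have \<Phi>: "\<Phi> \<in> completion X U"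
    by blast
  {
    assume "\<exists>\<gamma>\<in>completion_uniformity X U. star {\<Phi>} \<gamma> \<subseteq> V"
    then obtain \<gamma> where "\<gamma> \<in> completion_uniformity X U" and "star {\<Phi>} \<gamma> \<subseteq> V"
      by blast
    moreover from this(1) obtain \<alpha> where "\<alpha> \<in> U" "refines (hat ` \<alpha>) \<gamma>"
      unfolding completion_uniformity_hat by blast
    ultimately have \<gamma>: "star {\<Phi>} \<gamma> \<subseteq> V" "\<alpha> \<in> U" "refines (hat ` \<alpha>) \<gamma>"
      by simp_all
    obtain A where A: "A \<in> \<alpha>" "filter_mem A \<Phi>"
      using completion_cauchy[OF \<Phi>] \<gamma>(2) unfolding cauchy_on_def by blast
    have "hat A \<subseteq> star {\<Phi>} (hat ` \<alpha>)"
      using A \<Phi> unfolding star_singleton hat_def by blast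
    also have "\<dots> \<subseteq> star {\<Phi>} \<gamma>"
      using \<gamma>(3) by (rule star_refinement_mono)
    finally show "\<exists>A. filter_mem A \<Phi> \<and> hat A \<subseteq> V"
      using A(2) \<gamma>(1) by blast
  next
    assume "\<exists>A. filter_mem A \<Phi> \<and> hat A \<subseteq> V"
    then obtain A where A: "filter_mem A \<Phi>" "hat A \<subseteq> V"
      by blast
    obtain B \<alpha> where B: "filter_mem B \<Phi>" "\<alpha> \<in> U" "star B \<alpha> \<subseteq> A"
      using completion_mem_star[OF \<Phi> A(1)] .
    have "star {\<Phi>} (hat ` \<alpha>) \<subseteq> star (hat B) (hat ` \<alpha>)"
      using B(1) \<Phi> by (intro star_mono) (simp add: hat_def)
    also have "\<dots> \<subseteq> hat (star B \<alpha>)"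
      using B(2) by (rule star_hat_subset)
    also have "\<dots> \<subseteq> V"
      using hat_mono[OF B(3)] A(2) by simp
    finally show "\<exists>\<gamma>\<in>completion_uniformity X U. star {\<Phi>} \<gamma> \<subseteq> V"
      using hat_in_completion_uniformity[OF B(2)] by blast
  }
qed

lemma compact_completion:
  assumes "precompact_uniformity U"
  shows "compact_space completion.utopology"
  unfolding compact_space_fip
proof (intro allI impI, elim conjE)
  let ?Z = "completion X U"
  fix \<C> assume closed: "\<forall>C\<in>\<C>. closedin completion.utopology C"
    and fip: "\<forall>\<F>. finite \<F> \<and> \<F> \<subseteq> \<C> \<longrightarrow> \<Inter>\<F> \<noteq> {}"
  show "\<Inter>\<C> \<noteq> {}"
  proof (cases "\<C> = {}")
    case False
    \<comment> \<open>The closed sets generate a filter that is proper by the finite intersection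
      property; an ultrafilter below it will yield the common point.\<close>
    define F where "F = (INF C\<in>\<C>. principal C)"
    have "F \<noteq> bot"
    proof
      assume "F = bot"
      then have "eventually (\<lambda>_. False) F"
        by simp
      then have "\<exists>\<D>\<subseteq>\<C>. finite \<D> \<and> eventually (\<lambda>_. False) (INF C\<in>\<D>. principal C)"
        unfolding F_def by (rule iffD1[OF eventually_INF])
      then obtain \<D> where D: "finite \<D>" "\<D> \<subseteq> \<C>" "eventually (\<lambda>_. False) (INF C\<in>\<D>. principal C)"
        by auto
      then have "eventually (\<lambda>_. False) (principal (\<Inter>\<D>))"
        by (simp add: INF_principal_finite)
      then have "\<Inter>\<D> = {}"
        unfolding eventually_principal by blast
      then show False
        using fip D by blast
    qed
    then obtain G where G: "G \<le> F" "G \<noteq> bot" and ult: "\<And>P. eventually P G \<or> eventually (\<lambda>x. \<not> P x) G"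
      using ultrafilter_exists by blast
    have GC: "eventually (\<lambda>\<Theta>. \<Theta> \<in> C) G" if "C \<in> \<C>" for C
    proof -
      have "F \<le> principal C"
        unfolding F_def using that by (rule INF_lower)
      then have "G \<le> principal C"
        using G(1) by (rule order_trans[rotated])
      then show ?thesis
        unfolding le_principal .
    qed
    \<comment> \<open>One member of the family is enough to see that \<open>G\<close> lives on the
      completion.\<close>
    obtain C where C: "C \<in> \<C>"
      using False by blast
    then have "C \<subseteq> ?Z"
      using closed closedin_subset[of completion.utopology C] by simp
    then have GZ: "eventually (\<lambda>\<Theta>. \<Theta> \<in> ?Z) G"
      by (intro eventually_mono[OF GC[OF C]]) blast
    \<comment> \<open>A set \<open>A\<close> belongs to \<Phi> iff \<open>G\<close>-almost every
      filter contains \<open>A\<close>: a filter on filters is contracted to a filter on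
      \<open>X\<close>. Its rounding is the point sought.\<close>
    define \<Phi> where "\<Phi> = Abs_filter (\<lambda>P. eventually (\<lambda>\<Theta>. eventually P \<Theta>) G)"
    have ev: "eventually P \<Phi> \<longleftrightarrow> eventually (\<lambda>\<Theta>. eventually P \<Theta>) G" for P
      unfolding \<Phi>_def
    proof (rule eventually_Abs_filter, rule is_filter.intro)
      show "eventually (\<lambda>\<Theta>. eventually (\<lambda>x. P x \<and> Q x) \<Theta>) G"
        if "eventually (\<lambda>\<Theta>. eventually P \<Theta>) G" "eventually (\<lambda>\<Theta>. eventually Q \<Theta>) G" for P Q
        using that by (rule eventually_elim2) (rule eventually_conj)
      show "eventually (\<lambda>\<Theta>. eventually Q \<Theta>) G"
        if *: "\<forall>x. P x \<longrightarrow> Q x" "eventually (\<lambda>\<Theta>. eventually P \<Theta>) G" for P Q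
      proof (rule eventually_mono[OF *(2)])
        show "eventually Q \<Theta>" if "eventually P \<Theta>" for \<Theta>
          using that by (rule eventually_mono) (use *(1) in blast)
      qed
    qed (rule always_eventually, simp)
    have cau: "cauchy_on X U \<Phi>"
      unfolding cauchy_on_def
    proof (intro conjI ballI)
      show "\<Phi> \<noteq> bot"
      proof
        assume "\<Phi> = bot"
        then have "eventually (\<lambda>\<Theta>. eventually (\<lambda>_. False) \<Theta>) G"
          using ev[of "\<lambda>_. False"] by simp
        with GZ have "eventually (\<lambda>_. False) G"
          by eventually_elim (use completion_cauchy in \<open>auto simp: cauchy_on_def trivial_limit_def\<close>)
        then show False
          using G(2) by simp
      qed
      have "eventually (\<lambda>\<Theta>. filter_mem X \<Theta>) G"
        using GZ by eventually_elim
          (use completion_cauchy in \<open>auto simp: cauchy_on_def filter_mem_def le_principal\<close>)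
      then show "\<Phi> \<le> principal X"
        unfolding le_principal ev filter_mem_def .
      fix \<alpha> assume "\<alpha> \<in> U"
      then obtain \<beta> where \<beta>: "\<beta> \<in> U" "finite \<beta>" "refines \<beta> \<alpha>"
        using assms unfolding precompact_uniformity_def by blast
      have "eventually (\<lambda>\<Theta>. \<exists>B\<in>\<beta>. filter_mem B \<Theta>) G"
        using GZ by eventually_elim (rule completion_member[OF _ \<beta>(1)])
      then obtain B where B: "B \<in> \<beta>" "eventually (filter_mem B) G"
        using ultrafilter_finite_union[OF ult \<beta>(2) _ G(2)] by blast
      \<comment> \<open>\<open>refines\<close> says nothing about an empty member; here emptiness is
        excluded because points of the completion are proper filters.\<close>
      have "B \<noteq> {}"
      proof
        assume "B = {}"
        from B(2) GZ have "eventually (\<lambda>\<Theta>. \<Theta> \<in> hat B) G"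
          by eventually_elim (simp add: hat_def)
        then show False
          using G(2) by (simp add: \<open>B = {}\<close> hat_empty)
      qed
      then obtain A where A: "A \<in> \<alpha>" "B \<subseteq> A"
        using refinesD[OF \<beta>(3) B(1)] by blast
      have "eventually (filter_mem A) G"
        using B(2) by eventually_elim (rule filter_mem_mono[OF _ A(2)])
      then show "\<exists>A\<in>\<alpha>. filter_mem A \<Phi>"
        unfolding filter_mem_def ev using A(1) by blast
    qed
    \<comment> \<open>If \<open>hat A\<close> were a neighbourhood of the rounding outside
      \<open>C\<close>, then \<open>A\<close> would belong to \<Phi>, and \<open>G\<close> would
      live on the disjoint sets \<open>hat A\<close> and \<open>C\<close>.\<close>
    have "rounding \<Phi> \<in> C" if C: "C \<in> \<C>" for C
    proof (rule ccontr)
      assume "rounding \<Phi> \<notin> C"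
      then have "rounding \<Phi> \<in> ?Z - C"
        using rounding_in_completion[OF cau] by blast
      moreover have "openin completion.utopology (?Z - C)"
        using closed C unfolding closedin_def by simp
      ultimately obtain A where A: "filter_mem A (rounding \<Phi>)" "hat A \<subseteq> ?Z - C"
        unfolding openin_completion by blast
      have "filter_mem A \<Phi>"
        using filter_mem_antimono[OF A(1) le_rounding[OF cau]] .
      then have "eventually (\<lambda>\<Theta>. filter_mem A \<Theta>) G"
        unfolding filter_mem_def ev .
      with GZ GC[OF C] have "eventually (\<lambda>_. False) G"
        by eventually_elim (use A(2) in \<open>auto simp: hat_def\<close>)
      then show False
        using G(2) by simp
    qed
    then show ?thesis
      by blast
  qed simp
qed

end

section \<open>The circular order of the completion\<close>

locale gco_space = compatible_space T U + circularly_ordered "topspace T" R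
  for T :: "'a topology" and U and R +
  assumes convex_base:
    "\<alpha> \<in> U \<Longrightarrow> \<exists>\<beta>\<in>U. (\<forall>B\<in>\<beta>. circ_convex (topspace T) R B) \<and> refines \<beta> \<alpha>"
begin

abbreviation Z where "Z \<equiv> completion (topspace T) U"
abbreviation ZR where "ZR \<equiv> completion_order R (topspace T) U"

interpretation completion: covering_uniformity Z "completion_uniformity (topspace T) U"
  by unfold_locales (rule uniformity_on_completion)

section \<open>Separating points of the completion by convex sets\<close>

lemma separation_refines:
  assumes sep: "\<And>A B. A \<in> \<alpha> \<Longrightarrow> B \<in> \<alpha> \<Longrightarrow> filter_mem A \<Phi> \<Longrightarrow> filter_mem B \<Psi> \<Longrightarrow> A \<inter> B = {}"
    and ref: "refines \<beta> \<alpha>" and A: "A \<in> \<beta>" "filter_mem A \<Phi>" and B: "B \<in> \<beta>" "filter_mem B \<Psi>"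
  shows "A \<inter> B = {}"
proof (rule ccontr)
  assume ne: "A \<inter> B \<noteq> {}"
  obtain A' where A': "A' \<in> \<alpha>" "A \<subseteq> A'"
    using refinesD[OF ref A(1)] ne by blast
  obtain B' where B': "B' \<in> \<alpha>" "B \<subseteq> B'"
    using refinesD[OF ref B(1)] ne by blast
  have "A' \<inter> B' = {}"
    using sep[OF A'(1) B'(1)] filter_mem_mono[OF A(2) A'(2)] filter_mem_mono[OF B(2) B'(2)] .
  then show False
    using ne A'(2) B'(2) by blast
qed

text \<open>Separation of a pair survives refinement, so one convex refinement of three separating
  covers serves all three pairs.\<close>

lemma convex_separation:
  assumes Z: "\<Phi> \<in> Z" "\<Psi> \<in> Z" "\<Theta> \<in> Z" and ne: "\<Phi> \<noteq> \<Psi>" "\<Psi> \<noteq> \<Theta>" "\<Phi> \<noteq> \<Theta>"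
  obtains \<beta> A B C where "\<beta> \<in> U" "\<forall>B\<in>\<beta>. circ_convex (topspace T) R B"
    "A \<in> \<beta>" "B \<in> \<beta>" "C \<in> \<beta>" "filter_mem A \<Phi>" "filter_mem B \<Psi>" "filter_mem C \<Theta>"
    "A \<inter> B = {}" "B \<inter> C = {}" "A \<inter> C = {}"
proof -
  obtain \<alpha>1 where 1: "\<alpha>1 \<in> U"
    "\<And>A B. A \<in> \<alpha>1 \<Longrightarrow> B \<in> \<alpha>1 \<Longrightarrow> filter_mem A \<Phi> \<Longrightarrow> filter_mem B \<Psi> \<Longrightarrow> A \<inter> B = {}"
    using completion_separation[OF Z(1,2) ne(1)] by metis
  obtain \<alpha>2 where 2: "\<alpha>2 \<in> U"
    "\<And>A B. A \<in> \<alpha>2 \<Longrightarrow> B \<in> \<alpha>2 \<Longrightarrow> filter_mem A \<Psi> \<Longrightarrow> filter_mem B \<Theta> \<Longrightarrow> A \<inter> B = {}"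
    using completion_separation[OF Z(2,3) ne(2)] by metis
  obtain \<alpha>3 where 3: "\<alpha>3 \<in> U"
    "\<And>A B. A \<in> \<alpha>3 \<Longrightarrow> B \<in> \<alpha>3 \<Longrightarrow> filter_mem A \<Phi> \<Longrightarrow> filter_mem B \<Theta> \<Longrightarrow> A \<inter> B = {}"
    using completion_separation[OF Z(1,3) ne(3)] by metis
  obtain \<alpha>4 where 4: "\<alpha>4 \<in> U" "refines \<alpha>4 \<alpha>1" "refines \<alpha>4 \<alpha>2"
    using common_refinement[OF 1(1) 2(1)] by blast
  obtain \<alpha> where \<alpha>: "\<alpha> \<in> U" "refines \<alpha> \<alpha>4" "refines \<alpha> \<alpha>3"
    using common_refinement[OF 4(1) 3(1)] by blast
  obtain \<beta> where \<beta>: "\<beta> \<in> U" "\<forall>B\<in>\<beta>. circ_convex (topspace T) R B" "refines \<beta> \<alpha>"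
    using convex_base[OF \<alpha>(1)] by blast
  have ref: "refines \<beta> \<alpha>1" "refines \<beta> \<alpha>2" "refines \<beta> \<alpha>3"
    using refines_trans[OF refines_trans[OF \<beta>(3) \<alpha>(2)] 4(2)]
      refines_trans[OF refines_trans[OF \<beta>(3) \<alpha>(2)] 4(3)] refines_trans[OF \<beta>(3) \<alpha>(3)] .
  obtain A where A: "A \<in> \<beta>" "filter_mem A \<Phi>"
    using completion_member[OF Z(1) \<beta>(1)] by blast
  obtain B where B: "B \<in> \<beta>" "filter_mem B \<Psi>"
    using completion_member[OF Z(2) \<beta>(1)] by blast
  obtain C where C: "C \<in> \<beta>" "filter_mem C \<Theta>"
    using completion_member[OF Z(3) \<beta>(1)] by blast
  show thesis
    using that[OF \<beta>(1,2) A(1) B(1) C(1) A(2) B(2) C(2)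
        separation_refines[OF 1(2) ref(1) A B] separation_refines[OF 2(2) ref(2) B C]
        separation_refines[OF 3(2) ref(3) A C]] .
qed

text \<open>Representatives need be neither convex nor disjoint: such sets can be chosen smaller, and
  the orientation of one triple of points then decides the orientation of all of them.\<close>

lemma completion_order_iff:
  "(\<Phi>, \<Psi>, \<Theta>) \<in> ZR \<longleftrightarrow> \<Phi> \<in> Z \<and> \<Psi> \<in> Z \<and> \<Theta> \<in> Z \<and>
    (\<exists>A B C. filter_mem A \<Phi> \<and> filter_mem B \<Psi> \<and> filter_mem C \<Theta> \<and>
      (\<forall>a\<in>A. \<forall>b\<in>B. \<forall>c\<in>C. (a, b, c) \<in> R))" (is "_ \<longleftrightarrow> ?rhs")
proof
  show ?rhs if "(\<Phi>, \<Psi>, \<Theta>) \<in> ZR"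
    using that unfolding completion_order_def mem_Collect_eq prod.case by blast
next
  assume rhs: ?rhs
  then obtain A B C where mem: "filter_mem A \<Phi>" "filter_mem B \<Psi>" "filter_mem C \<Theta>"
    and or: "\<And>a b c. a \<in> A \<Longrightarrow> b \<in> B \<Longrightarrow> c \<in> C \<Longrightarrow> (a, b, c) \<in> R"
    by blast
  have Z: "\<Phi> \<in> Z" "\<Psi> \<in> Z" "\<Theta> \<in> Z"
    using rhs by blast+
  note cau = Z[THEN completion_cauchy]
  obtain a b c where abc: "a \<in> A" "b \<in> B" "c \<in> C"
    using cauchy_on_meet[OF cau(1) mem(1) mem(1)] cauchy_on_meet[OF cau(2) mem(2) mem(2)]
      cauchy_on_meet[OF cau(3) mem(3) mem(3)] by metis
  \<comment> \<open>The definition demands distinct filters. Equal ones would give two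
    representatives a common point, and hence an oriented triple with a repeated entry.\<close>
  have "\<Phi> \<noteq> \<Psi>"
  proof
    assume "\<Phi> = \<Psi>"
    then obtain x where "x \<in> A" "x \<in> B"
      using cauchy_on_meet[OF cau(1) mem(1)] mem(2) by blast
    then show False
      using or[of x x c] abc(3) distinct by blast
  qed
  moreover have "\<Psi> \<noteq> \<Theta>"
  proof
    assume "\<Psi> = \<Theta>"
    then obtain x where "x \<in> B" "x \<in> C"
      using cauchy_on_meet[OF cau(2) mem(2)] mem(3) by blast
    then show False
      using or[of a x x] abc(1) distinct by blast
  qed
  moreover have "\<Phi> \<noteq> \<Theta>"
  proof
    assume "\<Phi> = \<Theta>"
    then obtain x where "x \<in> A" "x \<in> C"
      using cauchy_on_meet[OF cau(1) mem(1)] mem(3) by blast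
    then show False
      using or[of x b x] abc(2) distinct by blast
  qed
  ultimately have ne: "\<Phi> \<noteq> \<Psi>" "\<Psi> \<noteq> \<Theta>" "\<Phi> \<noteq> \<Theta>"
    by blast+
  obtain \<beta> A' B' C' where \<beta>: "\<beta> \<in> U" "\<forall>B\<in>\<beta>. circ_convex (topspace T) R B"
    and mem': "A' \<in> \<beta>" "B' \<in> \<beta>" "C' \<in> \<beta>" "filter_mem A' \<Phi>" "filter_mem B' \<Psi>" "filter_mem C' \<Theta>"
    and disj: "A' \<inter> B' = {}" "B' \<inter> C' = {}" "A' \<inter> C' = {}"
    using convex_separation[OF Z ne] .
  obtain a where a: "a \<in> A" "a \<in> A'"
    using cauchy_on_meet[OF cau(1) mem(1) mem'(4)] .
  obtain b where b: "b \<in> B" "b \<in> B'"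
    using cauchy_on_meet[OF cau(2) mem(2) mem'(5)] .
  obtain c where c: "c \<in> C" "c \<in> C'"
    using cauchy_on_meet[OF cau(3) mem(3) mem'(6)] .
  have conv: "circ_convex (topspace T) R A'" "circ_convex (topspace T) R B'"
    "circ_convex (topspace T) R C'"
    using \<beta>(2) mem' by blast+
  have "\<forall>x\<in>A'. \<forall>y\<in>B'. \<forall>z\<in>C'. (x, y, z) \<in> R"
    using circ_convex_triple[OF conv disj a(2) _ b(2) _ c(2) _ or[OF a(1) b(1) c(1)]] by simp
  then show "(\<Phi>, \<Psi>, \<Theta>) \<in> ZR"
    unfolding completion_order_def mem_Collect_eq prod.case
    by (intro conjI bexI[OF _ \<beta>(1)] bexI[OF _ mem'(1)] bexI[OF _ mem'(2)] bexI[OF _ mem'(3)])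
      (rule Z ne \<beta>(2) mem' disj)+
qed

text \<open>Totality of \<open>R\<close> orients one triple of points taken from disjoint convex
  representatives, and this orientation is that of all such triples.\<close>

lemma completion_order_total:
  assumes Z: "\<Phi> \<in> Z" "\<Psi> \<in> Z" "\<Theta> \<in> Z" and ne: "\<Phi> \<noteq> \<Psi>" "\<Psi> \<noteq> \<Theta>" "\<Phi> \<noteq> \<Theta>"
  shows "(\<Phi>, \<Psi>, \<Theta>) \<in> ZR \<or> (\<Phi>, \<Theta>, \<Psi>) \<in> ZR"
proof -
  obtain \<beta> A B C where \<beta>: "\<beta> \<in> U" "\<forall>B\<in>\<beta>. circ_convex (topspace T) R B"
    and mem: "A \<in> \<beta>" "B \<in> \<beta>" "C \<in> \<beta>" "filter_mem A \<Phi>" "filter_mem B \<Psi>" "filter_mem C \<Theta>"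
    and disj: "A \<inter> B = {}" "B \<inter> C = {}" "A \<inter> C = {}"
    using convex_separation[OF Z ne] .
  note cau = Z[THEN completion_cauchy]
  have conv: "circ_convex (topspace T) R A" "circ_convex (topspace T) R B"
    "circ_convex (topspace T) R C"
    using \<beta>(2) mem by blast+
  obtain a where a: "a \<in> A" "a \<in> topspace T"
    using cauchy_on_meet[OF cau(1) mem(4) mem(4)] .
  obtain b where b: "b \<in> B" "b \<in> topspace T"
    using cauchy_on_meet[OF cau(2) mem(5) mem(5)] .
  obtain c where c: "c \<in> C" "c \<in> topspace T"
    using cauchy_on_meet[OF cau(3) mem(6) mem(6)] .
  have "a \<noteq> b" "b \<noteq> c" "a \<noteq> c"
    using a b c disj by blast+
  then consider "(a, b, c) \<in> R" | "(a, c, b) \<in> R"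
    using total[OF a(2) b(2) c(2)] by blast
  then show ?thesis
  proof cases
    case 1
    have "\<forall>x\<in>A. \<forall>y\<in>B. \<forall>z\<in>C. (x, y, z) \<in> R"
      using circ_convex_triple[OF conv disj a(1) _ b(1) _ c(1) _ 1] by simp
    then show ?thesis
      unfolding completion_order_iff using Z mem(4-6) by blast
  next
    case 2
    have disj': "A \<inter> C = {}" "C \<inter> B = {}" "A \<inter> B = {}"
      using disj by blast+
    have "\<forall>x\<in>A. \<forall>z\<in>C. \<forall>y\<in>B. (x, z, y) \<in> R"
      using circ_convex_triple[OF conv(1,3,2) disj' a(1) _ c(1) _ b(1) _ 2] by simp
    then show ?thesis
      unfolding completion_order_iff using Z mem(4-6) by blast
  qed
qed

lemma circular_order_completion: "circular_order Z ZR"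
  unfolding circular_order_def
proof (intro conjI allI ballI impI)
  show "ZR \<subseteq> Z \<times> Z \<times> Z"
    unfolding completion_order_def by blast
next
  fix \<Phi> \<Psi> \<Theta> assume *: "(\<Phi>, \<Psi>, \<Theta>) \<in> ZR"
  then obtain A B C where 1: "filter_mem A \<Phi>" "filter_mem B \<Psi>" "filter_mem C \<Theta>"
    "\<And>a b c. a \<in> A \<Longrightarrow> b \<in> B \<Longrightarrow> c \<in> C \<Longrightarrow> (a, b, c) \<in> R" and Z: "\<Phi> \<in> Z" "\<Psi> \<in> Z" "\<Theta> \<in> Z"
    unfolding completion_order_iff by blast
  have "\<forall>b\<in>B. \<forall>c\<in>C. \<forall>a\<in>A. (b, c, a) \<in> R"
    using 1(4) cyc by simp
  then show "(\<Psi>, \<Theta>, \<Phi>) \<in> ZR"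
    unfolding completion_order_iff using 1 Z by blast
  show "(\<Theta>, \<Psi>, \<Phi>) \<notin> ZR"
  proof
    assume "(\<Theta>, \<Psi>, \<Phi>) \<in> ZR"
    then obtain C' B' A' where 2: "filter_mem C' \<Theta>" "filter_mem B' \<Psi>" "filter_mem A' \<Phi>"
      "\<And>c b a. c \<in> C' \<Longrightarrow> b \<in> B' \<Longrightarrow> a \<in> A' \<Longrightarrow> (c, b, a) \<in> R"
      unfolding completion_order_iff by blast
    obtain a where a: "a \<in> A" "a \<in> A'"
      using cauchy_on_meet[OF completion_cauchy[OF Z(1)] 1(1) 2(3)] .
    obtain b where b: "b \<in> B" "b \<in> B'"
      using cauchy_on_meet[OF completion_cauchy[OF Z(2)] 1(2) 2(2)] .
    obtain c where c: "c \<in> C" "c \<in> C'"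
      using cauchy_on_meet[OF completion_cauchy[OF Z(3)] 1(3) 2(1)] .
    show False
      using 1(4)[OF a(1) b(1) c(1)] 2(4)[OF c(2) b(2) a(2)] asym by blast
  qed
next
  fix \<Phi> \<Psi> \<Theta> \<Omega> assume *: "(\<Phi>, \<Psi>, \<Theta>) \<in> ZR \<and> (\<Phi>, \<Theta>, \<Omega>) \<in> ZR"
  then have Z: "\<Phi> \<in> Z" "\<Psi> \<in> Z" "\<Theta> \<in> Z" "\<Omega> \<in> Z"
    unfolding completion_order_iff by simp_all
  obtain A B C where 1: "filter_mem A \<Phi>" "filter_mem B \<Psi>" "filter_mem C \<Theta>"
    "\<And>a b c. a \<in> A \<Longrightarrow> b \<in> B \<Longrightarrow> c \<in> C \<Longrightarrow> (a, b, c) \<in> R"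
    using conjunct1[OF *] unfolding completion_order_iff by blast
  obtain A' C' D where 2: "filter_mem A' \<Phi>" "filter_mem C' \<Theta>" "filter_mem D \<Omega>"
    "\<And>a c d. a \<in> A' \<Longrightarrow> c \<in> C' \<Longrightarrow> d \<in> D \<Longrightarrow> (a, c, d) \<in> R"
    using conjunct2[OF *] unfolding completion_order_iff by blast
  \<comment> \<open>The two hypotheses provide different representatives of \<Theta>; a point common
    to both is the link for transitivity in \<open>R\<close>.\<close>
  obtain c where c: "c \<in> C" "c \<in> C'"
    using cauchy_on_meet[OF completion_cauchy[OF Z(3)] 1(3) 2(2)] .
  have "\<forall>a\<in>A \<inter> A'. \<forall>b\<in>B. \<forall>d\<in>D. (a, b, d) \<in> R"
  proof (intro ballI)
    fix a b d assume "a \<in> A \<inter> A'" "b \<in> B" "d \<in> D"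
    then show "(a, b, d) \<in> R"
      using tr[OF 1(4)[of a b c] 2(4)[of a c d]] c by simp
  qed
  then show "(\<Phi>, \<Psi>, \<Omega>) \<in> ZR"
    unfolding completion_order_iff using Z filter_mem_Int[OF 1(1) 2(1)] 1(2) 2(3) by blast
next
  fix \<Phi> \<Psi> \<Theta> assume "\<Phi> \<in> Z" "\<Psi> \<in> Z" "\<Theta> \<in> Z" "\<Phi> \<noteq> \<Psi> \<and> \<Psi> \<noteq> \<Theta> \<and> \<Phi> \<noteq> \<Theta>"
  then show "(\<Phi>, \<Psi>, \<Theta>) \<in> ZR \<or> (\<Phi>, \<Theta>, \<Psi>) \<in> ZR"
    using completion_order_total by simp
qed

interpretation Z: circularly_ordered Z ZR
  by unfold_locales (rule circular_order_completion)

text \<open>A representative \<open>B\<close> of the middle filter works equally for every filter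
  that contains \<open>B\<close>, so an open arc around \<Psi> contains all of
  \<open>hat B\<close>.\<close>

lemma openin_utopology_of_interval:
  assumes "openin (interval_topology Z ZR) V"
  shows "openin completion.utopology V"
proof -
  have arc: "openin completion.utopology (Z - closed_arc ZR \<Phi> \<Theta>)" if Z: "\<Phi> \<in> Z" "\<Theta> \<in> Z" for \<Phi> \<Theta>
    unfolding openin_completion
  proof (intro conjI ballI)
    fix \<Psi> assume \<Psi>: "\<Psi> \<in> Z - closed_arc ZR \<Phi> \<Theta>"
    show "\<exists>A. filter_mem A \<Psi> \<and> hat A \<subseteq> Z - closed_arc ZR \<Phi> \<Theta>"
    proof (cases "\<Phi> = \<Theta>")
      \<comment> \<open>The set is the complement of a point here, and a separating cover takes the
        place of orientation.\<close>
      case True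
      then have "\<Psi> \<in> Z" "\<Psi> \<noteq> \<Phi>"
        using \<Psi> by (auto simp: closed_arc_def)
      obtain \<alpha> where \<alpha>: "\<alpha> \<in> U"
        "\<And>A B. A \<in> \<alpha> \<Longrightarrow> B \<in> \<alpha> \<Longrightarrow> filter_mem A \<Psi> \<Longrightarrow> filter_mem B \<Phi> \<Longrightarrow> A \<inter> B = {}"
        using completion_separation[OF \<open>\<Psi> \<in> Z\<close> Z(1) \<open>\<Psi> \<noteq> \<Phi>\<close>] by metis
      obtain A where A: "A \<in> \<alpha>" "filter_mem A \<Psi>"
        using completion_member[OF \<open>\<Psi> \<in> Z\<close> \<alpha>(1)] by blast
      have "\<not> filter_mem A \<Phi>"
        using \<alpha>(2)[OF A(1,1,2)] filter_mem_nonempty[OF A(2)] completion_cauchy[OF \<open>\<Psi> \<in> Z\<close>]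
        unfolding cauchy_on_def by blast
      then have "hat A \<subseteq> Z - closed_arc ZR \<Phi> \<Theta>"
        unfolding True[symmetric] Z.closed_arc_refl hat_def by blast
      then show ?thesis
        using A(2) by blast
    next
      case False
      note arc = Z.compl_closed_arc[OF Z False]
      have "(\<Theta>, \<Psi>, \<Phi>) \<in> ZR"
        using \<Psi> unfolding arc .
      then obtain C B A where 1: "filter_mem C \<Theta>" "filter_mem B \<Psi>" "filter_mem A \<Phi>"
        "\<forall>c\<in>C. \<forall>b\<in>B. \<forall>a\<in>A. (c, b, a) \<in> R"
        unfolding completion_order_iff by blast
      have "hat B \<subseteq> Z - closed_arc ZR \<Phi> \<Theta>"
      proof
        fix \<Psi>' assume "\<Psi>' \<in> hat B"
        then have "\<Psi>' \<in> Z" "filter_mem B \<Psi>'"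
          unfolding hat_def by auto
        then show "\<Psi>' \<in> Z - closed_arc ZR \<Phi> \<Theta>"
          unfolding arc completion_order_iff using Z 1 by blast
      qed
      then show ?thesis
        using 1(2) by blast
    qed
  qed blast
  have "openin completion.utopology Z"
    using openin_topspace[of completion.utopology] by simp
  then have "\<forall>S\<in>insert Z {Z - closed_arc ZR a b |a b. a \<in> Z \<and> b \<in> Z}. openin completion.utopology S"
    using arc by blast
  then show ?thesis
    using generate_topology_on_coarsest[OF istopology_openin[of completion.utopology]]
      openin_topology_generated_by[OF assms[unfolded interval_topology_def]] by blast
qed

text \<open>The interval topology is Hausdorff and coarser than the compact uniform one, hence equal to it.\<close>

lemma interval_topology_completion:
  assumes "precompact_uniformity U"
  shows "interval_topology Z ZR = completion.utopology"
proof -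
  have "continuous_map completion.utopology (interval_topology Z ZR) (\<lambda>x. x)"
    unfolding continuous_map_def
  proof (intro conjI allI impI)
    fix V assume V: "openin (interval_topology Z ZR) V"
    then have "{x \<in> topspace completion.utopology. x \<in> V} = V"
      using openin_subset[OF V] by auto
    then show "openin completion.utopology {x \<in> topspace completion.utopology. x \<in> V}"
      using openin_utopology_of_interval[OF V] by simp
  qed simp
  then have "homeomorphic_map completion.utopology (interval_topology Z ZR) (\<lambda>x. x)"
    using compact_completion[OF assms] Z.Hausdorff_interval_topology
    by (rule continuous_imp_homeomorphic_map) auto
  then have "open_map completion.utopology (interval_topology Z ZR) (\<lambda>x. x)"
    by (rule homeomorphic_imp_open_map)
  then show ?thesis
    unfolding topology_eq open_map_def using openin_utopology_of_interval by auto
qed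

lemma compact_interval_topology_completion:
  assumes "precompact_uniformity U"
  shows "compact_space (interval_topology Z ZR)"
  unfolding interval_topology_completion[OF assms] by (rule compact_completion[OF assms])

lemma compatible_completion:
  assumes "precompact_uniformity U"
  shows "compatible_uniformity (interval_topology Z ZR) (completion_uniformity (topspace T) U)"
  unfolding interval_topology_completion[OF assms] compatible_uniformity_def
    completion.openin_utopology completion.topspace_utopology
  using uniformity_on_completion hausdorff_completion by blast

section \<open>The canonical map into the completion\<close>

lemma filter_mem_nhdsin: "x \<in> topspace T \<Longrightarrow> filter_mem A (nhdsin T x) \<longleftrightarrow> x \<in> uinterior A"
  unfolding filter_mem_def using eventually_nhdsin_star[of x "\<lambda>y. y \<in> A"]
  unfolding uinterior_def by blast

lemma nhdsin_in_completion:
  assumes x: "x \<in> topspace T"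
  shows "nhdsin T x \<in> Z"
proof -
  have c: "cauchy_on (topspace T) U (principal {x})"
    unfolding cauchy_on_def
  proof (intro conjI ballI)
    fix \<alpha> assume "\<alpha> \<in> U"
    then show "\<exists>A\<in>\<alpha>. filter_mem A (principal {x})"
      using member_containing[of \<alpha> x] x by (simp add: filter_mem_def eventually_principal)
  qed (use x in \<open>auto simp: principal_eq_bot_iff\<close>)
  have "eventually P (nhdsin T x) \<longleftrightarrow> eventually P (rounding (principal {x}))" for P
  proof
    assume "eventually P (nhdsin T x)"
    then show "eventually P (rounding (principal {x}))"
      unfolding eventually_nhdsin_star[OF x] eventually_rounding
      by (intro exI[of _ "{x}"]) (simp add: filter_mem_def eventually_principal)
  next
    assume "eventually P (rounding (principal {x}))"
    then obtain A \<alpha> where A: "filter_mem A (principal {x})" "\<alpha> \<in> U" "\<forall>y\<in>star A \<alpha>. P y"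
      unfolding eventually_rounding by blast
    then have "star {x} \<alpha> \<subseteq> star A \<alpha>"
      by (intro star_mono) (simp add: filter_mem_def eventually_principal)
    then show "eventually P (nhdsin T x)"
      unfolding eventually_nhdsin_star[OF x] using A(2,3) by blast
  qed
  then have "nhdsin T x = rounding (principal {x})"
    by (simp add: filter_eq_iff)
  then show ?thesis
    using rounding_in_completion[OF c] by simp
qed

lemma nhdsin_hat: "x \<in> topspace T \<Longrightarrow> nhdsin T x \<in> hat A \<longleftrightarrow> x \<in> uinterior A"
  unfolding hat_def using nhdsin_in_completion filter_mem_nhdsin by simp

lemma inj_on_nhdsin: "inj_on (nhdsin T) (topspace T)"
proof (rule inj_onI, rule ccontr)
  fix x y assume xy: "x \<in> topspace T" "y \<in> topspace T" "nhdsin T x = nhdsin T y" "x \<noteq> y"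
  then obtain \<alpha> where \<alpha>: "\<alpha> \<in> U" "y \<notin> star {x} \<alpha>"
    using hausdorff unfolding hausdorff_uniformity_def by blast
  have "filter_mem (star {x} \<alpha>) (nhdsin T x)"
    unfolding filter_mem_nhdsin[OF xy(1)] using \<alpha>(1) xy(1) by (rule in_uinterior_star)
  then have "y \<in> uinterior (star {x} \<alpha>)"
    unfolding xy(3) filter_mem_nhdsin[OF xy(2)] .
  then show False
    using \<alpha>(2) uinterior_subset[of "star {x} \<alpha>"] by blast
qed

text \<open>The trace of \<open>hat A\<close> on \<open>X\<close> is the uniform interior of
  \<open>A\<close>. Covers by such interiors are uniform and refine the covers that they come
  from.\<close>

lemma pullback_completion_uniformity:
  "pullback_uniformity (topspace T) (nhdsin T) (completion_uniformity (topspace T) U) = U"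
proof -
  let ?j = "\<lambda>\<beta>. {nhdsin T -` B \<inter> topspace T |B. B \<in> \<beta>}"
  have pre: "nhdsin T -` hat A \<inter> topspace T = uinterior A" for A
    using nhdsin_hat[of _ A] by (auto simp: uinterior_def)
  have eq: "?j (hat ` \<alpha>) = uinterior ` \<alpha>" for \<alpha>
    using pre by (auto simp: image_iff)
  show ?thesis
  proof (intro subset_antisym subsetI)
    fix \<alpha> assume \<alpha>: "\<alpha> \<in> pullback_uniformity (topspace T) (nhdsin T) (completion_uniformity (topspace T) U)"
    then obtain \<beta> where \<beta>: "\<beta> \<in> completion_uniformity (topspace T) U" "refines (?j \<beta>) \<alpha>"
      unfolding pullback_uniformity_def by blast
    then obtain \<delta> where \<delta>: "\<delta> \<in> U" "refines (hat ` \<delta>) \<beta>"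
      unfolding completion_uniformity_hat by blast
    have "refines (uinterior ` \<delta>) \<alpha>"
      using refines_trans[OF refines_vimage[OF \<delta>(2)] \<beta>(2)] unfolding eq .
    moreover have "is_cover (topspace T) \<alpha>"
      using \<alpha> unfolding pullback_uniformity_def by blast
    ultimately show "\<alpha> \<in> U"
      using coarser_cover[OF uinterior_cover[OF \<delta>(1)]] by blast
  next
    fix \<alpha> assume \<alpha>: "\<alpha> \<in> U"
    have "refines (?j (hat ` \<alpha>)) \<alpha>"
      unfolding eq using uinterior_subset by (intro refinesI) blast
    then show "\<alpha> \<in> pullback_uniformity (topspace T) (nhdsin T) (completion_uniformity (topspace T) U)"
      unfolding pullback_uniformity_def mem_Collect_eq
      using cover[OF \<alpha>] hat_in_completion_uniformity[OF \<alpha>] by (intro conjI bexI)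
  qed
qed

lemma bi_embedding_nhdsin:
  assumes "precompact_uniformity U"
  shows "bi_embedding R T Z ZR (nhdsin T)"
  unfolding bi_embedding_def
proof (intro conjI ballI)
  show "inj_on (nhdsin T) (topspace T)"
    by (rule inj_on_nhdsin)
  show "embedding_map T (interval_topology Z ZR) (nhdsin T)"
  proof (rule embedding_map_of_pullback[OF _ compatible_completion[OF assms] _ inj_on_nhdsin])
    show "compatible_uniformity T (pullback_uniformity (topspace T) (nhdsin T)
        (completion_uniformity (topspace T) U))"
      unfolding pullback_completion_uniformity
      using compatible_space_axioms compatible_space_iff by blast
    show "nhdsin T \<in> topspace T \<rightarrow> topspace (interval_topology Z ZR)"
      using nhdsin_in_completion by simp
  qed
  fix a b c assume X: "a \<in> topspace T" "b \<in> topspace T" "c \<in> topspace T"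
  \<comment> \<open>Representatives of neighbourhood filters contain the points themselves, so
    orientation is reflected. Preservation follows by totality: a reversed image would reflect to a
    reversed triple.\<close>
  have *: "(x, y, z) \<in> R"
    if X: "x \<in> topspace T" "y \<in> topspace T" "z \<in> topspace T"
      and Z: "(nhdsin T x, nhdsin T y, nhdsin T z) \<in> ZR" for x y z
  proof -
    obtain A B C where 1: "filter_mem A (nhdsin T x)" "filter_mem B (nhdsin T y)"
      "filter_mem C (nhdsin T z)" "\<forall>a\<in>A. \<forall>b\<in>B. \<forall>c\<in>C. (a, b, c) \<in> R"
      using Z unfolding completion_order_iff by blast
    have "x \<in> A" "y \<in> B" "z \<in> C"
      using 1(1-3) X filter_mem_nhdsin uinterior_subset by blast+
    then show ?thesis
      using 1(4) by blast
  qed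
  show "(a, b, c) \<in> R \<longleftrightarrow> (nhdsin T a, nhdsin T b, nhdsin T c) \<in> ZR"
  proof
    assume abc: "(a, b, c) \<in> R"
    then have "nhdsin T a \<noteq> nhdsin T b" "nhdsin T b \<noteq> nhdsin T c" "nhdsin T a \<noteq> nhdsin T c"
      using distinct[OF abc] inj_onD[OF inj_on_nhdsin _ X(1,2)] inj_onD[OF inj_on_nhdsin _ X(2,3)]
        inj_onD[OF inj_on_nhdsin _ X(1,3)] by blast+
    moreover have "(nhdsin T a, nhdsin T c, nhdsin T b) \<notin> ZR"
      using *[OF X(1,3,2)] asym[OF abc] cyc_iff(1)[of a c b] by blast
    ultimately show "(nhdsin T a, nhdsin T b, nhdsin T c) \<in> ZR"
      using completion_order_total[OF X[THEN nhdsin_in_completion]] by blast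
  qed (rule *[OF X])
qed

text \<open>If \<open>A\<close> contains the star of some \<open>B\<close> in \<Phi>, it is a
  neighbourhood of every point of \<open>B\<close>, so the images of these points lie in
  \<open>hat A\<close>.\<close>

lemma dense_nhdsin:
  assumes "precompact_uniformity U"
  shows "interval_topology Z ZR closure_of (nhdsin T ` topspace T) = Z"
  unfolding interval_topology_completion[OF assms]
proof
  show "completion.utopology closure_of (nhdsin T ` topspace T) \<subseteq> Z"
    using closure_of_subset_topspace[of completion.utopology] by simp
  show "Z \<subseteq> completion.utopology closure_of (nhdsin T ` topspace T)"
  proof
    fix \<Phi> assume \<Phi>: "\<Phi> \<in> Z"
    have "\<exists>y. y \<in> nhdsin T ` topspace T \<and> y \<in> V" if V: "\<Phi> \<in> V" "openin completion.utopology V" for V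
    proof -
      obtain A where A: "filter_mem A \<Phi>" "hat A \<subseteq> V"
        using V unfolding openin_completion by blast
      obtain B \<alpha> where B: "filter_mem B \<Phi>" "\<alpha> \<in> U" "star B \<alpha> \<subseteq> A"
        using completion_mem_star[OF \<Phi> A(1)] .
      obtain x where x: "x \<in> topspace T" "x \<in> B"
        using cauchy_on_meet[OF completion_cauchy[OF \<Phi>] B(1,1)] .
      have "star {x} \<alpha> \<subseteq> A"
        using star_mono[of "{x}" B \<alpha>] x(2) B(3) by simp
      then have "nhdsin T x \<in> hat A"
        unfolding nhdsin_hat[OF x(1)] uinterior_def using x(1) B(2) by blast
      then show ?thesis
        using A(2) x(1) by blast
    qed
    then show "\<Phi> \<in> completion.utopology closure_of (nhdsin T ` topspace T)"
      unfolding in_closure_of using \<Phi> by simp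
  qed
qed

lemma proper_cop_completion_cpt:
  assumes "precompact_uniformity U"
  shows "proper_cop R T (completion_cpt R T U)"
  unfolding proper_cop_def ctop_def completion_cpt_def compactification.simps
  using circular_order_completion compact_interval_topology_completion[OF assms]
    bi_embedding_nhdsin[OF assms] dense_nhdsin[OF assms] by blast

lemma unif_of_completion_cpt:
  assumes "precompact_uniformity U"
  shows "unif_of T (completion_cpt R T U) = U"
proof -
  have "the_uniformity (interval_topology Z ZR) = completion_uniformity (topspace T) U"
    using the_uniformity_eq_fine compatible_uniformity_eq_fine compatible_completion[OF assms]
      compact_interval_topology_completion[OF assms] Z.Hausdorff_interval_topology by metis
  then show ?thesis
    unfolding unif_of_def ctop_def completion_cpt_def compactification.simps
    by (simp add: pullback_completion_uniformity)
qed

end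

section \<open>Uniformities induced by compactifications\<close>

text \<open>The image under \<open>j\<close> of an arc lies in the arc between the images of its
  endpoints, so whichever arc \<open>C\<close> contains, the corresponding arc is in the
  preimage.\<close>

lemma circ_convex_vimage:
  assumes R: "R \<subseteq> X \<times> X \<times> X" and j: "j \<in> X \<rightarrow> Y"
    and or: "\<And>a b c. a \<in> X \<Longrightarrow> b \<in> X \<Longrightarrow> c \<in> X \<Longrightarrow> (a, b, c) \<in> R \<Longrightarrow> (j a, j b, j c) \<in> S"
    and C: "circ_convex Y S C"
  shows "circ_convex X R (j -` C \<inter> X)"
  unfolding circ_convex_def
proof (intro conjI ballI)
  fix a b assume ab: "a \<in> j -` C \<inter> X" "b \<in> j -` C \<inter> X"
  have *: "closed_arc R p q \<subseteq> j -` C \<inter> X"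
    if pq: "p \<in> X" "q \<in> X" "closed_arc S (j p) (j q) \<subseteq> C" for p q
  proof
    fix x assume x: "x \<in> closed_arc R p q"
    then have xX: "x \<in> X"
      using R pq(1,2) unfolding closed_arc_def by auto
    have "j x \<in> closed_arc S (j p) (j q)"
      using x or[OF pq(1) xX pq(2)] unfolding closed_arc_def by auto
    then show "x \<in> j -` C \<inter> X"
      using xX pq(3) by blast
  qed
  have "closed_arc S (j a) (j b) \<subseteq> C \<or> closed_arc S (j b) (j a) \<subseteq> C"
    using C ab unfolding circ_convex_def by simp
  then show "closed_arc R a b \<subseteq> j -` C \<inter> X \<or> closed_arc R b a \<subseteq> j -` C \<inter> X"
    using *[of a b] *[of b a] ab by blast
qed blast

locale cop_compactification =
  fixes R :: "('a \<times> 'a \<times> 'a) set" and T :: "'a topology" and c :: "('a, 'b) compactification"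
  assumes proper: "proper_cop R T c"
begin

sublocale circularly_ordered "points c" "circ c"
  using proper unfolding proper_cop_def by unfold_locales blast

lemma topspace_ctop [simp]: "topspace (ctop c) = points c"
  by (simp add: ctop_def)

lemma compact: "compact_space (ctop c)"
  and Hausdorff: "Hausdorff_space (ctop c)"
  and inj: "inj_on (emb c) (topspace T)"
  and embedding: "embedding_map T (ctop c) (emb c)"
  and dense: "ctop c closure_of (emb c ` topspace T) = points c"
  using proper Hausdorff_interval_topology unfolding proper_cop_def bi_embedding_def ctop_def by simp_all

lemma order_iff: "x \<in> topspace T \<Longrightarrow> y \<in> topspace T \<Longrightarrow> z \<in> topspace T \<Longrightarrow>
    (x, y, z) \<in> R \<longleftrightarrow> (emb c x, emb c y, emb c z) \<in> circ c"
  using proper unfolding proper_cop_def bi_embedding_def by simp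

lemma emb_funcset: "emb c \<in> topspace T \<rightarrow> points c"
  using continuous_map_funspace[OF embedding_map_continuous[OF embedding]] by simp

lemma dense_meets:
  assumes "openin (ctop c) V" "y \<in> V"
  obtains x where "x \<in> topspace T" "emb c x \<in> V"
proof -
  have "y \<in> points c"
    using openin_subset[OF assms(1)] assms(2) by auto
  then have "y \<in> ctop c closure_of (emb c ` topspace T)"
    by (simp add: dense)
  then have "\<exists>z. z \<in> emb c ` topspace T \<and> z \<in> V"
    using assms unfolding in_closure_of by blast
  then show thesis
    using that by blast
qed

text \<open>Compactness makes \<open>the_uniformity\<close> explicit, and an open refinement in the
  compactification can be pulled back along with the cover. Hence only traces of open covers need to
  be handled.\<close>

lemma unif_of_iff:
  "\<alpha> \<in> unif_of T c \<longleftrightarrow> is_cover (topspace T) \<alpha> \<and>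
    (\<exists>\<beta>. is_cover (points c) \<beta> \<and> (\<forall>B\<in>\<beta>. openin (ctop c) B) \<and>
      refines {emb c -` B \<inter> topspace T |B. B \<in> \<beta>} \<alpha>)"
proof -
  have "(\<exists>\<beta>\<in>fine_uniformity (ctop c). refines {emb c -` B \<inter> topspace T |B. B \<in> \<beta>} \<alpha>) \<longleftrightarrow>
    (\<exists>\<beta>. is_cover (points c) \<beta> \<and> (\<forall>B\<in>\<beta>. openin (ctop c) B) \<and>
      refines {emb c -` B \<inter> topspace T |B. B \<in> \<beta>} \<alpha>)" (is "?l \<longleftrightarrow> ?r")
  proof
    assume ?l
    then obtain \<beta> where \<beta>: "\<beta> \<in> fine_uniformity (ctop c)"
      "refines {emb c -` B \<inter> topspace T |B. B \<in> \<beta>} \<alpha>"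
      by blast
    obtain \<gamma> where \<gamma>: "is_cover (points c) \<gamma>" "\<forall>B\<in>\<gamma>. openin (ctop c) B" "refines \<gamma> \<beta>"
      using \<beta>(1) unfolding fine_uniformity_def by auto
    then show ?r
      using refines_trans[OF refines_vimage[OF \<gamma>(3)] \<beta>(2)] by blast
  next
    assume ?r
    then obtain \<beta> where "is_cover (points c) \<beta>" "\<forall>B\<in>\<beta>. openin (ctop c) B"
      "refines {emb c -` B \<inter> topspace T |B. B \<in> \<beta>} \<alpha>"
      by blast
    then show ?l
      using fine_uniformityI[of "ctop c" \<beta>] by auto
  qed
  then show ?thesis
    unfolding unif_of_def pullback_uniformity_def the_uniformity_eq_fine[OF compact Hausdorff] by simp
qed

lemma unif_ofI:
  assumes "is_cover (points c) \<beta>" "\<And>B. B \<in> \<beta> \<Longrightarrow> openin (ctop c) B"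
  shows "{emb c -` B \<inter> topspace T |B. B \<in> \<beta>} \<in> unif_of T c"
  unfolding unif_of_iff using is_cover_vimage[OF assms(1) emb_funcset] assms refines_refl by blast

lemma compatible_unif_of: "compatible_uniformity T (unif_of T c)"
  unfolding unif_of_def the_uniformity_eq_fine[OF compact Hausdorff]
  using compatible_uniformity_pullback[OF compatible_fine_uniformity[OF compact Hausdorff] embedding inj] .

lemma finite_convex_refinement:
  assumes R: "circular_order (topspace T) R" and \<alpha>: "\<alpha> \<in> unif_of T c"
  obtains \<gamma> where "\<gamma> \<in> unif_of T c" "finite \<gamma>" "\<forall>C\<in>\<gamma>. circ_convex (topspace T) R C" "refines \<gamma> \<alpha>"
proof -
  obtain \<beta> where \<beta>: "is_cover (points c) \<beta>" "\<forall>B\<in>\<beta>. openin (ctop c) B"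
    "refines {emb c -` B \<inter> topspace T |B. B \<in> \<beta>} \<alpha>"
    using \<alpha> unfolding unif_of_iff by blast
  have "\<exists>C. openin (ctop c) C \<and> circ_convex (points c) (circ c) C \<and> y \<in> C \<and> (\<exists>B\<in>\<beta>. C \<subseteq> B)"
    if y: "y \<in> points c" for y
  proof -
    obtain B where B: "B \<in> \<beta>" "y \<in> B"
      using is_coverD[OF \<beta>(1) y] by blast
    then have "openin (interval_topology (points c) (circ c)) B"
      using \<beta>(2) unfolding ctop_def by blast
    then obtain C where "openin (interval_topology (points c) (circ c)) C"
      "circ_convex (points c) (circ c) C" "y \<in> C" "C \<subseteq> B"
      using convex_neighbourhood[OF _ B(2)] by blast
    then show ?thesis
      unfolding ctop_def using B(1) by blast
  qed
  then obtain C where C: "\<And>y. y \<in> points c \<Longrightarrow>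
      openin (ctop c) (C y) \<and> circ_convex (points c) (circ c) (C y) \<and> y \<in> C y \<and> (\<exists>B\<in>\<beta>. C y \<subseteq> B)"
    by metis
  have "\<forall>V\<in>C ` points c. openin (ctop c) V" "topspace (ctop c) \<subseteq> \<Union>(C ` points c)"
    using C by auto
  then have "\<exists>\<F>. finite \<F> \<and> \<F> \<subseteq> C ` points c \<and> topspace (ctop c) \<subseteq> \<Union>\<F>"
    using compact unfolding compact_space_alt by meson
  then obtain \<F> where F: "finite \<F>" "\<F> \<subseteq> C ` points c" "points c \<subseteq> \<Union>\<F>"
    by auto
  let ?\<gamma> = "{emb c -` B \<inter> topspace T |B. B \<in> \<F>}"
  have op: "openin (ctop c) B" if "B \<in> \<F>" for B
    using that F(2) C by blast
  have "\<Union>\<F> \<subseteq> points c"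
    using openin_subset[OF op] by auto
  then have "is_cover (points c) \<F>"
    using F(3) unfolding is_cover_def by auto
  then have "?\<gamma> \<in> unif_of T c"
    using op by (rule unif_ofI)
  moreover have "finite ?\<gamma>"
    using F(1) by simp
  moreover have "\<forall>D\<in>?\<gamma>. circ_convex (topspace T) R D"
  proof
    fix D assume "D \<in> ?\<gamma>"
    then obtain B where B: "B \<in> \<F>" "D = emb c -` B \<inter> topspace T"
      by blast
    have conv: "circ_convex (points c) (circ c) B"
      using B(1) F(2) C by blast
    show "circ_convex (topspace T) R D"
      unfolding B(2)
      using conjunct1[OF R[unfolded circular_order_def]] emb_funcset iffD1[OF order_iff] conv
      by (rule circ_convex_vimage)
  qed
  moreover have "refines \<F> \<beta>"
    using F(2) C by (intro refinesI) blast
  then have "refines ?\<gamma> \<alpha>"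
    using refines_trans[OF refines_vimage \<beta>(3)] by blast
  ultimately show thesis
    using that by blast
qed

lemma unif_of_in_Unif_GCO:
  assumes "circular_order (topspace T) R"
  shows "unif_of T c \<in> Unif_GCO R T"
  unfolding Unif_GCO_def gco_uniformity_def precompact_uniformity_def
proof (intro CollectI conjI ballI)
  show "compatible_uniformity T (unif_of T c)"
    by (rule compatible_unif_of)
  fix \<alpha> assume "\<alpha> \<in> unif_of T c"
  then obtain \<gamma> where \<gamma>: "\<gamma> \<in> unif_of T c" "finite \<gamma>" "\<forall>C\<in>\<gamma>. circ_convex (topspace T) R C" "refines \<gamma> \<alpha>"
    using finite_convex_refinement[OF assms] by metis
  show "\<exists>\<beta>\<in>unif_of T c. (\<forall>B\<in>\<beta>. circ_convex (topspace T) R B) \<and> refines \<beta> \<alpha>"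
    using \<gamma> by blast
  show "\<exists>\<beta>\<in>unif_of T c. finite \<beta> \<and> refines \<beta> \<alpha>"
    using \<gamma> by blast
qed

end

section \<open>Domination of compactifications\<close>

text \<open>An open cover of the smaller compactification, pulled back along \<open>F\<close>, has
  the same traces on \<open>X\<close>, since \<open>F\<close> commutes with the embeddings.\<close>

lemma comp_le_imp_unif_of_subset:
  assumes c: "proper_cop R T c" and d: "proper_cop R T d" and le: "comp_le T c d"
  shows "unif_of T c \<subseteq> unif_of T d"
proof
  interpret c: cop_compactification R T c by unfold_locales (rule c)
  interpret d: cop_compactification R T d by unfold_locales (rule d)
  obtain F where F: "continuous_map (ctop d) (ctop c) F"
    and Fe: "\<And>x. x \<in> topspace T \<Longrightarrow> F (emb d x) = emb c x"
    using le unfolding comp_le_def by blast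
  fix \<alpha> assume "\<alpha> \<in> unif_of T c"
  then obtain \<beta> where cov: "is_cover (topspace T) \<alpha>" and \<beta>: "is_cover (points c) \<beta>"
    "\<forall>B\<in>\<beta>. openin (ctop c) B" "refines {emb c -` B \<inter> topspace T |B. B \<in> \<beta>} \<alpha>"
    unfolding c.unif_of_iff by blast
  let ?\<beta> = "{F -` B \<inter> points d |B. B \<in> \<beta>}"
  have eq: "emb d -` (F -` B \<inter> points d) \<inter> topspace T = emb c -` B \<inter> topspace T" for B
    using Fe d.emb_funcset by auto
  have "{emb d -` B \<inter> topspace T |B. B \<in> ?\<beta>} = (\<lambda>B. emb d -` (F -` B \<inter> points d) \<inter> topspace T) ` \<beta>"
    by (simp only: setcompr_eq_image image_image Collect_mem_eq)
  also have "\<dots> = {emb c -` B \<inter> topspace T |B. B \<in> \<beta>}"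
    by (simp only: setcompr_eq_image eq Collect_mem_eq)
  finally have 1: "{emb d -` B \<inter> topspace T |B. B \<in> ?\<beta>} = {emb c -` B \<inter> topspace T |B. B \<in> \<beta>}" .
  have "F \<in> points d \<rightarrow> points c"
    using continuous_map_funspace[OF F] by simp
  then have "is_cover (points d) ?\<beta>"
    using \<beta>(1) by (intro is_cover_vimage)
  moreover have "openin (ctop d) B" if B: "B \<in> ?\<beta>" for B
  proof -
    obtain B' where B': "B' \<in> \<beta>" "B = F -` B' \<inter> points d"
      using B by blast
    have "openin (ctop d) {x \<in> topspace (ctop d). F x \<in> B'}"
      using openin_continuous_map_preimage[OF F] \<beta>(2) B'(1) by blast
    moreover have "{x \<in> topspace (ctop d). F x \<in> B'} = B"
      using B'(2) by auto
    ultimately show ?thesis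
      by simp
  qed
  ultimately have "?\<beta> \<in> {\<beta>. is_cover (points d) \<beta> \<and> (\<forall>B\<in>\<beta>. openin (ctop d) B)}"
    by blast
  then show "\<alpha> \<in> unif_of T d"
    unfolding d.unif_of_iff using cov \<beta>(3) 1 by (intro conjI exI[of _ ?\<beta>]) auto
qed

text \<open>A point of the larger compactification has traces of neighbourhoods of arbitrarily small
  size in the smaller uniformity, so that the embedding into the smaller compactification has a
  limit there.\<close>

lemma unif_of_subset_imp_comp_le:
  assumes c: "proper_cop R T c" and d: "proper_cop R T d" and sub: "unif_of T c \<subseteq> unif_of T d"
  shows "comp_le T c d"
proof -
  interpret c: cop_compactification R T c by unfold_locales (rule c)
  interpret d: cop_compactification R T d by unfold_locales (rule d)
  let ?S = "emb d ` topspace T"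
  obtain h where h: "homeomorphic_maps T (subtopology (ctop d) ?S) (emb d) h"
    using d.embedding unfolding embedding_map_def homeomorphic_map_maps by blast
  have hc: "continuous_map (subtopology (ctop d) ?S) T h"
    and he: "\<And>x. x \<in> topspace T \<Longrightarrow> h (emb d x) = x"
    using h unfolding homeomorphic_maps_def by auto
  \<comment> \<open>\<open>h\<close> undoes \<open>emb d\<close> on its image, so \<open>?f\<close>
    is \<open>emb c\<close> transported to a dense subset of the larger compactification.\<close>
  let ?f = "emb c \<circ> h"
  have fc: "continuous_map (subtopology (ctop d) ?S) (ctop c) ?f"
    using continuous_map_compose[OF hc embedding_map_continuous[OF c.embedding]] .
  have lim: "\<exists>l. limitin (ctop c) ?f l (atin_within (ctop d) t ?S)" if t: "t \<in> points d - ?S" for t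
  proof (rule ccontr)
    assume no: "\<nexists>l. limitin (ctop c) ?f l (atin_within (ctop d) t ?S)"
    \<comment> \<open>Without a limit, each \<open>z\<close> has a neighbourhood that
      \<open>?f\<close> does not eventually enter. The contradiction comes from applying the
      inclusion of uniformities to the cover formed by these sets.\<close>
    have "\<exists>V. openin (ctop c) V \<and> z \<in> V \<and> \<not> eventually (\<lambda>x. ?f x \<in> V) (atin_within (ctop d) t ?S)"
      if z: "z \<in> points c" for z
      using no z unfolding limitin_def by auto
    then obtain V where V: "\<And>z. z \<in> points c \<Longrightarrow> openin (ctop c) (V z) \<and> z \<in> V z \<and>
        \<not> eventually (\<lambda>x. ?f x \<in> V z) (atin_within (ctop d) t ?S)"
      by metis
    let ?\<beta> = "V ` points c"
    have "V z \<subseteq> points c" if "z \<in> points c" for z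
      using openin_subset[of "ctop c" "V z"] V[OF that] by simp
    then have "is_cover (points c) ?\<beta>"
      using V unfolding is_cover_def by auto
    then have "{emb c -` B \<inter> topspace T |B. B \<in> ?\<beta>} \<in> unif_of T c"
      using V by (intro c.unif_ofI) blast+
    then have "{emb c -` B \<inter> topspace T |B. B \<in> ?\<beta>} \<in> unif_of T d"
      using sub by blast
    then obtain \<delta> where \<delta>: "is_cover (points d) \<delta>" "\<forall>D\<in>\<delta>. openin (ctop d) D"
      "refines {emb d -` D \<inter> topspace T |D. D \<in> \<delta>} {emb c -` B \<inter> topspace T |B. B \<in> ?\<beta>}"
      unfolding d.unif_of_iff by blast
    obtain D where D: "D \<in> \<delta>" "t \<in> D"
      using is_coverD[OF \<delta>(1)] t by blast
    have oD: "openin (ctop d) D"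
      using \<delta>(2) D(1) by blast
    \<comment> \<open>Density makes the trace of \<open>D\<close> nonempty, as
      \<open>refinesD\<close> requires.\<close>
    have ne: "emb d -` D \<inter> topspace T \<noteq> {}"
      using d.dense_meets[OF oD D(2)] by blast
    have "emb d -` D \<inter> topspace T \<in> {emb d -` D \<inter> topspace T |D. D \<in> \<delta>}"
      using D(1) by blast
    then have "\<exists>A\<in>{emb c -` B \<inter> topspace T |B. B \<in> ?\<beta>}. emb d -` D \<inter> topspace T \<subseteq> A"
      using ne by (rule refinesD[OF \<delta>(3)])
    then obtain z where z: "z \<in> points c" "emb d -` D \<inter> topspace T \<subseteq> emb c -` V z \<inter> topspace T"
      by blast
    have "?f x \<in> V z" if x: "x \<in> D" "x \<in> ?S" for x
    proof -
      obtain x' where x': "x' \<in> topspace T" "x = emb d x'"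
        using x(2) by blast
      then have "x' \<in> emb c -` V z \<inter> topspace T"
        using z(2) x(1) by blast
      then show ?thesis
        using he[OF x'(1)] x'(2) by simp
    qed
    then have "eventually (\<lambda>x. ?f x \<in> V z) (atin_within (ctop d) t ?S)"
      unfolding eventually_atin_within using oD D(2) by blast
    then show False
      using V[OF z(1)] by blast
  qed
  have "?S \<subseteq> points d" "points d \<subseteq> ctop d closure_of ?S"
    using d.emb_funcset d.dense by auto
  then obtain F where F: "continuous_map (subtopology (ctop d) (points d)) (ctop c) F"
    and Fe: "\<And>x. x \<in> ?S \<Longrightarrow> F x = ?f x"
    using continuous_map_extension_pointwise_alt[OF
        compact_Hausdorff_imp_regular_space[OF c.compact c.Hausdorff] _ _ fc lim] by metis
  have "continuous_map (ctop d) (ctop c) F"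
    using F subtopology_topspace[of "ctop d"] by simp
  moreover have "\<forall>x\<in>topspace T. F (emb d x) = emb c x"
    using Fe he by simp
  ultimately show ?thesis
    unfolding comp_le_def by blast
qed

lemma comp_le_iff:
  "proper_cop R T c \<Longrightarrow> proper_cop R T d \<Longrightarrow> comp_le T c d \<longleftrightarrow> unif_of T c \<subseteq> unif_of T d"
  using comp_le_imp_unif_of_subset unif_of_subset_imp_comp_le by blast

lemma homeomorphic_map_preserves_order:
  assumes c: "proper_cop R T c" and d: "proper_cop R T d"
    and h: "homeomorphic_map (ctop c) (ctop d) h"
    and he: "\<And>x. x \<in> topspace T \<Longrightarrow> h (emb c x) = emb d x"
    and uvw: "(u, v, w) \<in> circ c"
  shows "(h u, h v, h w) \<in> circ d"
proof (rule ccontr)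
  interpret c: cop_compactification R T c by unfold_locales (rule c)
  interpret d: cop_compactification R T d by unfold_locales (rule d)
  assume no: "(h u, h v, h w) \<notin> circ d"
  have hc: "continuous_map (ctop c) (ctop d) h" and inj: "inj_on h (points c)"
    and hp: "h ` points c = points d"
    using h homeomorphic_imp_continuous_map homeomorphic_imp_injective_map
      homeomorphic_imp_surjective_map by fastforce+
  have X: "u \<in> points c" "v \<in> points c" "w \<in> points c" and ne: "u \<noteq> v" "v \<noteq> w" "u \<noteq> w"
    using c.carrier[OF uvw] c.distinct[OF uvw] by auto
  have "h u \<in> points d" "h v \<in> points d" "h w \<in> points d"
    using hp X by blast+
  moreover have "h u \<noteq> h v" "h v \<noteq> h w" "h u \<noteq> h w"
    using inj_onD[OF inj _ X(1,2)] inj_onD[OF inj _ X(2,3)] inj_onD[OF inj _ X(1,3)] ne by blast+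
  \<comment> \<open>The images stay distinct, so an orientation that is lost is reversed. Both
    orientations are open conditions and can be compared on points of \<open>X\<close>.\<close>
  ultimately have huwv: "(h u, h w, h v) \<in> circ d"
    using d.total no by blast
  obtain U V W where 1: "openin (ctop c) U" "openin (ctop c) V" "openin (ctop c) W"
    "u \<in> U" "v \<in> V" "w \<in> W" "\<And>x y z. x \<in> U \<Longrightarrow> y \<in> V \<Longrightarrow> z \<in> W \<Longrightarrow> (x, y, z) \<in> circ c"
    using c.open_triple[OF uvw] unfolding ctop_def by metis
  obtain U' W' V' where 2: "openin (ctop d) U'" "openin (ctop d) W'" "openin (ctop d) V'"
    "h u \<in> U'" "h w \<in> W'" "h v \<in> V'"
    "\<And>x z y. x \<in> U' \<Longrightarrow> z \<in> W' \<Longrightarrow> y \<in> V' \<Longrightarrow> (x, z, y) \<in> circ d"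
    using d.open_triple[OF huwv] unfolding ctop_def by metis
  \<comment> \<open>The points of \<open>A\<close> that \<open>h\<close> maps into \<open>A'\<close>
    form an open set containing \<open>p\<close>, and by density this set contains the image of a
    point of \<open>X\<close>.\<close>
  have meet: "\<exists>x\<in>topspace T. emb c x \<in> A \<and> emb d x \<in> A'"
    if A: "openin (ctop c) A" "openin (ctop d) A'" "p \<in> A" "h p \<in> A'" for A A' p
  proof -
    have op: "openin (ctop c) (A \<inter> {q \<in> topspace (ctop c). h q \<in> A'})"
      using A(1) openin_continuous_map_preimage[OF hc A(2)] by (rule openin_Int)
    have p: "p \<in> A \<inter> {q \<in> topspace (ctop c). h q \<in> A'}"
      using openin_subset[OF A(1)] A(3,4) by blast
    obtain x where x: "x \<in> topspace T" "emb c x \<in> A \<inter> {q \<in> topspace (ctop c). h q \<in> A'}"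
      using c.dense_meets[OF op p] .
    then show ?thesis
      using he[OF x(1)] by auto
  qed
  obtain x where x: "x \<in> topspace T" "emb c x \<in> U" "emb d x \<in> U'"
    using meet[OF 1(1) 2(1) 1(4) 2(4)] by blast
  obtain y where y: "y \<in> topspace T" "emb c y \<in> V" "emb d y \<in> V'"
    using meet[OF 1(2) 2(3) 1(5) 2(6)] by blast
  obtain z where z: "z \<in> topspace T" "emb c z \<in> W" "emb d z \<in> W'"
    using meet[OF 1(3) 2(2) 1(6) 2(5)] by blast
  have "(x, y, z) \<in> R"
    using 1(7)[OF x(2) y(2) z(2)] c.order_iff[OF x(1) y(1) z(1)] by blast
  then have "(emb d x, emb d y, emb d z) \<in> circ d"
    using d.order_iff[OF x(1) y(1) z(1)] by blast
  then show False
    using 2(7)[OF x(3) z(3) y(3)] d.asym d.cyc_iff(1)[of "emb d x" "emb d z" "emb d y"] by blast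
qed

text \<open>Equal uniformities give domination in both directions. The two maps are mutually inverse
  on the dense images of \<open>X\<close>, hence everywhere by the Hausdorff property, and they
  preserve orientation.\<close>

lemma comp_equivalent_iff:
  assumes c: "proper_cop R T c" and d: "proper_cop R T d"
  shows "comp_equivalent T c d \<longleftrightarrow> unif_of T c = unif_of T d"
proof
  assume "comp_equivalent T c d"
  then obtain h where "homeomorphic_map (ctop c) (ctop d) h"
    and he: "\<And>x. x \<in> topspace T \<Longrightarrow> h (emb c x) = emb d x"
    unfolding comp_equivalent_def by blast
  then obtain k where hk: "homeomorphic_maps (ctop c) (ctop d) h k"
    unfolding homeomorphic_map_maps by blast
  interpret c: cop_compactification R T c by unfold_locales (rule c)
  have "k (emb d x) = emb c x" if "x \<in> topspace T" for x
  proof -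
    have "emb c x \<in> topspace (ctop c)"
      using c.emb_funcset that by auto
    then have "k (h (emb c x)) = emb c x"
      using hk unfolding homeomorphic_maps_def by blast
    then show ?thesis
      using he[OF that] by simp
  qed
  then have "comp_le T c d" "comp_le T d c"
    using hk he unfolding comp_le_def homeomorphic_maps_def by blast+
  then show "unif_of T c = unif_of T d"
    using comp_le_iff[OF c d] comp_le_iff[OF d c] by blast
next
  assume eq: "unif_of T c = unif_of T d"
  interpret c: cop_compactification R T c by unfold_locales (rule c)
  interpret d: cop_compactification R T d by unfold_locales (rule d)
  have "comp_le T d c" "comp_le T c d"
    using eq comp_le_iff[OF c d] comp_le_iff[OF d c] by auto
  then obtain h k where h: "continuous_map (ctop c) (ctop d) h"
    and he: "\<And>x. x \<in> topspace T \<Longrightarrow> h (emb c x) = emb d x"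
    and k: "continuous_map (ctop d) (ctop c) k"
    and ke: "\<And>x. x \<in> topspace T \<Longrightarrow> k (emb d x) = emb c x"
    unfolding comp_le_def by blast
  have kh: "k (h y) = y" if "y \<in> points c" for y
  proof -
    have "(k \<circ> h) y = id y"
    proof (rule forall_in_closure_of_eq[where S = "emb c ` topspace T" and f = "k \<circ> h" and g = id
          and Y = "ctop c"])
      show "y \<in> ctop c closure_of (emb c ` topspace T)"
        using that by (simp add: c.dense)
      show "(k \<circ> h) x = id x" if "x \<in> emb c ` topspace T" for x
        using that he ke by auto
    qed (rule c.Hausdorff continuous_map_compose[OF h k] continuous_map_id)+
    then show ?thesis
      by simp
  qed
  have hk: "h (k y) = y" if "y \<in> points d" for y
  proof -
    have "(h \<circ> k) y = id y"
    proof (rule forall_in_closure_of_eq[where S = "emb d ` topspace T" and f = "h \<circ> k" and g = id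
          and Y = "ctop d"])
      show "y \<in> ctop d closure_of (emb d ` topspace T)"
        using that by (simp add: d.dense)
      show "(h \<circ> k) x = id x" if "x \<in> emb d ` topspace T" for x
        using that he ke by auto
    qed (rule d.Hausdorff continuous_map_compose[OF k h] continuous_map_id)+
    then show ?thesis
      by simp
  qed
  have "homeomorphic_maps (ctop c) (ctop d) h k"
    unfolding homeomorphic_maps_def using h k kh hk by simp
  then have hh: "homeomorphic_map (ctop c) (ctop d) h" and hk': "homeomorphic_map (ctop d) (ctop c) k"
    unfolding homeomorphic_maps_map by blast+
  have "(u, v, w) \<in> circ c \<longleftrightarrow> (h u, h v, h w) \<in> circ d"
    if uvw: "u \<in> points c" "v \<in> points c" "w \<in> points c" for u v w
    using homeomorphic_map_preserves_order[OF c d hh he, of u v w]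
      homeomorphic_map_preserves_order[OF d c hk' ke, of "h u" "h v" "h w"] kh uvw by auto
  then show "comp_equivalent T c d"
    unfolding comp_equivalent_def using hh he by blast
qed

section \<open>The correspondence\<close>

lemma gco_spaceI:
  assumes "circular_order (topspace T) R" "\<U> \<in> Unif_GCO R T"
  shows "gco_space T \<U> R"
proof -
  have "compatible_space T \<U>"
    using assms(2) compatible_space_iff unfolding Unif_GCO_def gco_uniformity_def by blast
  moreover have "circularly_ordered (topspace T) R"
    using assms(1) by unfold_locales
  moreover have "gco_space_axioms T \<U> R"
    using assms(2) unfolding gco_space_axioms_def Unif_GCO_def gco_uniformity_def by blast
  ultimately show ?thesis
    by (rule gco_space.intro)
qed

lemma completion_cpt_of_Unif_GCO:
  assumes R: "circular_order (topspace T) R" and \<U>: "\<U> \<in> Unif_GCO R T"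
  shows "proper_cop R T (completion_cpt R T \<U>)"
    and "compatible_uniformity (ctop (completion_cpt R T \<U>)) (completion_uniformity (topspace T) \<U>)"
    and "unif_of T (completion_cpt R T \<U>) = \<U>"
proof -
  interpret gco_space T \<U> R
    using gco_spaceI[OF assms] .
  have pre: "precompact_uniformity \<U>"
    using \<U> unfolding Unif_GCO_def by blast
  show "proper_cop R T (completion_cpt R T \<U>)"
    using pre by (rule proper_cop_completion_cpt)
  show "compatible_uniformity (ctop (completion_cpt R T \<U>)) (completion_uniformity (topspace T) \<U>)"
    using compatible_completion[OF pre] by (simp add: ctop_def completion_cpt_def)
  show "unif_of T (completion_cpt R T \<U>) = \<U>"
    using pre by (rule unif_of_completion_cpt)
qed

text \<open>On proper compactifications the relation is the kernel of \<open>unif_of\<close>, which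
  makes it an equivalence at once.\<close>

lemma comp_equiv_rel_iff:
  "(c, d) \<in> comp_equiv_rel R T \<longleftrightarrow> proper_cop R T c \<and> proper_cop R T d \<and> unif_of T c = unif_of T d"
  unfolding comp_equiv_rel_def using comp_equivalent_iff by blast

lemma equiv_comp_equiv_rel: "equiv {c. proper_cop R T c} (comp_equiv_rel R T)"
  by (rule equivI) (auto simp: refl_on_def sym_def trans_def comp_equiv_rel_iff)

text \<open>The arbitrary choice is harmless: \<open>unif_of\<close> is constant on each equivalence
  class.\<close>

definition class_unif ::
  "'a topology \<Rightarrow> ('a, 'a filter) compactification set \<Rightarrow> 'a set set set" where
  "class_unif T K = unif_of T (SOME c. c \<in> K)"

lemma in_comp_class_iff:
  "proper_cop R T c \<Longrightarrow> d \<in> comp_class R T c \<longleftrightarrow> proper_cop R T d \<and> unif_of T c = unif_of T d"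
  unfolding comp_class_def by (simp add: comp_equiv_rel_iff)

lemma class_unif_comp_class:
  assumes "proper_cop R T c"
  shows "class_unif T (comp_class R T c) = unif_of T c"
proof -
  have "c \<in> comp_class R T c"
    using in_comp_class_iff[OF assms] assms by blast
  then have "(SOME d. d \<in> comp_class R T c) \<in> comp_class R T c"
    by (rule someI)
  then show ?thesis
    unfolding class_unif_def in_comp_class_iff[OF assms] by simp
qed

lemma Comp_COP_cases:
  assumes "K \<in> Comp_COP R T"
  obtains c where "proper_cop R T c" "K = comp_class R T c"
  using assms that unfolding Comp_COP_def comp_class_def by (auto elim: quotientE)

lemma comp_class_in_Comp_COP: "proper_cop R T c \<Longrightarrow> comp_class R T c \<in> Comp_COP R T"
  unfolding Comp_COP_def comp_class_def by (rule quotientI) simp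

text \<open>The order asks for some pair of comparable representatives; since \<open>unif_of\<close>
  is constant on classes, one pair is comparable iff every pair is.\<close>

lemma comp_order_iff:
  assumes K: "K \<in> Comp_COP R T" and L: "L \<in> Comp_COP R T"
  shows "(K, L) \<in> comp_order R T \<longleftrightarrow> class_unif T K \<subseteq> class_unif T L"
proof -
  obtain c where c: "proper_cop R T c" "K = comp_class R T c"
    using Comp_COP_cases[OF K] .
  obtain d where d: "proper_cop R T d" "L = comp_class R T d"
    using Comp_COP_cases[OF L] .
  have "(\<exists>c'\<in>K. \<exists>d'\<in>L. comp_le T c' d') \<longleftrightarrow> unif_of T c \<subseteq> unif_of T d"
  proof
    assume "\<exists>c'\<in>K. \<exists>d'\<in>L. comp_le T c' d'"
    then obtain c' d' where *: "c' \<in> K" "d' \<in> L" "comp_le T c' d'"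
      by blast
    then have "proper_cop R T c'" "unif_of T c = unif_of T c'" "proper_cop R T d'" "unif_of T d = unif_of T d'"
      using in_comp_class_iff[OF c(1)] in_comp_class_iff[OF d(1)] c(2) d(2) by auto
    then show "unif_of T c \<subseteq> unif_of T d"
      using comp_le_iff *(3) by metis
  next
    assume "unif_of T c \<subseteq> unif_of T d"
    then have "comp_le T c d"
      using comp_le_iff[OF c(1) d(1)] by simp
    moreover have "c \<in> K" "d \<in> L"
      using in_comp_class_iff[OF c(1)] in_comp_class_iff[OF d(1)] c d by auto
    ultimately show "\<exists>c'\<in>K. \<exists>d'\<in>L. comp_le T c' d'"
      by blast
  qed
  then show ?thesis
    unfolding comp_order_def using K L c d by (simp add: class_unif_comp_class)
qed

lemma class_unif_inj:
  assumes K: "K \<in> Comp_COP R T" and L: "L \<in> Comp_COP R T" and eq: "class_unif T K = class_unif T L"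
  shows "K = L"
proof -
  obtain c where c: "proper_cop R T c" "K = comp_class R T c"
    using Comp_COP_cases[OF K] .
  obtain d where d: "proper_cop R T d" "L = comp_class R T d"
    using Comp_COP_cases[OF L] .
  have "unif_of T c = unif_of T d"
    using eq c d by (simp add: class_unif_comp_class)
  then show ?thesis
    unfolding c(2) d(2) using in_comp_class_iff[OF c(1)] in_comp_class_iff[OF d(1)] by auto
qed

text \<open>All three properties are those of inclusion, transported along the injective map
  \<open>class_unif\<close>.\<close>

lemma partial_order_comp_order: "partial_order_on (Comp_COP R T) (comp_order R T)"
proof -
  have sub: "comp_order R T \<subseteq> Comp_COP R T \<times> Comp_COP R T"
    unfolding comp_order_def by blast
  have "refl_on (Comp_COP R T) (comp_order R T)"
    unfolding refl_on_def using comp_order_iff by blast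
  moreover have "trans (comp_order R T)"
  proof (rule transI)
    fix K L M assume *: "(K, L) \<in> comp_order R T" "(L, M) \<in> comp_order R T"
    then have KLM: "K \<in> Comp_COP R T" "L \<in> Comp_COP R T" "M \<in> Comp_COP R T"
      using sub by blast+
    show "(K, M) \<in> comp_order R T"
      using * comp_order_iff[OF KLM(1,2)] comp_order_iff[OF KLM(2,3)] comp_order_iff[OF KLM(1,3)]
      by simp
  qed
  moreover have "antisym (comp_order R T)"
  proof (rule antisymI)
    fix K L assume *: "(K, L) \<in> comp_order R T" "(L, K) \<in> comp_order R T"
    then have KL: "K \<in> Comp_COP R T" "L \<in> Comp_COP R T"
      using sub by blast+
    then have "class_unif T K = class_unif T L"
      using * comp_order_iff[OF KL] comp_order_iff[OF KL(2,1)] by blast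
    then show "K = L"
      using class_unif_inj[OF KL] by blast
  qed
  ultimately show ?thesis
    unfolding partial_order_on_def preorder_on_def using sub by blast
qed

lemma bij_betw_class_unif:
  assumes R: "circular_order (topspace T) R"
  shows "bij_betw (class_unif T) (Comp_COP R T) (Unif_GCO R T)"
  unfolding bij_betw_def
proof
  show "inj_on (class_unif T) (Comp_COP R T)"
    using class_unif_inj by (intro inj_onI)
  show "class_unif T ` Comp_COP R T = Unif_GCO R T"
  proof
    show "class_unif T ` Comp_COP R T \<subseteq> Unif_GCO R T"
    proof clarify
      fix K assume "K \<in> Comp_COP R T"
      then obtain c where c: "proper_cop R T c" "K = comp_class R T c"
        by (rule Comp_COP_cases)
      then show "class_unif T K \<in> Unif_GCO R T"
        using cop_compactification.unif_of_in_Unif_GCO[OF cop_compactification.intro[OF c(1)] R]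
        by (simp add: class_unif_comp_class)
    qed
    show "Unif_GCO R T \<subseteq> class_unif T ` Comp_COP R T"
    proof
      fix \<U> assume \<U>: "\<U> \<in> Unif_GCO R T"
      note cpt = completion_cpt_of_Unif_GCO[OF R \<U>]
      show "\<U> \<in> class_unif T ` Comp_COP R T"
        using class_unif_comp_class[OF cpt(1)] cpt(3) comp_class_in_Comp_COP[OF cpt(1)]
        by (intro image_eqI[of _ _ "comp_class R T (completion_cpt R T \<U>)"]) simp_all
    qed
  qed
qed

theorem theorem9p13:
  fixes R :: "('a \<times> 'a \<times> 'a) set" and T :: "'a topology"
  assumes "gcots TYPE('y) R T"
  shows
    "(\<forall>c :: ('a, 'b) compactification. proper_cop R T c \<longrightarrow>
        (\<exists>!\<V>. compatible_uniformity (ctop c) \<V>) \<and>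
        unif_of T c \<in> Unif_GCO R T \<and>
        comp_equivalent T (completion_cpt R T (unif_of T c)) c) \<and>
     (\<forall>\<U>\<in>Unif_GCO R T.
        proper_cop R T (completion_cpt R T \<U>) \<and>
        compatible_uniformity (ctop (completion_cpt R T \<U>))
          (completion_uniformity (topspace T) \<U>) \<and>
        unif_of T (completion_cpt R T \<U>) = \<U>) \<and>
     (\<forall>(c :: ('a, 'b) compactification) (d :: ('a, 'c) compactification).
        proper_cop R T c \<and> proper_cop R T d \<longrightarrow>
        (comp_le T c d \<longleftrightarrow> unif_of T c \<subseteq> unif_of T d)) \<and>
     equiv {c. proper_cop R T c} (comp_equiv_rel R T) \<and>
     partial_order_on (Comp_COP R T) (comp_order R T) \<and>
     (\<exists>\<Phi>. bij_betw \<Phi> (Comp_COP R T) (Unif_GCO R T) \<and>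
        (\<forall>c. proper_cop R T c \<longrightarrow> \<Phi> (comp_class R T c) = unif_of T c) \<and>
        (\<forall>\<U>\<in>Unif_GCO R T.
           inv_into (Comp_COP R T) \<Phi> \<U> = comp_class R T (completion_cpt R T \<U>)) \<and>
        (\<forall>K\<in>Comp_COP R T. \<forall>L\<in>Comp_COP R T.
           (K, L) \<in> comp_order R T \<longleftrightarrow> \<Phi> K \<subseteq> \<Phi> L))"
proof (intro conjI exI[of _ "class_unif T"] allI ballI impI)
  have R: "circular_order (topspace T) R"
    using assms unfolding gcots_def by blast
  note cpt = completion_cpt_of_Unif_GCO[OF R]
  {
    fix c :: "('a, 'b) compactification"
    assume c: "proper_cop R T c"
    interpret cop_compactification R T c
      by unfold_locales (rule c)
    show "\<exists>!\<V>. compatible_uniformity (ctop c) \<V>"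
      by (rule compact_Hausdorff_uniformity[OF compact Hausdorff])
    show U: "unif_of T c \<in> Unif_GCO R T"
      using R by (rule unif_of_in_Unif_GCO)
    \<comment> \<open>The points of \<open>c\<close> and of the completion have different types, but
      both compactifications induce the same uniformity on \<open>X\<close>.\<close>
    show "comp_equivalent T (completion_cpt R T (unif_of T c)) c"
      using comp_equivalent_iff[OF cpt(1)[OF U] c] cpt(3)[OF U] by simp
  }
  {
    fix \<U> assume \<U>: "\<U> \<in> Unif_GCO R T"
    show "proper_cop R T (completion_cpt R T \<U>)"
      "compatible_uniformity (ctop (completion_cpt R T \<U>)) (completion_uniformity (topspace T) \<U>)"
      "unif_of T (completion_cpt R T \<U>) = \<U>"
      using cpt[OF \<U>] .
    have "class_unif T (comp_class R T (completion_cpt R T \<U>)) = \<U>"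
      using class_unif_comp_class[OF cpt(1)[OF \<U>]] cpt(3)[OF \<U>] by simp
    then show "inv_into (Comp_COP R T) (class_unif T) \<U> = comp_class R T (completion_cpt R T \<U>)"
      using bij_betw_class_unif[OF R] comp_class_in_Comp_COP[OF cpt(1)[OF \<U>]]
      unfolding bij_betw_def by (intro inv_into_f_eq) blast+
  }
  show "bij_betw (class_unif T) (Comp_COP R T) (Unif_GCO R T)"
    using R by (rule bij_betw_class_unif)
  show "comp_le T c d \<longleftrightarrow> unif_of T c \<subseteq> unif_of T d" if "proper_cop R T c \<and> proper_cop R T d"
    for c :: "('a, 'b) compactification" and d :: "('a, 'c) compactification"
    using comp_le_iff that by blast
  show "(K, L) \<in> comp_order R T \<longleftrightarrow> class_unif T K \<subseteq> class_unif T L"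
    if "K \<in> Comp_COP R T" "L \<in> Comp_COP R T" for K L
    using that by (rule comp_order_iff)
  show "class_unif T (comp_class R T c) = unif_of T c" if "proper_cop R T c" for c
    using that by (rule class_unif_comp_class)
qed (rule equiv_comp_equiv_rel partial_order_comp_order)+

end
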